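(* Let $k\ge1$, let $f$ be a bounded, piecewise continuous probability density on $\mathbb{R}^d$, let $\mathcal{P}_\nu$ be a Poisson process with rate $\nu$ and density $f$, and let $V_{\ell,\nu}$ be the number of vertices of degree $\ell$ in the $k$-nearest-neighbor graph $G_k(\mathcal{P}_\nu)$. There exists $K>k$ such that for all $k\le\ell\le K$, \[ \lim_{\nu\to\infty}\frac1\nu\mathbb{E}[V_{\ell,\nu}]=p_\ell^*,\qquad p_\ell^*=\mathbb{P}\big(\deg(\mathbf{0};\mathcal{H}_1\cup\{\mathbf{0}\})=\ell\big), \] where $\mathcal{H}_1$ is a homogeneous Poisson process on $\mathbb{R}^d$ of rate $1$ (so $p_\ell^*$ depends on $d,k,\ell$ but not on $f$), and $\sum_{\ell=k}^Kp_\ell^*=1$. Similarly, if $\mathcal{X}_n$ consists of $n$ i.i.d. points with density $f$ and $V_{\ell,n}$ is the number of degree-$\ell$ vertices of $G_k(\mathcal{X}_n)$, then almost surely, for all $k\le\ell\le K$, \[ \lim_{n\to\infty}\frac1nV_{\ell,n}=\lim_{n\to\infty}\frac1n\mathbb{E}[V_{\ell,n}]=p_\ell^*. \]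
   Context: The $k$-nearest-neighbor graph $G_k(\mathcal{X})$ of a locally finite $\mathcal{X}\subset\mathbb{R}^d$ connects $x_1,x_2\in\mathcal{X}$ by an edge if $x_2$ is one of the $k$ nearest neighbors of $x_1$ or $x_1$ is one of the $k$ nearest neighbors of $x_2$. $\deg(x;\mathcal{X})$ is the degree of $x$ in $G_k(\mathcal{X})$. A Poisson process of rate $\nu$ and density $f$ consists of $\mathrm{Poisson}(\nu)$ many i.i.d. points of density $f$. *)

theory Defs
  imports "HOL-Probability.Probability"
begin

text \<open>y is one of the k nearest neighbours of x in X: y is a point of X other than x,
  and fewer than k points of X (other than x) are strictly closer to x than y.
  (Ties have probability zero in all random settings considered.)\<close>
definition knn :: "nat \<Rightarrow> ('a::metric_space) set \<Rightarrow> 'a \<Rightarrow> 'a \<Rightarrow> bool" where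
  "knn k X x y \<longleftrightarrow> y \<in> X \<and> y \<noteq> x \<and>
     finite {z \<in> X - {x}. dist x z < dist x y} \<and>
     card {z \<in> X - {x}. dist x z < dist x y} < k"

definition knn_edge :: "nat \<Rightarrow> ('a::metric_space) set \<Rightarrow> 'a \<Rightarrow> 'a \<Rightarrow> bool" where
  "knn_edge k X x y \<longleftrightarrow> x \<in> X \<and> y \<in> X \<and> x \<noteq> y \<and> (knn k X x y \<or> knn k X y x)"

definition knn_deg :: "nat \<Rightarrow> ('a::metric_space) set \<Rightarrow> 'a \<Rightarrow> nat" where
  "knn_deg k X x = card {y \<in> X. knn_edge k X x y}"

definition knn_count_deg :: "nat \<Rightarrow> nat \<Rightarrow> ('a::metric_space) set \<Rightarrow> nat" where
  "knn_count_deg k l X = card {x \<in> X. knn_deg k X x = l}"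

definition piecewise_continuous_Rd :: "('a::euclidean_space \<Rightarrow> real) \<Rightarrow> bool" where
  "piecewise_continuous_Rd f \<longleftrightarrow>
     (\<exists>\<A>. finite \<A> \<and> (\<forall>A\<in>\<A>. open A \<and> continuous_on A f) \<and> disjoint \<A> \<and>
          (UNIV - \<Union>\<A>) \<in> null_sets lborel)"

definition dens_measure :: "('a::euclidean_space \<Rightarrow> real) \<Rightarrow> 'a measure" where
  "dens_measure f = density lborel (\<lambda>x. ennreal (f x))"

definition iid_space :: "('a::euclidean_space \<Rightarrow> real) \<Rightarrow> (nat \<Rightarrow> 'a) measure" where
  "iid_space f = PiM UNIV (\<lambda>_. dens_measure f)"

definition V_iid :: "nat \<Rightarrow> nat \<Rightarrow> nat \<Rightarrow> (nat \<Rightarrow> 'a::euclidean_space) \<Rightarrow> real" where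
  "V_iid k l n \<omega> = real (knn_count_deg k l (\<omega> ` {..<n}))"

text \<open>Poisson process of rate nu and density f: Poisson(nu) many i.i.d. points.
  Realised as an independent pair (N, \<omega>) with N ~ Poisson(nu), \<omega> an i.i.d. sequence,
  and the process is {\<omega> i | i < N}.\<close>
definition poisson_space :: "real \<Rightarrow> ('a::euclidean_space \<Rightarrow> real) \<Rightarrow> (nat \<times> (nat \<Rightarrow> 'a)) measure" where
  "poisson_space \<nu> f = measure_pmf (poisson_pmf \<nu>) \<Otimes>\<^sub>M iid_space f"

definition V_poisson :: "nat \<Rightarrow> nat \<Rightarrow> nat \<times> (nat \<Rightarrow> 'a::euclidean_space) \<Rightarrow> real" where
  "V_poisson k l p = real (knn_count_deg k l (snd p ` {..<fst p}))"

text \<open>Homogeneous Poisson process of rate 1 on R^d (d = CARD('d)): independently for each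
  unit cube [c, c+1) with c in Z^d, a Poisson(1) number of i.i.d. uniform points in it.\<close>
definition unit_cube :: "int^('d::finite) \<Rightarrow> (real^'d) set" where
  "unit_cube c = {x. \<forall>i. real_of_int (c $ i) \<le> x $ i \<and> x $ i < real_of_int (c $ i) + 1}"

definition hpp_space :: "(int^('d::finite) \<Rightarrow> nat \<times> (nat \<Rightarrow> real^'d)) measure" where
  "hpp_space = PiM UNIV (\<lambda>c. measure_pmf (poisson_pmf 1) \<Otimes>\<^sub>M
                             PiM UNIV (\<lambda>_. uniform_measure lborel (unit_cube c)))"

definition hpp_points :: "(int^('d::finite) \<Rightarrow> nat \<times> (nat \<Rightarrow> real^'d)) \<Rightarrow> (real^'d) set" where
  "hpp_points \<omega> = (\<Union>c. snd (\<omega> c) ` {..<fst (\<omega> c)})"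

definition p_star :: "('d::finite) itself \<Rightarrow> nat \<Rightarrow> nat \<Rightarrow> real" where
  "p_star _ k l = measure (hpp_space :: (int^'d \<Rightarrow> nat \<times> (nat \<Rightarrow> real^'d)) measure)
      {\<omega> \<in> space hpp_space. knn_deg k (insert 0 (hpp_points \<omega>)) (0::real^'d) = l}"

end

theory Submission
  imports Defs "HOL-Library.Discrete_Functions"
begin

text \<open>
  The degree of a point is a local and scale-invariant functional. Cover the directions by finitely
  many cones of opening below 60 degrees: a point is among the \<open>k\<close> nearest neighbours of at most
  \<open>k\<close> points in each cone, which bounds all degrees, and if every cone at the origin contains \<open>k\<close>
  points within distance \<open>r\<close>, then the degree of the origin is determined by the configuration in the
  ball of radius \<open>2 r\<close>. At a continuity point \<open>x\<close> with \<open>f x > 0\<close> the sample, rescaled by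
  \<open>(n f x)\<close> to the power \<open>1/d\<close> and restricted to a bounded box, converges to the homogeneous Poisson
  process. For this, laws of point processes are written through the operators that integrate out one
  added point; these commute, so that the binomial process is a power of an affine operator, the
  Poisson process is an exponential, and superposition is the exponential law. Integrating over \<open>x\<close>
  gives convergence of expectations, first for the sample and then for its Poissonization.
  Changing one sample point changes the degree counts by a bounded amount, hence their variance is
  \<open>O(n)\<close>; this gives almost sure convergence along squares, and bounded increments fill the gaps.
\<close>

text \<open>Degrees are defined through sets and \<open>card\<close>, so laws enter only through
  bounded functionals that forget order and repetition of points. These functionals have no
  continuity, hence the rescaled intensities must converge in L1 on the window; dominated
  convergence gives this from continuity at \<open>x\<close> and the bound on \<open>f\<close>. The
  obstacle is the influence of sample points outside the window. No tail estimate for the sample is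
  made: stabilisation inside the window is itself such a functional, so its probability for the
  sample converges to the one for the Poisson process, and that is close to 1 since every cone
  almost surely contains infinitely many points. Likewise the identity that the limits sum to 1 is
  not computed for the Poisson process; it is the limit of the identity that the counts of all
  degrees from \<open>k\<close> to \<open>K\<close> add up to \<open>n\<close>. The bounded effect
  of one point on the counts rests on this: a new point takes at most one outgoing edge from each
  vertex, and only from vertices that now have it among their \<open>k\<close> nearest
  neighbours.\<close>

section \<open>Measurability of degrees\<close>

text \<open>Infinite sets satisfy this for every \<open>m\<close>, whereas \<open>card\<close> is \<open>0\<close> on them.\<close>

definition atleast :: "nat \<Rightarrow> 'a set \<Rightarrow> bool" where
  "atleast m A \<longleftrightarrow> (\<exists>T\<subseteq>A. finite T \<and> card T = m)"

lemma atleast_finite_iff: "finite A \<Longrightarrow> atleast m A \<longleftrightarrow> m \<le> card A"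
  unfolding atleast_def by (metis card_mono obtain_subset_with_card_n)

lemma atleast_infinite: "infinite A \<Longrightarrow> atleast m A"
  unfolding atleast_def using infinite_arbitrarily_large by blast

lemma not_atleast_iff: "\<not> atleast m A \<longleftrightarrow> finite A \<and> card A < m"
  by (metis atleast_finite_iff atleast_infinite not_le)

lemma atleast_mono: "atleast m A \<Longrightarrow> A \<subseteq> B \<Longrightarrow> atleast m B"
  unfolding atleast_def by blast

text \<open>On an infinite set \<open>card\<close> is 0 while \<open>atleast\<close> holds for every
  number, so for \<open>l \<ge> 1\<close> both sides are false. The restriction to positive degrees
  in the measurability statements comes from here.\<close>

lemma card_eq_iff_atleast:
  "finite A \<or> l \<ge> 1 \<Longrightarrow> card A = l \<longleftrightarrow> atleast l A \<and> \<not> atleast (Suc l) A"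
  by (cases "finite A") (auto simp: atleast_finite_iff atleast_infinite)

lemma knn_iff_atleast:
  "knn k X x y \<longleftrightarrow> y \<in> X \<and> y \<noteq> x \<and> \<not> atleast k {z \<in> X. z \<noteq> x \<and> dist x z < dist x y}"
proof -
  have "{z \<in> X - {x}. dist x z < dist x y} = {z \<in> X. z \<noteq> x \<and> dist x z < dist x y}" by auto
  then show ?thesis unfolding knn_def not_atleast_iff by auto
qed

text \<open>Subsets of a countable family are replaced by lists of indices, so that the existential
  quantifier ranges over a countable type and measurability becomes automatic. Distinctness is
  required of the values, since different indices may carry the same point.\<close>

lemma atleast_range_iff:
  "atleast m {y. (\<exists>i. b i \<and> y = p i) \<and> Q y} \<longleftrightarrow>
   (\<exists>is. length is = m \<and> (\<forall>j<m. b (is ! j) \<and> Q (p (is ! j))) \<and>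
      (\<forall>j<m. \<forall>j'<m. j \<noteq> j' \<longrightarrow> p (is ! j) \<noteq> p (is ! j')))" (is "?L \<longleftrightarrow> ?R")
proof
  assume ?L
  then obtain T where T: "T \<subseteq> {y. (\<exists>i. b i \<and> y = p i) \<and> Q y}" "finite T" "card T = m"
    unfolding atleast_def by blast
  obtain ys where ys: "set ys = T" "distinct ys"
    using T(2) finite_distinct_list by blast
  have len: "length ys = m" using ys T distinct_card by fastforce
  have "\<forall>y\<in>T. \<exists>i. b i \<and> y = p i" using T by blast
  then obtain g where g: "\<And>y. y \<in> T \<Longrightarrow> b (g y) \<and> y = p (g y)" by metis
  have nth: "ys ! j \<in> T" if "j < m" for j using ys len that by auto
  show ?R
  proof (intro exI[of _ "map g ys"] conjI allI impI)
    show "length (map g ys) = m" using len by simp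
    fix j assume j: "j < m"
    then show "b (map g ys ! j)" "Q (p (map g ys ! j))"
      using g[OF nth[OF j]] T(1) nth[OF j] len by auto
    fix j' assume j': "j' < m" "j \<noteq> j'"
    then show "p (map g ys ! j) \<noteq> p (map g ys ! j')"
      using j len g[OF nth[OF j]] g[OF nth[OF j'(1)]] ys(2) by (simp add: nth_eq_iff_index_eq)
  qed
next
  assume ?R
  then obtain is' where is': "length is' = m" "\<forall>j<m. b (is' ! j) \<and> Q (p (is' ! j))"
    "\<forall>j<m. \<forall>j'<m. j \<noteq> j' \<longrightarrow> p (is' ! j) \<noteq> p (is' ! j')" by blast
  have "card ((\<lambda>j. p (is' ! j)) ` {..<m}) = m"
    by (subst card_image) (use is' in \<open>auto simp: inj_on_def\<close>)
  then show ?L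
    unfolding atleast_def using is'
    by (intro exI[of _ "(\<lambda>j. p (is' ! j)) ` {..<m}"]) auto
qed

text \<open>The predicates \<open>b i\<close> switch indices on and off. This treats samples of
  fixed size and the random number of points per cell of \<open>hpp_points\<close> alike.\<close>

lemma measurable_atleast_range:
  fixes p :: "'i::countable \<Rightarrow> 'w \<Rightarrow> 'a::{second_countable_topology, t2_space}"
  assumes [measurable]: "\<And>i. p i \<in> M \<rightarrow>\<^sub>M borel" "\<And>i. Measurable.pred M (b i)"
    "\<And>i. Measurable.pred M (\<lambda>w. Q w (p i w))"
  shows "Measurable.pred M (\<lambda>w. atleast m {y. (\<exists>i. b i w \<and> y = p i w) \<and> Q w y})"
  unfolding atleast_range_iff by measurable

lemma measurable_knn:
  fixes p :: "'i::countable \<Rightarrow> 'w \<Rightarrow> 'a::{second_countable_topology, metric_space}"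
  assumes [measurable]: "\<And>i. p i \<in> M \<rightarrow>\<^sub>M borel" "\<And>i. Measurable.pred M (b i)"
    "x \<in> M \<rightarrow>\<^sub>M borel" "y \<in> M \<rightarrow>\<^sub>M borel"
  shows "Measurable.pred M (\<lambda>w. knn k {z. \<exists>i. b i w \<and> z = p i w} (x w) (y w))"
proof -
  have eq: "{z \<in> {z. \<exists>i. b i w \<and> z = p i w}. z \<noteq> x w \<and> dist (x w) z < dist (x w) (y w)} =
     {z. (\<exists>i. b i w \<and> z = p i w) \<and> (z \<noteq> x w \<and> dist (x w) z < dist (x w) (y w))}" for w
    by auto
  have [measurable]: "Measurable.pred M (\<lambda>w. atleast k
      {z. (\<exists>i. b i w \<and> z = p i w) \<and> (z \<noteq> x w \<and> dist (x w) z < dist (x w) (y w))})"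
    by (intro measurable_atleast_range) measurable
  show ?thesis
    unfolding knn_iff_atleast eq mem_Collect_eq by measurable
qed

lemma measurable_knn_deg:
  fixes p :: "'i::countable \<Rightarrow> 'w \<Rightarrow> 'a::{second_countable_topology, metric_space}"
  assumes [measurable]: "\<And>i. p i \<in> M \<rightarrow>\<^sub>M borel" "\<And>i. Measurable.pred M (b i)"
    "x \<in> M \<rightarrow>\<^sub>M borel"
    and l: "l \<ge> 1"
  shows "Measurable.pred M (\<lambda>w. knn_deg k {z. \<exists>i. b i w \<and> z = p i w} (x w) = l)"
proof -
  let ?X = "\<lambda>w. {z. \<exists>i. b i w \<and> z = p i w}"
  have eq: "{y \<in> ?X w. knn_edge k (?X w) (x w) y} =
    {y. (\<exists>i. b i w \<and> y = p i w) \<and> ((\<exists>i. b i w \<and> x w = p i w) \<and> (\<exists>i. b i w \<and> y = p i w)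
      \<and> x w \<noteq> y \<and> (knn k (?X w) (x w) y \<or> knn k (?X w) y (x w)))}" for w
    unfolding knn_edge_def by auto
  note measurable_knn[measurable]
  have [measurable]: "Measurable.pred M (\<lambda>w. atleast l' {y. (\<exists>i. b i w \<and> y = p i w) \<and>
     ((\<exists>i. b i w \<and> x w = p i w) \<and> (\<exists>i. b i w \<and> y = p i w)
      \<and> x w \<noteq> y \<and> (knn k (?X w) (x w) y \<or> knn k (?X w) y (x w)))})" for l'
    by (intro measurable_atleast_range) measurable
  show ?thesis
    unfolding knn_deg_def card_eq_iff_atleast[OF disjI2[OF l]] eq by measurable
qed

lemma measurable_knn_deg_insert:
  fixes p :: "'i::countable \<Rightarrow> 'w \<Rightarrow> 'a::{second_countable_topology, metric_space}"
  assumes [measurable]: "\<And>i. p i \<in> M \<rightarrow>\<^sub>M borel" "\<And>i. Measurable.pred M (b i)"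
    "x \<in> M \<rightarrow>\<^sub>M borel"
    and l: "l \<ge> 1"
  shows "Measurable.pred M (\<lambda>w. knn_deg k (insert (x w) {z. \<exists>i. b i w \<and> z = p i w}) (x w) = l)"
proof -
  define p' where "p' = case_option x p"
  define b' where "b' = case_option (\<lambda>_. True) b"
  have "insert (x w) {z. \<exists>i. b i w \<and> z = p i w} = {z. \<exists>i. b' i w \<and> z = p' i w}" for w
    by (auto simp: p'_def b'_def split: option.splits)
  moreover have "Measurable.pred M (\<lambda>w. knn_deg k {z. \<exists>i. b' i w \<and> z = p' i w} (x w) = l)"
    by (rule measurable_knn_deg) (use l in \<open>auto simp: p'_def b'_def split: option.splits\<close>)
  ultimately show ?thesis by simp
qed

lemma measurable_knn_count_deg:
  fixes p :: "nat \<Rightarrow> 'w \<Rightarrow> 'a::{second_countable_topology, metric_space}"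
  assumes [measurable]: "\<And>i. p i \<in> M \<rightarrow>\<^sub>M borel" and l: "l \<ge> 1"
  shows "(\<lambda>w. real (knn_count_deg k l ((\<lambda>i. p i w) ` {..<n}))) \<in> borel_measurable M"
proof -
  have im: "(\<lambda>i. p i w) ` {..<n} = {z. \<exists>i. i < n \<and> z = p i w}" for w by auto
  have [measurable]: "Measurable.pred M (\<lambda>w. knn_deg k {z. \<exists>i. i < n \<and> z = p i w} (p j w) = l)" for j
    by (rule measurable_knn_deg) (use l in auto)
  have [measurable]: "Measurable.pred M (\<lambda>w. atleast c
      {y. (\<exists>i. i < n \<and> y = p i w) \<and> knn_deg k {z. \<exists>i. i < n \<and> z = p i w} y = l})" for c
    by (intro measurable_atleast_range) measurable
  have "Measurable.pred M (\<lambda>w. knn_count_deg k l ((\<lambda>i. p i w) ` {..<n}) = c)" for c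
    unfolding knn_count_deg_def im mem_Collect_eq
    by (subst card_eq_iff_atleast) simp_all
  then have "(\<lambda>w. knn_count_deg k l ((\<lambda>i. p i w) ` {..<n})) \<in> M \<rightarrow>\<^sub>M count_space UNIV"
    by (subst measurable_count_space_eq_countable) (auto simp: pred_def vimage_def Int_def conj_commute)
  then show ?thesis by measurable
qed

section \<open>Geometry of nearest neighbours\<close>

lemma finite_has_maximizer:
  fixes h :: "'a \<Rightarrow> 'b::linorder"
  assumes "finite T" "T \<noteq> {}"
  obtains y where "y \<in> T" "\<And>z. z \<in> T \<Longrightarrow> h z \<le> h y"
proof -
  have "Max (h ` T) \<in> h ` T" using assms by simp
  then obtain y where "y \<in> T" "h y = Max (h ` T)" by auto
  then show thesis using that[of y] assms by simp
qed

text \<open>The radius 1/2 puts any two directions of a cone at distance below 1, the chord of 60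
  degrees on the unit sphere.\<close>

definition dcone :: "'a::real_normed_vector \<Rightarrow> 'a set" where
  "dcone u = {y. y \<noteq> 0 \<and> norm (y /\<^sub>R norm y - u) < 1/2}"

definition cone_cover :: "'a::real_normed_vector set \<Rightarrow> bool" where
  "cone_cover U \<longleftrightarrow> finite U \<and> (\<forall>u\<in>U. norm u = 1) \<and> (\<forall>y. y \<noteq> 0 \<longrightarrow> (\<exists>u\<in>U. y \<in> dcone u))"

lemma cone_cover_exists: "\<exists>U::'a::euclidean_space set. cone_cover U"
proof -
  have "compact (sphere (0::'a) 1)" by simp
  moreover have "sphere (0::'a) 1 \<subseteq> (\<Union>u\<in>sphere 0 1. ball u (1/2))"
    by (auto intro!: bexI)
  ultimately obtain U where U: "U \<subseteq> sphere (0::'a) 1" "finite U" "sphere (0::'a) 1 \<subseteq> (\<Union>u\<in>U. ball u (1/2))"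
    using compactE_image[of "sphere (0::'a) 1" "sphere 0 1" "\<lambda>u. ball u (1/2)"] by auto
  have "\<exists>u\<in>U. y \<in> dcone u" if "y \<noteq> 0" for y :: 'a
  proof -
    have "y /\<^sub>R norm y \<in> sphere 0 1" using that by simp
    then obtain u where "u \<in> U" "y /\<^sub>R norm y \<in> ball u (1/2)" using U by blast
    then show ?thesis using that by (auto simp: dcone_def dist_norm norm_minus_commute)
  qed
  then show ?thesis using U unfolding cone_cover_def by (intro exI[of _ U]) auto
qed

text \<open>The two directions make an angle below 60 degrees, so the opposite side \<open>y - z\<close> is not the
  longest one of the triangle.\<close>

lemma dcone_closer:
  fixes y z :: "'a::real_inner"
  assumes "y \<in> dcone u" "z \<in> dcone u" "norm z \<le> norm y"
  shows "norm (y - z) < norm y"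
proof -
  define a where "a = y /\<^sub>R norm y"
  define b where "b = z /\<^sub>R norm z"
  have nz: "norm y > 0" "norm z > 0" using assms by (auto simp: dcone_def)
  have na: "norm a = 1" "norm b = 1" using nz by (auto simp: a_def b_def)
  have ya: "y = norm y *\<^sub>R a" "z = norm z *\<^sub>R b" using nz by (auto simp: a_def b_def)
  have "norm (a - b) \<le> norm (a - u) + norm (b - u)"
    using norm_triangle_ineq4[of "a - u" "b - u"] by simp
  also have "\<dots> < 1" using assms by (auto simp: dcone_def a_def b_def)
  finally have "norm (a - b) ^ 2 < 1" by (simp add: power_less_one_iff)
  then have "2 - 2 * (a \<bullet> b) < 1"
    using na by (simp add: power2_norm_eq_inner inner_diff inner_commute norm_eq_1)
  then have ab: "a \<bullet> b > 1/2" by simp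
  have "y \<bullet> z = norm y * norm z * (a \<bullet> b)" unfolding a_def b_def using nz by (simp add: field_simps)
  also have "\<dots> > norm y * norm z * (1/2)"
    using ab nz by (intro mult_strict_left_mono) auto
  finally have yz: "2 * (y \<bullet> z) > norm y * norm z" by simp
  have "norm (y - z) ^ 2 = norm y ^ 2 + norm z ^ 2 - 2 * (y \<bullet> z)"
    by (simp add: power2_norm_eq_inner inner_diff inner_commute)
  also have "\<dots> < norm y ^ 2 + norm z ^ 2 - norm y * norm z" using yz by simp
  also have "\<dots> \<le> norm y ^ 2"
    using assms(3) nz by (simp add: power2_eq_square mult_right_mono)
  finally show ?thesis using power_less_imp_less_base by fastforce
qed

text \<open>Among \<open>k + 1\<close> such points, the one farthest from \<open>x\<close> has the
  other \<open>k\<close> strictly closer to it than \<open>x\<close> is, by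
  \<open>dcone_closer\<close>; so \<open>x\<close> is not among its \<open>k\<close> nearest
  neighbours.\<close>

lemma knn_in_cone_card:
  fixes x :: "'a::real_inner"
  shows "\<not> atleast (Suc k) {y \<in> S. knn k S y x \<and> y - x \<in> dcone u}"
proof
  assume "atleast (Suc k) {y \<in> S. knn k S y x \<and> y - x \<in> dcone u}"
  then obtain T where T: "T \<subseteq> {y \<in> S. knn k S y x \<and> y - x \<in> dcone u}" "finite T" "card T = Suc k"
    unfolding atleast_def by blast
  then have "T \<noteq> {}" by auto
  then obtain y where y: "y \<in> T" "\<And>z. z \<in> T \<Longrightarrow> norm (z - x) \<le> norm (y - x)"
    using T(2) finite_has_maximizer[of T "\<lambda>y. norm (y - x)"] by blast
  have "T - {y} \<subseteq> {z \<in> S. z \<noteq> y \<and> dist y z < dist y x}"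
  proof
    fix z assume z: "z \<in> T - {y}"
    then have "norm ((y - x) - (z - x)) < norm (y - x)"
      using T(1) y by (intro dcone_closer[of _ u]) auto
    then show "z \<in> {z \<in> S. z \<noteq> y \<and> dist y z < dist y x}"
      using z T(1) by (auto simp: dist_norm)
  qed
  then have "atleast k {z \<in> S. z \<noteq> y \<and> dist y z < dist y x}"
    unfolding atleast_def using T y by (intro exI[of _ "T - {y}"]) auto
  then show False using y(1) T(1) by (auto simp: knn_iff_atleast)
qed

text \<open>Every point other than \<open>x\<close> lies in some cone at \<open>x\<close>, and each
  cone contributes at most \<open>k\<close>. Finiteness is claimed separately because
  \<open>S\<close> may be infinite.\<close>

lemma knn_in_degree_le:
  fixes x :: "'a::real_inner"
  assumes U: "cone_cover (U :: 'a set)"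
  shows "finite {y \<in> S. knn k S y x}" "card {y \<in> S. knn k S y x} \<le> k * card U"
proof -
  have eq: "{y \<in> S. knn k S y x} \<subseteq> (\<Union>u\<in>U. {y \<in> S. knn k S y x \<and> y - x \<in> dcone u})"
  proof
    fix y assume y: "y \<in> {y \<in> S. knn k S y x}"
    then have "y - x \<noteq> 0" by (auto simp: knn_def)
    then show "y \<in> (\<Union>u\<in>U. {y \<in> S. knn k S y x \<and> y - x \<in> dcone u})"
      using U y unfolding cone_cover_def by blast
  qed
  have fin: "finite {y \<in> S. knn k S y x \<and> y - x \<in> dcone u}"
    "card {y \<in> S. knn k S y x \<and> y - x \<in> dcone u} \<le> k" for u
    using knn_in_cone_card[of k S x u] unfolding not_atleast_iff by auto
  have finU: "finite U" using U by (simp add: cone_cover_def)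
  then have f2: "finite (\<Union>u\<in>U. {y \<in> S. knn k S y x \<and> y - x \<in> dcone u})" using fin by auto
  then show "finite {y \<in> S. knn k S y x}" using eq finite_subset by blast
  have "card {y \<in> S. knn k S y x} \<le> card (\<Union>u\<in>U. {y \<in> S. knn k S y x \<and> y - x \<in> dcone u})"
    using f2 eq by (rule card_mono)
  also have "\<dots> \<le> (\<Sum>u\<in>U. card {y \<in> S. knn k S y x \<and> y - x \<in> dcone u})"
    by (rule card_UN_le[OF finU])
  also have "\<dots> \<le> (\<Sum>u\<in>U. k)" by (intro sum_mono fin)
  finally show "card {y \<in> S. knn k S y x} \<le> k * card U" by (simp add: mult.commute)
qed

definition tie_free :: "'a::metric_space set \<Rightarrow> bool" where
  "tie_free S \<longleftrightarrow> (\<forall>a\<in>S. \<forall>b\<in>S. \<forall>c\<in>S. b \<noteq> a \<longrightarrow> c \<noteq> a \<longrightarrow> dist a b = dist a c \<longrightarrow> b = c)"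

lemma tie_free_subset: "tie_free S \<Longrightarrow> T \<subseteq> S \<Longrightarrow> tie_free T"
  unfolding tie_free_def by blast

text \<open>Points tied at the \<open>k\<close>-th smallest distance would all count as neighbours.
  Without ties the farthest of \<open>k + 1\<close> neighbours would have \<open>k\<close> strictly
  closer points.\<close>

lemma knn_out_degree_le:
  assumes "tie_free S" "x \<in> S"
  shows "finite {y \<in> S. knn k S x y}" "card {y \<in> S. knn k S x y} \<le> k"
proof -
  have "\<not> atleast (Suc k) {y \<in> S. knn k S x y}"
  proof
    assume "atleast (Suc k) {y \<in> S. knn k S x y}"
    then obtain T where T: "T \<subseteq> {y \<in> S. knn k S x y}" "finite T" "card T = Suc k"
      unfolding atleast_def by blast
    then have "T \<noteq> {}" by auto
    then obtain y where y: "y \<in> T" "\<And>z. z \<in> T \<Longrightarrow> dist x z \<le> dist x y"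
      using T(2) finite_has_maximizer[of T "dist x"] by blast
    have "T - {y} \<subseteq> {z \<in> S. z \<noteq> x \<and> dist x z < dist x y}"
    proof
      fix z assume z: "z \<in> T - {y}"
      then have zy: "z \<in> S" "z \<noteq> x" "y \<in> S" "y \<noteq> x" using y T(1) by (auto simp: knn_def)
      then have "dist x z \<noteq> dist x y" using assms z unfolding tie_free_def by blast
      moreover have "dist x z \<le> dist x y" using y z by simp
      moreover note zy
      ultimately show "z \<in> {z \<in> S. z \<noteq> x \<and> dist x z < dist x y}" by simp
    qed
    then have "atleast k {z \<in> S. z \<noteq> x \<and> dist x z < dist x y}"
      unfolding atleast_def using T y by (intro exI[of _ "T - {y}"]) auto
    then show False using y(1) T(1) by (auto simp: knn_iff_atleast)
  qed
  then show "finite {y \<in> S. knn k S x y}" "card {y \<in> S. knn k S x y} \<le> k"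
    unfolding not_atleast_iff by auto
qed

text \<open>If some point is not a neighbour, take the nearest such point: at least \<open>k\<close>
  points are strictly closer to \<open>x\<close>, and all of them are neighbours by
  minimality.\<close>

lemma knn_out_degree_ge:
  assumes S: "finite S" "x \<in> S" "card S > k"
  shows "k \<le> card {y \<in> S. knn k S x y}"
proof (cases "\<forall>y\<in>S-{x}. knn k S x y")
  case True
  then have "S - {x} \<subseteq> {y \<in> S. knn k S x y}" by auto
  then have "card (S - {x}) \<le> card {y \<in> S. knn k S x y}" using S by (intro card_mono) auto
  then show ?thesis using S by simp
next
  case False
  let ?N = "{y \<in> S - {x}. \<not> knn k S x y}"
  have "finite ?N" "?N \<noteq> {}" using S False by auto
  then obtain y where y: "y \<in> ?N" "\<And>z. z \<in> ?N \<Longrightarrow> dist x y \<le> dist x z"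
    by (metis (no_types, lifting) arg_min_if_finite(1,2) not_le)
  then have "atleast k {z \<in> S. z \<noteq> x \<and> dist x z < dist x y}" by (auto simp: knn_iff_atleast)
  moreover have "{z \<in> S. z \<noteq> x \<and> dist x z < dist x y} \<subseteq> {y \<in> S. knn k S x y}"
    using y(2) by force
  ultimately have "atleast k {y \<in> S. knn k S x y}" by (rule atleast_mono)
  then show ?thesis using S by (simp add: atleast_finite_iff)
qed

lemma knn_deg_ge:
  assumes S: "finite S" "x \<in> S" "card S > k"
  shows "k \<le> knn_deg k S x"
proof -
  have "card {y \<in> S. knn k S x y} \<le> card {y \<in> S. knn_edge k S x y}"
    using S by (intro card_mono) (auto simp: knn_edge_def knn_def)
  then show ?thesis using knn_out_degree_ge[OF S] by (simp add: knn_deg_def)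
qed

lemma knn_edge_set_eq:
  "x \<in> S \<Longrightarrow> {y \<in> S. knn_edge k S x y} = {y \<in> S. knn k S x y} \<union> {y \<in> S. knn k S y x}"
  by (auto simp: knn_edge_def knn_def)

lemma knn_deg_le:
  fixes x :: "'a::real_inner"
  assumes "cone_cover (U :: 'a set)" "tie_free S" "x \<in> S"
  shows "finite {y \<in> S. knn_edge k S x y}" "knn_deg k S x \<le> k + k * card U"
proof -
  show "finite {y \<in> S. knn_edge k S x y}"
    unfolding knn_edge_set_eq[OF assms(3)]
    using knn_out_degree_le(1)[OF assms(2,3)] knn_in_degree_le(1)[OF assms(1)] by blast
  have "knn_deg k S x \<le> card {y \<in> S. knn k S x y} + card {y \<in> S. knn k S y x}"
    unfolding knn_deg_def knn_edge_set_eq[OF assms(3)] by (rule card_Un_le)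
  also have "\<dots> \<le> k + k * card U"
    using knn_out_degree_le(2)[OF assms(2,3)] knn_in_degree_le(2)[OF assms(1)] by (intro add_mono)
  finally show "knn_deg k S x \<le> k + k * card U" .
qed

lemma knn_insert_antimono:
  assumes "knn k (insert x S) y z" "z \<noteq> x"
  shows "knn k S y z"
proof -
  have "{a \<in> S. a \<noteq> y \<and> dist y a < dist y z} \<subseteq> {a \<in> insert x S. a \<noteq> y \<and> dist y a < dist y z}" by auto
  then show ?thesis using assms unfolding knn_iff_atleast by (auto dest: atleast_mono)
qed

text \<open>The only directed edge that \<open>y\<close> can lose is the one to its former \<open>k\<close>-th nearest
  neighbour, and then \<open>x\<close> has become one of the \<open>k\<close> nearest neighbours of \<open>y\<close>.\<close>

lemma knn_lost:
  assumes S: "x \<notin> S" "y \<in> S" and lost: "knn k S y z" "\<not> knn k (insert x S) y z"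
  shows "knn k (insert x S) y x" "card {a \<in> S. a \<noteq> y \<and> dist y a < dist y z} = k - 1"
proof -
  let ?A = "{a \<in> S. a \<noteq> y \<and> dist y a < dist y z}"
  have A: "finite ?A" "card ?A < k" and z: "z \<in> S" "z \<noteq> y"
    using lost(1) unfolding knn_iff_atleast not_atleast_iff by auto
  have al: "atleast k {a \<in> insert x S. a \<noteq> y \<and> dist y a < dist y z}"
    using lost(2) z unfolding knn_iff_atleast by auto
  have xy: "x \<noteq> y" using S by auto
  have cl: "dist y x < dist y z"
  proof (rule ccontr)
    assume "\<not> dist y x < dist y z"
    then have "{a \<in> insert x S. a \<noteq> y \<and> dist y a < dist y z} = ?A" by auto
    then show False using al A by (simp add: atleast_finite_iff)
  qed
  then have ins: "{a \<in> insert x S. a \<noteq> y \<and> dist y a < dist y z} = insert x ?A"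
    using xy by auto
  have xA: "x \<notin> ?A" using S by auto
  have "k \<le> card (insert x ?A)" using al A unfolding ins by (simp add: atleast_finite_iff)
  then show "card ?A = k - 1" using A xA by simp
  have "{a \<in> insert x S. a \<noteq> y \<and> dist y a < dist y x} \<subseteq> ?A" using cl by auto
  then have "\<not> atleast k {a \<in> insert x S. a \<noteq> y \<and> dist y a < dist y x}"
    using A atleast_mono[of k _ ?A] not_atleast_iff[of k ?A] by blast
  then show "knn k (insert x S) y x" using xy by (simp add: knn_iff_atleast)
qed

text \<open>Each lost neighbour has exactly \<open>k - 1\<close> strictly closer points by
  \<open>knn_lost\<close>, and without ties the farther of two neighbours has strictly more closer
  points than the nearer one.\<close>

lemma knn_lost_unique:
  assumes S: "tie_free S" "x \<notin> S" "y \<in> S"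
    and lost: "knn k S y z" "\<not> knn k (insert x S) y z" "knn k S y w" "\<not> knn k (insert x S) y w"
  shows "z = w"
proof (rule ccontr)
  assume ne: "z \<noteq> w"
  have zw: "z \<in> S" "w \<in> S" "z \<noteq> y" "w \<noteq> y" using lost by (auto simp: knn_def)
  have *: False if "dist y a < dist y b" "knn k S y a" "knn k S y b"
     "\<not> knn k (insert x S) y a" "\<not> knn k (insert x S) y b" for a b
  proof -
    have a: "a \<in> S" "a \<noteq> y" using that by (auto simp: knn_def)
    have fin: "finite {c \<in> S. c \<noteq> y \<and> dist y c < dist y b}"
      using that(3) unfolding knn_iff_atleast not_atleast_iff by auto
    have "insert a {c \<in> S. c \<noteq> y \<and> dist y c < dist y a} \<subseteq> {c \<in> S. c \<noteq> y \<and> dist y c < dist y b}"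
      using that(1) a by auto
    then have "card (insert a {c \<in> S. c \<noteq> y \<and> dist y c < dist y a}) \<le> card {c \<in> S. c \<noteq> y \<and> dist y c < dist y b}"
      using fin by (rule card_mono[rotated])
    moreover have "finite {c \<in> S. c \<noteq> y \<and> dist y c < dist y a}"
      using that(2) unfolding knn_iff_atleast not_atleast_iff by auto
    ultimately show False
      using knn_lost(2)[OF S(2,3) that(2,4)] knn_lost(2)[OF S(2,3) that(3,5)] by simp
  qed
  have "dist y z \<noteq> dist y w" using S zw ne unfolding tie_free_def by blast
  then show False using *[of z w] *[of w z] lost by linarith
qed

text \<open>A vertex can change its degree only if it is adjacent to the new point, at most
  \<open>k + k * card U\<close> vertices, or if it is the head of a lost directed edge. Lost edges
  start at in-neighbours of \<open>x\<close>, one each, which gives at most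
  \<open>k * card U\<close> heads. The final 1 counts \<open>x\<close> itself.\<close>

lemma knn_count_deg_insert_diff:
  fixes x :: "'a::real_inner"
  assumes U: "cone_cover (U :: 'a set)" and S: "finite S" "tie_free (insert x S)"
  shows "\<bar>real (knn_count_deg k l (insert x S)) - real (knn_count_deg k l S)\<bar> \<le> real (k + 2 * k * card U + 1)"
proof (cases "x \<in> S")
  case True then show ?thesis by (simp add: insert_absorb)
next
  case x: False
  let ?S' = "insert x S"
  have tf: "tie_free S" using S(2) tie_free_subset by blast
  let ?In = "{y \<in> ?S'. knn k ?S' y x}" and ?E = "{y \<in> ?S'. knn_edge k ?S' x y}"
  \<comment> \<open>For an in-neighbour that loses nothing the description has an unspecified value;
    this only enlarges \<open>L\<close> and does not affect the bound on its size.\<close>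
  define L where "L = (\<lambda>y. THE z. knn k S y z \<and> \<not> knn k ?S' y z) ` ?In"
  have finIn: "finite ?In" "card ?In \<le> k * card U" using knn_in_degree_le[OF U] by blast+
  have finE: "finite ?E" "card ?E \<le> k + k * card U"
    using knn_deg_le[OF U S(2), of x k] by (auto simp: knn_deg_def)
  have finL: "finite L" "card L \<le> k * card U"
    using finIn card_image_le[OF finIn(1)] unfolding L_def by (auto intro: le_trans)
  \<comment> \<open>Both ends of a lost edge from \<open>y\<close> to \<open>z\<close> are covered:
    \<open>y\<close> is now adjacent to \<open>x\<close>, and \<open>z\<close> is the described
    value because the lost neighbour is unique.\<close>
  have Lmem: "z \<in> L" "y \<in> ?E" if "y \<in> S" "knn k S y z" "\<not> knn k ?S' y z" for y z
  proof -
    have yx: "y \<in> ?In" using knn_lost(1)[OF x that] that(1) by auto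
    have "(THE z. knn k S y z \<and> \<not> knn k ?S' y z) = z"
      using that knn_lost_unique[OF tf x that(1)] by blast
    then show "z \<in> L" unfolding L_def using yx by force
    show "y \<in> ?E" using yx that(1) x by (auto simp: knn_edge_def)
  qed
  have same: "knn_deg k ?S' y = knn_deg k S y" if y: "y \<in> S" "y \<notin> ?E" "y \<notin> L" for y
  proof -
    have nox: "\<not> knn k ?S' y x" "\<not> knn k ?S' x y" using y x by (auto simp: knn_edge_def)
    have "knn_edge k ?S' y z \<longleftrightarrow> knn_edge k S y z" if z: "z \<in> S" for z
    proof -
      have "knn k ?S' y z \<longleftrightarrow> knn k S y z"
        using Lmem(2)[of y z] y knn_insert_antimono[of k x S y z] z x by blast
      moreover have "knn k ?S' z y \<longleftrightarrow> knn k S z y"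
        using Lmem(1)[of z y] y knn_insert_antimono[of k x S z y] z x by blast
      ultimately show ?thesis using y z by (auto simp: knn_edge_def)
    qed
    then have "{z \<in> ?S'. knn_edge k ?S' y z} = {z \<in> S. knn_edge k S y z}"
      using nox by (auto simp: knn_edge_def)
    then show ?thesis by (simp add: knn_deg_def)
  qed
  let ?D = "insert x (?E \<union> L)"
  let ?A = "{y \<in> ?S'. knn_deg k ?S' y = l}" and ?B = "{y \<in> S. knn_deg k S y = l}"
  have fD: "finite ?D" using finE finL by simp
  have cD: "card ?D \<le> k + 2 * k * card U + 1"
  proof -
    have "card ?D \<le> Suc (card (?E \<union> L))" by (rule card_insert_le_m1) auto
    also have "card (?E \<union> L) \<le> card ?E + card L" by (rule card_Un_le)
    finally show ?thesis using finE finL by simp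
  qed
  have "y \<in> ?A \<longleftrightarrow> y \<in> ?B" if "y \<notin> ?D" for y
    using that same[of y] by auto
  then have "?A \<subseteq> ?B \<union> ?D" "?B \<subseteq> ?A \<union> ?D" by blast+
  then have "card ?A \<le> card (?B \<union> ?D)" "card ?B \<le> card (?A \<union> ?D)"
    using S fD by (auto intro!: card_mono)
  then have "card ?A \<le> card ?B + card ?D" "card ?B \<le> card ?A + card ?D"
    using card_Un_le order_trans by blast+
  then show ?thesis using cD unfolding knn_count_deg_def by linarith
qed

section \<open>Locality and scale invariance of the degree of the origin\<close>

definition stab :: "nat \<Rightarrow> 'a::real_normed_vector set \<Rightarrow> real \<Rightarrow> 'a set \<Rightarrow> bool" where
  "stab k U r S \<longleftrightarrow> (\<forall>u\<in>U. atleast k {z \<in> S. z \<in> dcone u \<and> norm z \<le> r})"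

text \<open>Let \<open>y\<close> be farther than \<open>r\<close>, in the cone of \<open>u\<close>.
  The \<open>k\<close> points of that cone within \<open>r\<close> are closer to the origin than
  \<open>y\<close>, and closer to \<open>y\<close> than the origin by \<open>dcone_closer\<close>;
  so neither end selects the other.\<close>

lemma stab_neighbours_near:
  fixes S :: "'a::euclidean_space set"
  assumes U: "cone_cover U" and st: "stab k U r S"
    and e: "knn_edge k (insert 0 S) 0 y"
  shows "norm y \<le> r"
proof (rule ccontr)
  assume far: "\<not> norm y \<le> r"
  have y0: "y \<noteq> 0" using e by (auto simp: knn_edge_def)
  then obtain u where u: "u \<in> U" "y \<in> dcone u" using U by (auto simp: cone_cover_def)
  let ?Z = "{z \<in> S. z \<in> dcone u \<and> norm z \<le> r}"
  have at: "atleast k ?Z" using st u by (auto simp: stab_def)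
  have "?Z \<subseteq> {z \<in> insert 0 S. z \<noteq> 0 \<and> dist 0 z < dist 0 y}"
    using far by (auto simp: dcone_def)
  then have n1: "\<not> knn k (insert 0 S) 0 y" using at atleast_mono by (auto simp: knn_iff_atleast)
  have "?Z \<subseteq> {z \<in> insert 0 S. z \<noteq> y \<and> dist y z < dist y 0}"
  proof
    fix z assume z: "z \<in> ?Z"
    then have "norm (y - z) < norm y" using far u by (intro dcone_closer[of _ u]) auto
    then show "z \<in> {z \<in> insert 0 S. z \<noteq> y \<and> dist y z < dist y 0}"
      using z far by (auto simp: dist_norm)
  qed
  then have n2: "\<not> knn k (insert 0 S) y 0" using at atleast_mono by (auto simp: knn_iff_atleast)
  show False using e n1 n2 by (auto simp: knn_edge_def)
qed

lemma stab_cong: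
  assumes "stab k U r S" "S \<inter> cball 0 (2*r) = S' \<inter> cball 0 (2*r)"
  shows "stab k U r S'"
proof -
  have "{z \<in> S. z \<in> dcone u \<and> norm z \<le> r} = {z \<in> S'. z \<in> dcone u \<and> norm z \<le> r}" for u
  proof -
    have "z \<in> S \<longleftrightarrow> z \<in> S'" if "norm z \<le> r" for z
    proof -
      have "norm z \<le> 2 * r" using that norm_ge_zero[of z] by linarith
      then show ?thesis using assms(2) by (metis IntD1 IntI mem_cball_0)
    qed
    then show ?thesis by auto
  qed
  then show ?thesis using assms(1) by (simp add: stab_def)
qed

text \<open>All neighbours lie within \<open>r\<close>. Whether such a \<open>y\<close> selects the
  origin depends on the points closer to \<open>y\<close> than \<open>norm y\<close>, and these lie
  within \<open>2 * r\<close> of the origin. This is where the factor 2 comes from.\<close>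

lemma knn_deg_stab_cong:
  fixes S :: "'a::euclidean_space set"
  assumes U: "cone_cover U" and st: "stab k U r S"
    and eq: "S \<inter> cball 0 (2*r) = S' \<inter> cball 0 (2*r)"
  shows "knn_deg k (insert 0 S) 0 = knn_deg k (insert 0 S') 0"
proof -
  have st': "stab k U r S'" using stab_cong[OF st eq] .
  have mem: "z \<in> insert 0 S \<longleftrightarrow> z \<in> insert 0 S'" if "norm z \<le> 2 * r" for z
    using eq that by (metis IntD1 IntI insert_iff mem_cball_0)
  have "knn_edge k (insert 0 S) 0 y \<longleftrightarrow> knn_edge k (insert 0 S') 0 y" if y: "norm y \<le> r" for y
  proof -
    have y2: "norm y \<le> 2 * r" using y norm_ge_zero[of y] by linarith
    have "{z \<in> insert 0 S. z \<noteq> 0 \<and> dist 0 z < dist 0 y} = {z \<in> insert 0 S'. z \<noteq> 0 \<and> dist 0 z < dist 0 y}"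
    proof -
      have "norm z \<le> 2 * r" if "dist 0 z < dist 0 y" for z using that y2 by simp
      then show ?thesis using mem by blast
    qed
    moreover have "{z \<in> insert 0 S. z \<noteq> y \<and> dist y z < dist y 0} = {z \<in> insert 0 S'. z \<noteq> y \<and> dist y z < dist y 0}"
    proof -
      have "norm z \<le> 2 * r" if "dist y z < dist y 0" for z
        using that y norm_triangle_ineq2[of z y] by (simp add: dist_norm norm_minus_commute)
      then show ?thesis using mem by blast
    qed
    ultimately show ?thesis using mem[OF y2] unfolding knn_edge_def knn_iff_atleast by simp
  qed
  then have "{y \<in> insert 0 S. knn_edge k (insert 0 S) 0 y} = {y \<in> insert 0 S'. knn_edge k (insert 0 S') 0 y}"
    using stab_neighbours_near[OF U st] stab_neighbours_near[OF U st']
    by (auto simp: knn_edge_def)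
  then show ?thesis by (simp add: knn_deg_def)
qed

lemma atleast_image: "inj_on g A \<Longrightarrow> atleast m (g ` A) \<longleftrightarrow> atleast m A"
  by (cases "finite A") (auto simp: atleast_finite_iff atleast_infinite card_image finite_image_iff)

lemma knn_similarity:
  assumes g: "inj g" and c: "c > 0" "\<And>a b. dist (g a) (g b) = c * dist a b"
  shows "knn k (g ` X) (g x) (g y) \<longleftrightarrow> knn k X x y"
proof -
  have "{z \<in> g ` X. z \<noteq> g x \<and> dist (g x) z < dist (g x) (g y)} = g ` {z \<in> X. z \<noteq> x \<and> dist x z < dist x y}"
    using g c by (auto simp: inj_def)
  then show ?thesis
    using g unfolding knn_iff_atleast
    by (auto simp: atleast_image inj_on_subset[OF g] inj_image_mem_iff inj_eq)
qed

lemma knn_deg_similarity: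
  assumes g: "inj g" and c: "c > 0" "\<And>a b. dist (g a) (g b) = c * dist a b"
  shows "knn_deg k (g ` X) (g x) = knn_deg k X x"
proof -
  have "{y \<in> g ` X. knn_edge k (g ` X) (g x) y} = g ` {y \<in> X. knn_edge k X x y}"
    using g by (auto simp: knn_edge_def knn_similarity[OF assms] inj_image_mem_iff inj_eq)
  then show ?thesis by (simp add: knn_deg_def card_image inj_on_subset[OF g])
qed

section \<open>Functionals of finite configurations\<close>

text \<open>A configuration is a list that only matters through its set of points together with the
  origin; hence moving the sample points outside a window to the origin amounts to deleting them.\<close>

definition config_fun :: "('a::euclidean_space list \<Rightarrow> real) \<Rightarrow> bool" where
  "config_fun F \<longleftrightarrow> (\<forall>n. (\<lambda>y. F (map y [0..<n])) \<in> borel_measurable (PiM UNIV (\<lambda>_::nat. borel)))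
     \<and> (\<exists>D. \<forall>xs. \<bar>F xs\<bar> \<le> D)
     \<and> (\<forall>xs ys. insert 0 (set xs) = insert 0 (set ys) \<longrightarrow> F xs = F ys)"

lemma config_funI:
  assumes "\<And>n. (\<lambda>y. F (map y [0..<n])) \<in> borel_measurable (PiM UNIV (\<lambda>_::nat. borel))"
    "\<And>xs. \<bar>F xs\<bar> \<le> D"
    "\<And>xs ys. insert 0 (set xs) = insert 0 (set ys) \<Longrightarrow> F xs = F ys"
  shows "config_fun F"
  using assms unfolding config_fun_def by blast

lemma config_fun_bound:
  assumes "config_fun F" obtains D where "\<And>xs. \<bar>F xs\<bar> \<le> D" "D \<ge> 0"
proof -
  obtain D where D: "\<And>xs. \<bar>F xs\<bar> \<le> D" using assms unfolding config_fun_def by blast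
  moreover have "D \<ge> 0" using D[of "[]"] by linarith
  ultimately show thesis using that by blast
qed

lemma config_fun_cong:
  "config_fun F \<Longrightarrow> insert 0 (set xs) = insert 0 (set ys) \<Longrightarrow> F xs = F ys"
  unfolding config_fun_def by blast

lemma config_fun_Cons_commute: "config_fun F \<Longrightarrow> F (x # y # xs) = F (y # x # xs)"
  by (rule config_fun_cong) auto

lemma measurable_config_fun_nth:
  fixes p :: "nat \<Rightarrow> 'w \<Rightarrow> 'a::euclidean_space"
  assumes F: "config_fun F" and p: "\<And>i. i < n \<Longrightarrow> p i \<in> M \<rightarrow>\<^sub>M borel"
  shows "(\<lambda>w. F (map (\<lambda>i. p i w) [0..<n])) \<in> borel_measurable M"
proof -
  \<comment> \<open>The maps \<open>p i\<close> are known to be measurable only for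
    \<open>i < n\<close>; the other coordinates are filled with 0 to obtain a map into the full
    product space.\<close>
  have eq: "F (map (\<lambda>i. p i w) [0..<n]) = F (map (\<lambda>i. if i < n then p i w else 0) [0..<n])" for w
    by (intro arg_cong[where f=F]) simp
  have [measurable]: "(\<lambda>y. F (map y [0..<n])) \<in> borel_measurable (PiM UNIV (\<lambda>_::nat. borel))"
    using F unfolding config_fun_def by blast
  have "(\<lambda>w i. if i < n then p i w else 0) \<in> M \<rightarrow>\<^sub>M PiM UNIV (\<lambda>_::nat. borel)"
  proof (rule measurable_PiM_single')
    show "(\<lambda>w. if i < n then p i w else 0) \<in> M \<rightarrow>\<^sub>M borel" for i using p by (cases "i < n") auto
  qed auto
  then show ?thesis unfolding eq by measurable
qed

lemma measurable_config_fun: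
  assumes F: "config_fun F" and p: "\<And>p. p \<in> set ps \<Longrightarrow> p \<in> M \<rightarrow>\<^sub>M borel"
  shows "(\<lambda>w. F (map (\<lambda>p. p w) ps)) \<in> borel_measurable M"
proof -
  have eq: "map (\<lambda>p. p w) ps = map (\<lambda>i. (ps ! i) w) [0..<length ps]" for w
    by (rule nth_equalityI) auto
  show ?thesis unfolding eq by (intro measurable_config_fun_nth[OF F] p) auto
qed

lemma measurable_config_fun_Cons:
  assumes F: "config_fun F" and [measurable]: "p \<in> M \<rightarrow>\<^sub>M borel"
  shows "(\<lambda>w. F (p w # xs)) \<in> borel_measurable M"
proof -
  have "(\<lambda>w. F (map (\<lambda>q. q w) (p # map (\<lambda>x _. x) xs))) \<in> borel_measurable M"
    by (rule measurable_config_fun[OF F]) auto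
  then show ?thesis by (simp add: o_def)
qed

lemma measurable_config_fun_Cons_map:
  fixes q :: "nat \<Rightarrow> 'w \<Rightarrow> 'a::euclidean_space"
  assumes F: "config_fun F" and [measurable]: "p \<in> M \<rightarrow>\<^sub>M borel" "\<And>i. q i \<in> M \<rightarrow>\<^sub>M borel"
  shows "(\<lambda>w. F (p w # map (\<lambda>i. q i w) [0..<n] @ xs)) \<in> borel_measurable M"
proof -
  have "(\<lambda>w. F (map (\<lambda>q. q w) (p # map q [0..<n] @ map (\<lambda>x _. x) xs))) \<in> borel_measurable M"
    by (rule measurable_config_fun[OF F]) auto
  then show ?thesis by (simp add: o_def)
qed

lemma measurable_config_fun_map:
  fixes q :: "nat \<Rightarrow> 'w \<Rightarrow> 'a::euclidean_space"
  assumes F: "config_fun F" and [measurable]: "\<And>i. q i \<in> M \<rightarrow>\<^sub>M borel"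
  shows "(\<lambda>w. F (map (\<lambda>i. q i w) [0..<n] @ xs)) \<in> borel_measurable M"
proof -
  have "(\<lambda>w. F (map (\<lambda>q. q w) (map q [0..<n] @ map (\<lambda>x _. x) xs))) \<in> borel_measurable M"
    by (rule measurable_config_fun[OF F]) auto
  then show ?thesis by (simp add: o_def)
qed

lemma (in finite_measure) integrable_bounded:
  fixes h :: "'a \<Rightarrow> real"
  assumes "h \<in> borel_measurable M" "\<And>x. \<bar>h x\<bar> \<le> D"
  shows "integrable M h"
  using assms by (intro integrable_const_bound[of _ D]) auto

lemma (in prob_space) abs_integral_le_const:
  fixes h :: "'a \<Rightarrow> real"
  assumes "\<And>x. \<bar>h x\<bar> \<le> D"
  shows "\<bar>\<integral>x. h x \<partial>M\<bar> \<le> D"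
proof (cases "integrable M h")
  case True
  have "\<bar>\<integral>x. h x \<partial>M\<bar> \<le> (\<integral>x. \<bar>h x\<bar> \<partial>M)" by simp
  also have "\<dots> \<le> (\<integral>x. D \<partial>M)" using True assms by (intro integral_mono) auto
  finally show ?thesis by (simp add: prob_space)
next
  case False
  \<comment> \<open>A non-integrable \<open>h\<close> has integral 0 by convention, and a bound for
    absolute values is nonnegative.\<close>
  then show ?thesis using assms[of undefined] by (simp add: not_integrable_integral_eq)
qed

text \<open>Expectation over one further random point, as an operator on functionals; its powers
  give expectations over i.i.d. samples. The map \<open>\<psi>\<close> will rescale around a point
  and send everything outside a window to the origin.\<close>

definition sample_point :: "'b measure \<Rightarrow> ('b \<Rightarrow> 'a) \<Rightarrow> ('a list \<Rightarrow> real) \<Rightarrow> 'a list \<Rightarrow> real" where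
  "sample_point M \<psi> F xs = (\<integral>z. F (\<psi> z # xs) \<partial>M)"

lemma config_fun_sample_point:
  fixes \<psi> :: "'b \<Rightarrow> 'a::euclidean_space"
  assumes M: "prob_space M" and F: "config_fun F" and [measurable]: "\<psi> \<in> M \<rightarrow>\<^sub>M borel"
  shows "config_fun (sample_point M \<psi> F)"
proof -
  interpret prob_space M by fact
  obtain D where D: "\<And>xs. \<bar>F xs\<bar> \<le> D" using config_fun_bound[OF F] by blast
  show ?thesis
  proof (rule config_funI[where D=D])
    fix n :: nat
    have "(\<lambda>w. F (\<psi> (snd w) # map (\<lambda>i. fst w i) [0..<n] @ [])) \<in>
       borel_measurable (PiM UNIV (\<lambda>_::nat. borel) \<Otimes>\<^sub>M M)"
      by (rule measurable_config_fun_Cons_map[OF F]) measurable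
    then have "case_prod (\<lambda>y z. F (\<psi> z # map y [0..<n])) \<in>
       borel_measurable (PiM UNIV (\<lambda>_::nat. borel) \<Otimes>\<^sub>M M)"
      by (simp add: case_prod_beta')
    then show "(\<lambda>y. sample_point M \<psi> F (map y [0..<n])) \<in> borel_measurable (PiM UNIV (\<lambda>_::nat. borel))"
      unfolding sample_point_def by (rule borel_measurable_lebesgue_integral)
  next
    fix xs show "\<bar>sample_point M \<psi> F xs\<bar> \<le> D"
      unfolding sample_point_def by (rule abs_integral_le_const) (rule D)
  next
    fix xs ys :: "'a list" assume "insert 0 (set xs) = insert 0 (set ys)"
    then show "sample_point M \<psi> F xs = sample_point M \<psi> F ys"
      unfolding sample_point_def
      by (intro Bochner_Integration.integral_cong refl config_fun_cong[OF F]) auto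
  qed
qed

lemma integral_PiM_nat_Suc:
  fixes h :: "(nat \<Rightarrow> 'b) \<Rightarrow> real"
  assumes M: "prob_space M" and h[measurable]: "h \<in> borel_measurable (PiM UNIV (\<lambda>_::nat. M))"
    and D: "\<And>w. \<bar>h w\<bar> \<le> D"
  shows "(\<integral>w. h w \<partial>PiM UNIV (\<lambda>_::nat. M)) = (\<integral>z. (\<integral>w. h (case_nat z w) \<partial>PiM UNIV (\<lambda>_::nat. M)) \<partial>M)"
proof -
  interpret M: prob_space M by fact
  interpret sequence_space M by unfold_locales
  interpret PP: pair_prob_space M "PiM UNIV (\<lambda>_::nat. M)" by unfold_locales
  have [measurable]: "(\<lambda>p. h (case_nat (fst p) (snd p))) \<in> borel_measurable (M \<Otimes>\<^sub>M PiM UNIV (\<lambda>_::nat. M))"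
    by measurable
  have "(\<integral>w. h w \<partial>PiM UNIV (\<lambda>_::nat. M)) =
     (\<integral>w. h w \<partial>distr (M \<Otimes>\<^sub>M PiM UNIV (\<lambda>_::nat. M)) (PiM UNIV (\<lambda>_::nat. M)) (\<lambda>(s, w). case_nat s w))"
    by (simp add: PiM_iter)
  also have "\<dots> = (\<integral>p. h (case_nat (fst p) (snd p)) \<partial>(M \<Otimes>\<^sub>M PiM UNIV (\<lambda>_::nat. M)))"
    by (subst integral_distr) (auto simp: case_prod_beta')
  also have "\<dots> = (\<integral>z. (\<integral>w. h (case_nat z w) \<partial>PiM UNIV (\<lambda>_::nat. M)) \<partial>M)"
    by (subst PP.integral_fst'[symmetric]) (auto intro!: PP.P.integrable_bounded[where D=D] D)
  finally show ?thesis .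
qed

text \<open>Induction on the sample size, with the fixed points \<open>xs\<close> general: the first
  sample point is split off by Fubini and joins \<open>xs\<close>, which is legitimate because
  \<open>F\<close> does not see the order.\<close>

lemma integral_config_fun_iid:
  fixes \<psi> :: "'b \<Rightarrow> 'a::euclidean_space"
  assumes M: "prob_space M" and F: "config_fun F" and [measurable]: "\<psi> \<in> M \<rightarrow>\<^sub>M borel"
  shows "(\<integral>w. F (map (\<lambda>i. \<psi> (w i)) [0..<m] @ xs) \<partial>PiM UNIV (\<lambda>_::nat. M)) = (sample_point M \<psi> ^^ m) F xs"
proof (induction m arbitrary: xs)
  case 0
  interpret M: prob_space M by fact
  interpret sequence_space M by unfold_locales
  show ?case by (simp add: P.prob_space)
next
  case (Suc m)
  interpret M: prob_space M by fact
  obtain D where D: "\<And>xs. \<bar>F xs\<bar> \<le> D" using config_fun_bound[OF F] by blast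
  have cn: "F (map (\<lambda>i. \<psi> (case_nat z w i)) [0..<Suc m] @ xs) = F (map (\<lambda>i. \<psi> (w i)) [0..<m] @ (\<psi> z # xs))" for z w
    by (rule config_fun_cong[OF F])
      (simp add: atLeast0_lessThan_Suc_eq_insert_0 image_image insert_commute del: upt_Suc image_Suc_atLeastLessThan)
  have "(\<integral>w. F (map (\<lambda>i. \<psi> (w i)) [0..<Suc m] @ xs) \<partial>PiM UNIV (\<lambda>_::nat. M))
     = (\<integral>z. (\<integral>w. F (map (\<lambda>i. \<psi> (case_nat z w i)) [0..<Suc m] @ xs) \<partial>PiM UNIV (\<lambda>_::nat. M)) \<partial>M)"
    by (rule integral_PiM_nat_Suc[OF M _ D]) (rule measurable_config_fun_map[OF F], measurable)
  also have "\<dots> = (\<integral>z. (sample_point M \<psi> ^^ m) F (\<psi> z # xs) \<partial>M)"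
    unfolding cn Suc.IH ..
  finally show ?case
    by (simp add: sample_point_def[of M \<psi> "(sample_point M \<psi> ^^ m) F"] del: upt_Suc)
qed

section \<open>The algebra of the operators that add a point of a given, unnormalised
  intensity\<close>

definition add_point :: "('a::euclidean_space \<Rightarrow> real) \<Rightarrow> ('a list \<Rightarrow> real) \<Rightarrow> 'a list \<Rightarrow> real" where
  "add_point g F xs = (\<integral>z. g z * F (z # xs) \<partial>lborel)"

definition weight :: "('a::euclidean_space \<Rightarrow> real) \<Rightarrow> bool" where
  "weight g \<longleftrightarrow> integrable lborel g \<and> (\<forall>x. g x \<ge> 0)"

definition mass :: "('a::euclidean_space \<Rightarrow> real) \<Rightarrow> real" where
  "mass g = (\<integral>x. g x \<partial>lborel)"

lemma mass_nonneg: "weight g \<Longrightarrow> mass g \<ge> 0"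
  unfolding mass_def weight_def by simp

lemma weight_measurable[measurable_dest]: "weight g \<Longrightarrow> g \<in> borel_measurable borel"
  unfolding weight_def by (auto dest: borel_measurable_integrable)

lemma integrable_add_point:
  assumes g: "integrable lborel g" and F: "config_fun F"
  shows "integrable lborel (\<lambda>z. g z * F (z # xs))"
proof -
  obtain D where D: "\<And>xs. \<bar>F xs\<bar> \<le> D" "D \<ge> 0" using config_fun_bound[OF F] by blast
  have [measurable]: "(\<lambda>z. F (z # xs)) \<in> borel_measurable borel"
    by (rule measurable_config_fun_Cons[OF F]) simp
  show ?thesis
  proof (rule Bochner_Integration.integrable_bound)
    show "integrable lborel (\<lambda>z. D * g z)" using g by simp
    show "(\<lambda>z. g z * F (z # xs)) \<in> borel_measurable lborel"
      using borel_measurable_integrable[OF g] by measurable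
    show "AE x in lborel. norm (g x * F (x # xs)) \<le> norm (D * g x)"
      using D by (auto simp: abs_mult mult.commute[of _ "\<bar>g _\<bar>"] intro!: mult_left_mono)
  qed
qed

lemma abs_add_point_le:
  assumes g: "integrable lborel g" and F: "\<And>xs. \<bar>F xs\<bar> \<le> D"
  shows "\<bar>add_point g F xs\<bar> \<le> (\<integral>x. \<bar>g x\<bar> \<partial>lborel) * D"
proof -
  have D: "D \<ge> 0" using F[of "[]"] by linarith
  show ?thesis
  proof (cases "integrable lborel (\<lambda>z. g z * F (z # xs))")
    case True
    have "\<bar>add_point g F xs\<bar> \<le> (\<integral>z. \<bar>g z * F (z # xs)\<bar> \<partial>lborel)"
      unfolding add_point_def by simp
    also have "\<dots> \<le> (\<integral>z. \<bar>g z\<bar> * D \<partial>lborel)"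
      using integrable_abs[OF True] g F
      by (intro integral_mono) (auto simp: abs_mult intro!: mult_left_mono)
    finally show ?thesis by simp
  next
    case False
    then show ?thesis using D by (simp add: add_point_def not_integrable_integral_eq)
  qed
qed

lemma abs_add_point_weight_le:
  assumes "weight g" "\<And>xs. \<bar>F xs\<bar> \<le> D"
  shows "\<bar>add_point g F xs\<bar> \<le> mass g * D"
  using abs_add_point_le[of g F D xs] assms unfolding weight_def mass_def by simp

lemma config_fun_add_point:
  assumes g: "weight g" and F: "config_fun F"
  shows "config_fun (add_point g F)"
proof -
  obtain D where D: "\<And>xs. \<bar>F xs\<bar> \<le> D" using config_fun_bound[OF F] by blast
  show ?thesis
  proof (rule config_funI[where D="mass g * D"])
    fix n :: nat
    have [measurable]: "g \<in> borel_measurable borel" using g by (rule weight_measurable)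
    have "(\<lambda>w. F (snd w # map (\<lambda>i. fst w i) [0..<n] @ [])) \<in>
       borel_measurable (PiM UNIV (\<lambda>_::nat. borel) \<Otimes>\<^sub>M lborel)"
      by (rule measurable_config_fun_Cons_map[OF F]) measurable
    then have [measurable]: "(\<lambda>w. F (snd w # map (fst w) [0..<n])) \<in>
       borel_measurable (PiM UNIV (\<lambda>_::nat. borel) \<Otimes>\<^sub>M lborel)"
      by simp
    have "case_prod (\<lambda>y z. g z * F (z # map y [0..<n])) \<in>
       borel_measurable (PiM UNIV (\<lambda>_::nat. borel) \<Otimes>\<^sub>M lborel)"
      unfolding case_prod_beta' by measurable
    then show "(\<lambda>y. add_point g F (map y [0..<n])) \<in> borel_measurable (PiM UNIV (\<lambda>_::nat. borel))"
      unfolding add_point_def by (rule lborel.borel_measurable_lebesgue_integral)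
  next
    fix xs show "\<bar>add_point g F xs\<bar> \<le> mass g * D" by (rule abs_add_point_weight_le[OF g D])
  next
    fix xs ys :: "'a list" assume "insert 0 (set xs) = insert 0 (set ys)"
    then have "F (z # xs) = F (z # ys)" for z by (intro config_fun_cong[OF F]) auto
    then show "add_point g F xs = add_point g F ys"
      unfolding add_point_def by simp
  qed
qed

lemma config_fun_add_point_power:
  "weight g \<Longrightarrow> config_fun F \<Longrightarrow> config_fun ((add_point g ^^ m) F)"
  by (induction m) (auto intro: config_fun_add_point)

lemma abs_add_point_power_le:
  assumes g: "weight g" and D: "\<And>xs. \<bar>F xs\<bar> \<le> D"
  shows "\<bar>(add_point g ^^ m) F xs\<bar> \<le> mass g ^ m * D"
proof (induction m arbitrary: xs)
  case 0 then show ?case using D by simp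
next
  case (Suc m)
  show ?case using abs_add_point_weight_le[OF g Suc.IH] by (simp add: mult.assoc)
qed

text \<open>Fubini, combined with the fact that \<open>F\<close> does not see the order of the two
  new points.\<close>

lemma add_point_commute:
  assumes g: "weight g" and h: "weight h" and F: "config_fun F"
  shows "add_point g (add_point h F) = add_point h (add_point g F)"
proof
  fix xs
  obtain D where D: "\<And>xs. \<bar>F xs\<bar> \<le> D" "D \<ge> 0" using config_fun_bound[OF F] by blast
  have [measurable]: "g \<in> borel_measurable borel" "h \<in> borel_measurable borel"
    using g h weight_measurable by auto
  have [measurable]: "(\<lambda>w. F (fst w # snd w # xs)) \<in> borel_measurable (lborel \<Otimes>\<^sub>M lborel)"
  proof -
    have "(\<lambda>w. F (map (\<lambda>q. q w) (fst # snd # map (\<lambda>x _. x) xs))) \<in> borel_measurable (lborel \<Otimes>\<^sub>M lborel)"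
      by (rule measurable_config_fun[OF F]) auto
    then show ?thesis by (simp add: o_def)
  qed
  have "integrable (lborel \<Otimes>\<^sub>M lborel) (\<lambda>w. g (fst w) * h (snd w))"
    using g h unfolding weight_def
    by (intro lborel_pair.Fubini_integrable) (auto simp: abs_mult)
  then have "integrable (lborel \<Otimes>\<^sub>M lborel) (\<lambda>w. D * (g (fst w) * h (snd w)))" by simp
  then have int: "integrable (lborel \<Otimes>\<^sub>M lborel) (\<lambda>(x, y). g x * h y * F (x # y # xs))"
    unfolding case_prod_beta'
  proof (rule Bochner_Integration.integrable_bound)
    show "(\<lambda>w. g (fst w) * h (snd w) * F (fst w # snd w # xs)) \<in> borel_measurable (lborel \<Otimes>\<^sub>M lborel)"
      by measurable
    show "AE w in lborel \<Otimes>\<^sub>M lborel. norm (g (fst w) * h (snd w) * F (fst w # snd w # xs))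
        \<le> norm (D * (g (fst w) * h (snd w)))"
      using D by (auto simp: abs_mult mult.commute[of D] intro!: mult_left_mono)
  qed
  have "add_point g (add_point h F) xs = (\<integral>x. (\<integral>y. g x * h y * F (x # y # xs) \<partial>lborel) \<partial>lborel)"
    unfolding add_point_def by (simp add: config_fun_Cons_commute[OF F] mult.assoc)
  also have "\<dots> = (\<integral>y. (\<integral>x. g x * h y * F (x # y # xs) \<partial>lborel) \<partial>lborel)"
    by (rule lborel_pair.Fubini_integral[OF int, symmetric])
  also have "\<dots> = add_point h (add_point g F) xs"
  proof -
    have "(\<integral>x. g x * h y * F (x # y # xs) \<partial>lborel) = h y * (\<integral>x. g x * F (x # y # xs) \<partial>lborel)" for y
      by (subst integral_mult_right_zero[symmetric]) (simp add: mult_ac)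
    then show ?thesis unfolding add_point_def by simp
  qed
  finally show "add_point g (add_point h F) xs = add_point h (add_point g F) xs" .
qed

lemma add_point_add:
  assumes g: "weight g" and h: "weight h" and F: "config_fun F"
  shows "add_point (\<lambda>x. g x + h x) F = (\<lambda>xs. add_point g F xs + add_point h F xs)"
  unfolding add_point_def distrib_right
  using g h by (auto simp: weight_def integrable_add_point[OF _ F])

lemma add_point_diff:
  assumes g: "integrable lborel g" and h: "integrable lborel h" and F: "config_fun F"
  shows "add_point (\<lambda>x. g x - h x) F xs = add_point g F xs - add_point h F xs"
  unfolding add_point_def left_diff_distrib
  using g h by (auto simp: weight_def integrable_add_point[OF _ F])

lemma add_point_fun_diff:
  assumes g: "weight g" and F: "config_fun F" "config_fun G"
  shows "add_point g (\<lambda>xs. F xs - G xs) xs = add_point g F xs - add_point g G xs"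
  unfolding add_point_def right_diff_distrib
  using g by (auto simp: weight_def integrable_add_point F)

lemma add_point_sum:
  assumes g: "weight g" and G: "\<And>m. m \<in> I \<Longrightarrow> config_fun (G m)"
  shows "add_point g (\<lambda>xs. \<Sum>m\<in>I. c m * G m xs) xs = (\<Sum>m\<in>I. c m * add_point g (G m) xs)"
proof -
  have "integrable lborel (\<lambda>z. c m * (g z * G m (z # xs)))" if "m \<in> I" for m
    using integrable_add_point[OF _ G[OF that]] g by (auto simp: weight_def)
  then have "(\<integral>z. (\<Sum>m\<in>I. c m * (g z * G m (z # xs))) \<partial>lborel) = (\<Sum>m\<in>I. c m * add_point g (G m) xs)"
    unfolding add_point_def by (subst Bochner_Integration.integral_sum) auto
  then show ?thesis unfolding add_point_def sum_distrib_left by (simp add: mult_ac)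
qed

lemma add_point_cmult: "add_point g (\<lambda>xs. c * F xs) xs = c * add_point g F xs"
  unfolding add_point_def by (subst integral_mult_right_zero[symmetric]) (simp add: mult_ac)

lemma add_point_scale: "add_point (\<lambda>x. c * g x) F xs = c * add_point g F xs"
  unfolding add_point_def by (subst integral_mult_right_zero[symmetric]) (simp add: mult_ac)

lemma add_point_power_scale:
  "(add_point (\<lambda>x. c * g x) ^^ m) F = (\<lambda>xs. c ^ m * (add_point g ^^ m) F xs)"
proof (induction m)
  case (Suc m)
  show ?case
    by (rule ext, subst funpow.simps(2), subst o_apply, subst Suc.IH)
      (simp add: add_point_scale[of c g] add_point_cmult mult_ac)
qed simp

lemma weight_add: "weight g \<Longrightarrow> weight h \<Longrightarrow> weight (\<lambda>x. g x + h x)"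
  unfolding weight_def by auto

lemma mass_add: "weight g \<Longrightarrow> weight h \<Longrightarrow> mass (\<lambda>x. g x + h x) = mass g + mass h"
  unfolding weight_def mass_def by simp

text \<open>Pascal's rule in summed form, the common induction step of the two binomial expansions
  of operators below.\<close>

lemma pascal_sum:
  fixes t :: "nat \<Rightarrow> real"
  shows "(\<Sum>m\<le>Suc n. real (Suc n choose m) * t m) =
    (\<Sum>m\<le>n. real (n choose m) * t (Suc m)) + (\<Sum>m\<le>n. real (n choose m) * t m)"
proof -
  have "(\<Sum>m\<le>Suc n. real (Suc n choose m) * t m) =
     t 0 + (\<Sum>m\<le>n. real (Suc n choose Suc m) * t (Suc m))"
    by (subst sum.atMost_Suc_shift) simp
  also have "\<dots> = (\<Sum>m\<le>n. real (n choose m) * t (Suc m)) + (t 0 + (\<Sum>m\<le>n. real (n choose Suc m) * t (Suc m)))"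
    by (simp add: distrib_right sum.distrib)
  also have "t 0 + (\<Sum>m\<le>n. real (n choose Suc m) * t (Suc m)) = (\<Sum>m\<le>Suc n. real (n choose m) * t m)"
    by (subst sum.atMost_Suc_shift) simp
  also have "\<dots> = (\<Sum>m\<le>n. real (n choose m) * t m)" by simp
  finally show ?thesis .
qed

text \<open>Binomial theorem for a multiple of the identity plus \<open>add_point g\<close>. For
  \<open>c = 1 - mass g\<close> the right side is the expectation over a binomial number of
  points.\<close>

lemma affine_add_point_power:
  assumes g: "weight g" and F: "config_fun F"
  shows "((\<lambda>F xs. c * F xs + add_point g F xs) ^^ n) F =
    (\<lambda>xs. \<Sum>m\<le>n. real (n choose m) * c ^ (n - m) * (add_point g ^^ m) F xs)"
proof (induction n)
  case (Suc n)
  show ?case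
  proof
    fix xs
    let ?b = "\<lambda>m. (add_point g ^^ m) F xs"
    have "((\<lambda>F xs. c * F xs + add_point g F xs) ^^ Suc n) F xs =
      c * (\<Sum>m\<le>n. real (n choose m) * c ^ (n - m) * ?b m) +
      (\<Sum>m\<le>n. real (n choose m) * c ^ (n - m) * ?b (Suc m))"
      by (simp add: Suc.IH add_point_sum[OF g config_fun_add_point_power[OF g F]])
    also have "c * (\<Sum>m\<le>n. real (n choose m) * c ^ (n - m) * ?b m) =
       (\<Sum>m\<le>n. real (n choose m) * (c ^ (Suc n - m) * ?b m))"
      unfolding sum_distrib_left by (intro sum.cong refl) (simp add: Suc_diff_le mult_ac)
    also have "(\<Sum>m\<le>n. real (n choose m) * c ^ (n - m) * ?b (Suc m)) =
       (\<Sum>m\<le>n. real (n choose m) * (c ^ (Suc n - Suc m) * ?b (Suc m)))" by (simp add: mult.assoc)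
    finally show "((\<lambda>F xs. c * F xs + add_point g F xs) ^^ Suc n) F xs =
        (\<Sum>m\<le>Suc n. real (Suc n choose m) * c ^ (Suc n - m) * ?b m)"
      using pascal_sum[of n "\<lambda>m. c ^ (Suc n - m) * ?b m"] by (simp only: mult.assoc add.commute)
  qed
qed simp

lemma add_point_power_commute:
  assumes g: "weight g" and h: "weight h" and F: "config_fun F"
  shows "add_point h ((add_point g ^^ m) F) = (add_point g ^^ m) (add_point h F)"
proof (induction m)
  case (Suc m)
  have "add_point h (add_point g ((add_point g ^^ m) F)) = add_point g (add_point h ((add_point g ^^ m) F))"
    by (rule add_point_commute[OF h g config_fun_add_point_power[OF g F]])
  then show ?case using Suc.IH by simp
qed simp

text \<open>Binomial theorem for two commuting operators. Commutation enters in \<open>bh\<close>,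
  where \<open>add_point h\<close> has to pass the powers of \<open>add_point g\<close>.\<close>

lemma add_point_add_power:
  assumes g: "weight g" and h: "weight h" and F: "config_fun F"
  shows "(add_point (\<lambda>x. g x + h x) ^^ n) F =
    (\<lambda>xs. \<Sum>m\<le>n. real (n choose m) * (add_point g ^^ m) ((add_point h ^^ (n - m)) F) xs)"
proof (induction n)
  case (Suc n)
  define b where "b m k = (add_point g ^^ m) ((add_point h ^^ k) F)" for m k
  have cb: "config_fun (b m k)" for m k
    unfolding b_def by (intro config_fun_add_point_power g h F)
  have bg: "add_point g (b m k) = b (Suc m) k" for m k unfolding b_def by simp
  have bh: "add_point h (b m k) = b m (Suc k)" for m k
    unfolding b_def by (subst add_point_power_commute[OF g h config_fun_add_point_power[OF h F]]) simp
  have IH: "(add_point (\<lambda>x. g x + h x) ^^ n) F = (\<lambda>xs. \<Sum>m\<le>n. real (n choose m) * b m (n - m) xs)"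
    using Suc.IH unfolding b_def .
  have cIH: "config_fun ((add_point (\<lambda>x. g x + h x) ^^ n) F)"
    by (intro config_fun_add_point_power weight_add g h F)
  show ?case
  proof
    fix xs
    have "(add_point (\<lambda>x. g x + h x) ^^ Suc n) F xs =
      add_point g ((add_point (\<lambda>x. g x + h x) ^^ n) F) xs + add_point h ((add_point (\<lambda>x. g x + h x) ^^ n) F) xs"
      using add_point_add[OF g h cIH] by simp
    also have "\<dots> = (\<Sum>m\<le>n. real (n choose m) * b (Suc m) (n - m) xs) + (\<Sum>m\<le>n. real (n choose m) * b m (Suc (n - m)) xs)"
      unfolding IH by (simp add: add_point_sum[OF g cb] add_point_sum[OF h cb] bg bh)
    also have "(\<Sum>m\<le>n. real (n choose m) * b m (Suc (n - m)) xs) = (\<Sum>m\<le>n. real (n choose m) * b m (Suc n - m) xs)"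
      by (intro sum.cong refl) (simp add: Suc_diff_le)
    also have "(\<Sum>m\<le>n. real (n choose m) * b (Suc m) (n - m) xs) + \<dots> = (\<Sum>m\<le>Suc n. real (Suc n choose m) * b m (Suc n - m) xs)"
      using pascal_sum[of n "\<lambda>m. b m (Suc n - m) xs"] by simp
    finally show "(add_point (\<lambda>x. g x + h x) ^^ Suc n) F xs =
      (\<Sum>m\<le>Suc n. real (Suc n choose m) * (add_point g ^^ m) ((add_point h ^^ (Suc n - m)) F) xs)"
      unfolding b_def .
  qed
qed simp

section \<open>Series of functionals and the exponential law\<close>

lemma config_fun_suminf:
  assumes G: "\<And>k. config_fun (G k)" and d: "\<And>k xs. \<bar>G k xs\<bar> \<le> d k" "summable d"
  shows "config_fun (\<lambda>xs. \<Sum>k. G k xs)"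
proof (rule config_funI[where D="suminf d"])
  fix n show "(\<lambda>y. \<Sum>k. G k (map y [0..<n])) \<in> borel_measurable (PiM UNIV (\<lambda>_::nat. borel))"
    using G unfolding config_fun_def by (intro borel_measurable_suminf) blast
next
  fix xs
  have s: "summable (\<lambda>k. \<bar>G k xs\<bar>)" using d by (intro summable_comparison_test[OF _ d(2)]) auto
  have "\<bar>\<Sum>k. G k xs\<bar> \<le> (\<Sum>k. \<bar>G k xs\<bar>)" by (rule summable_rabs[OF s])
  also have "\<dots> \<le> suminf d" by (rule suminf_le[OF d(1) s d(2)])
  finally show "\<bar>\<Sum>k. G k xs\<bar> \<le> suminf d" .
next
  fix xs ys :: "'a list" assume "insert 0 (set xs) = insert 0 (set ys)"
  then have "G k xs = G k ys" for k by (rule config_fun_cong[OF G])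
  then show "(\<Sum>k. G k xs) = (\<Sum>k. G k ys)" by simp
qed

lemma add_point_suminf:
  assumes g: "weight g" and G: "\<And>k. config_fun (G k)" and d: "\<And>k xs. \<bar>G k xs\<bar> \<le> d k" "summable d"
  shows "add_point g (\<lambda>xs. \<Sum>k. G k xs) xs = (\<Sum>k. add_point g (G k) xs)"
proof -
  have gi: "integrable lborel g" and g0: "\<And>x. g x \<ge> 0" using g by (auto simp: weight_def)
  have s: "summable (\<lambda>k. norm (G k xs))" for xs
    using d by (intro summable_comparison_test[OF _ d(2)]) auto
  have "add_point g (\<lambda>xs. \<Sum>k. G k xs) xs = (\<integral>z. (\<Sum>k. g z * G k (z # xs)) \<partial>lborel)"
    unfolding add_point_def using s[THEN summable_norm_cancel] by (simp add: suminf_mult)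
  also have "\<dots> = (\<Sum>k. (\<integral>z. g z * G k (z # xs) \<partial>lborel))"
  proof (rule integral_suminf)
    show "integrable lborel (\<lambda>z. g z * G k (z # xs))" for k by (rule integrable_add_point[OF gi G])
    show "AE z in lborel. summable (\<lambda>k. norm (g z * G k (z # xs)))"
      using s by (auto simp: abs_mult intro!: summable_mult)
    have "(\<integral>z. norm (g z * G k (z # xs)) \<partial>lborel) \<le> mass g * d k" for k
    proof -
      have "(\<integral>z. norm (g z * G k (z # xs)) \<partial>lborel) \<le> (\<integral>z. g z * d k \<partial>lborel)"
        using integrable_abs[OF integrable_add_point[OF gi G]] gi g0 d(1)
        by (intro integral_mono) (auto simp: abs_mult intro!: mult_left_mono)
      then show ?thesis by (simp add: mass_def)
    qed
    then show "summable (\<lambda>k. (\<integral>z. norm (g z * G k (z # xs)) \<partial>lborel))"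
      by (intro summable_comparison_test[OF _ summable_mult[OF d(2), of "mass g"]]) auto
  qed
  finally show ?thesis unfolding add_point_def .
qed

lemma add_point_power_suminf:
  assumes g: "weight g" and G: "\<And>k. config_fun (G k)" and d: "\<And>k xs. \<bar>G k xs\<bar> \<le> d k" "summable d"
  shows "(add_point g ^^ m) (\<lambda>xs. \<Sum>k. G k xs) = (\<lambda>xs. \<Sum>k. (add_point g ^^ m) (G k) xs)"
proof (induction m)
  case (Suc m)
  have "add_point g (\<lambda>xs. \<Sum>k. (add_point g ^^ m) (G k) xs) xs = (\<Sum>k. add_point g ((add_point g ^^ m) (G k)) xs)" for xs
    by (rule add_point_suminf[OF g, where d="\<lambda>k. mass g ^ m * d k"])
      (auto intro: config_fun_add_point_power g G abs_add_point_power_le d summable_mult)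
  then show ?case using Suc.IH by auto
qed simp

text \<open>The expectation of \<open>F\<close> at \<open>xs\<close> together with a Poisson process of intensity \<open>g\<close>; as an
  operator on \<open>F\<close> it is the exponential of \<open>add_point g\<close> minus the mass of \<open>g\<close>.\<close>

definition poisson_fun :: "('a::euclidean_space \<Rightarrow> real) \<Rightarrow> ('a list \<Rightarrow> real) \<Rightarrow> 'a list \<Rightarrow> real" where
  "poisson_fun g F xs = (\<Sum>m. exp (- mass g) / fact m * (add_point g ^^ m) F xs)"

lemma abs_poisson_term_le:
  assumes g: "weight g" and D: "\<And>xs. \<bar>F xs\<bar> \<le> D"
  shows "\<bar>exp (- mass g) / fact m * (add_point g ^^ m) F xs\<bar> \<le> D * exp (- mass g) * (mass g ^ m / fact m)"
  using abs_add_point_power_le[OF g D, where m=m and xs=xs]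
  by (simp add: abs_mult field_simps)

lemma summable_pow_fact: "summable (\<lambda>m. c * ((x::real) ^ m / fact m))"
  using summable_exp[of x] by (intro summable_mult) (simp add: divide_inverse mult.commute)

lemma config_fun_cmult: "config_fun F \<Longrightarrow> config_fun (\<lambda>xs. c * F xs)"
proof -
  assume F: "config_fun F"
  obtain D where D: "\<And>xs. \<bar>F xs\<bar> \<le> D" using config_fun_bound[OF F] by blast
  show ?thesis
  proof (rule config_funI[where D="\<bar>c\<bar> * D"])
    show "(\<lambda>y. c * F (map y [0..<n])) \<in> borel_measurable (PiM UNIV (\<lambda>_::nat. borel))" for n
      using F unfolding config_fun_def by (intro borel_measurable_times borel_measurable_const) blast
  qed (auto simp: abs_mult intro!: mult_left_mono D dest: config_fun_cong[OF F])
qed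

lemma config_fun_poisson_fun:
  assumes g: "weight g" and F: "config_fun F"
  shows "config_fun (poisson_fun g F)"
proof -
  obtain D where D: "\<And>xs. \<bar>F xs\<bar> \<le> D" using config_fun_bound[OF F] by blast
  show ?thesis unfolding poisson_fun_def[abs_def]
    by (rule config_fun_suminf[OF config_fun_cmult[OF config_fun_add_point_power[OF g F]]
          abs_poisson_term_le[OF g D] summable_pow_fact])
qed

lemma suminf_eq_infsum:
  fixes f :: "nat \<Rightarrow> real"
  assumes "summable (\<lambda>n. \<bar>f n\<bar>)" shows "suminf f = infsum f UNIV"
  using norm_summable_imp_has_sum[of f "suminf f"] assms
  by (auto simp: summable_rabs_cancel summable_sums intro!: infsumI[symmetric])

text \<open>The array \<open>b\<close> is not itself a product but is dominated by one. This makes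
  it absolutely summable over all pairs, so it may be summed along antidiagonals through the
  bijection of \<open>(n, m)\<close> with \<open>(m, n - m)\<close>.\<close>

lemma suminf_suminf_triangle:
  fixes b :: "nat \<Rightarrow> nat \<Rightarrow> real"
  assumes b: "\<And>m k. \<bar>b m k\<bar> \<le> u m * v k" and u: "summable u" "\<And>m. u m \<ge> 0" and v: "summable v" "\<And>k. v k \<ge> 0"
  shows "(\<Sum>m. \<Sum>k. b m k) = (\<Sum>n. \<Sum>m\<le>n. b m (n - m))"
proof -
  have "((\<lambda>k. u m * v k) has_sum u m * suminf v) UNIV" for m
    using u v by (intro norm_summable_imp_has_sum sums_mult summable_sums)
      (auto simp: abs_mult intro!: summable_mult)
  moreover have "(\<lambda>m. u m * suminf v) summable_on UNIV"
    using u v by (intro norm_summable_imp_summable_on)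
      (auto simp: abs_mult suminf_nonneg intro!: summable_mult2)
  ultimately have "(\<lambda>(m, k). u m * v k) summable_on (UNIV \<times> UNIV)"
    using u v by (intro summable_on_SigmaI) auto
  then have S: "(\<lambda>(m, k). b m k) summable_on (UNIV \<times> UNIV)"
  proof -
    assume uv: "(\<lambda>(m, k). u m * v k) summable_on (UNIV \<times> UNIV)"
    have "(\<lambda>x. norm (case x of (m, k) \<Rightarrow> b m k)) summable_on (UNIV \<times> UNIV)"
      by (rule summable_on_comparison_test[OF uv]) (use b in auto)
    then show ?thesis by (rule Infinite_Sum.abs_summable_summable)
  qed
  have s1: "summable (\<lambda>k. \<bar>b m k\<bar>)" for m
    using b by (intro summable_comparison_test[OF _ summable_mult[OF v(1), of "u m"]]) auto
  have s2: "summable (\<lambda>m. \<bar>\<Sum>k. b m k\<bar>)"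
  proof (rule summable_comparison_test[OF _ summable_mult2[OF u(1), of "suminf v"]], intro exI allI impI)
    fix m
    have "\<bar>\<Sum>k. b m k\<bar> \<le> (\<Sum>k. \<bar>b m k\<bar>)" by (rule summable_rabs[OF s1])
    also have "\<dots> \<le> (\<Sum>k. u m * v k)" by (rule suminf_le[OF b s1 summable_mult[OF v(1)]])
    also have "\<dots> = u m * suminf v" using v by (simp add: suminf_mult)
    finally show "norm \<bar>\<Sum>k. b m k\<bar> \<le> u m * suminf v" by simp
  qed
  let ?T = "SIGMA n:UNIV. {..n::nat}"
  have bij: "bij_betw (\<lambda>(n, m). (m, n - m)) ?T (UNIV \<times> UNIV)"
    by (rule bij_betwI[where g="\<lambda>(m, k). (m + k, m)"]) auto
  have S2: "(\<lambda>(n, m). b m (n - m)) summable_on ?T"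
    using summable_on_reindex_bij_betw[OF bij, of "\<lambda>(m, k). b m k"] S by (simp add: case_prod_unfold)
  have "summable (\<lambda>n. \<bar>\<Sum>m\<le>n. b m (n - m)\<bar>)"
  proof (rule summable_comparison_test[OF _ summable_Cauchy_product[of u v]], intro exI allI impI)
    fix n show "norm \<bar>\<Sum>m\<le>n. b m (n - m)\<bar> \<le> (\<Sum>i\<le>n. u i * v (n - i))"
      using b by (auto intro!: order_trans[OF sum_abs] sum_mono)
  qed (use u v in auto)
  then have "(\<Sum>n. \<Sum>m\<le>n. b m (n - m)) = infsum (\<lambda>n. infsum (\<lambda>m. b m (n - m)) {..n}) UNIV"
    by (simp add: suminf_eq_infsum)
  also have "\<dots> = infsum (\<lambda>(n, m). b m (n - m)) ?T" by (rule infsum_Sigma'_banach[OF S2])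
  also have "\<dots> = infsum (\<lambda>(m, k). b m k) (UNIV \<times> UNIV)"
    using infsum_reindex_bij_betw[OF bij, of "\<lambda>(m, k). b m k"] by (simp add: case_prod_unfold)
  also have "\<dots> = infsum (\<lambda>m. infsum (\<lambda>k. b m k) UNIV) UNIV"
    by (rule infsum_Sigma'_banach[OF S, symmetric])
  also have "\<dots> = (\<Sum>m. \<Sum>k. b m k)" by (simp add: suminf_eq_infsum s1 s2 flip: suminf_eq_infsum)
  finally show ?thesis ..
qed

text \<open>The exponential law for commuting operators. On the antidiagonal
  \<open>m + k = n\<close> the factor \<open>1 / (fact m * fact k)\<close> equals
  \<open>(n choose m) / fact n\<close>, so the double series collapses to the binomial expansion of
  the powers of the operator for \<open>g + h\<close>.\<close>

theorem poisson_fun_superposition: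
  assumes g: "weight g" and h: "weight h" and F: "config_fun F"
  shows "poisson_fun g (poisson_fun h F) = poisson_fun (\<lambda>x. g x + h x) F"
proof
  fix xs
  obtain D where D: "\<And>xs. \<bar>F xs\<bar> \<le> D" "D \<ge> 0" using config_fun_bound[OF F] by blast
  define b where "b m k = exp (- mass g) / fact m * (exp (- mass h) / fact k * (add_point g ^^ m) ((add_point h ^^ k) F) xs)" for m k
  have pw: "(add_point g ^^ m) (\<lambda>xs. c * G xs) = (\<lambda>xs. c * (add_point g ^^ m) G xs)" for m c G
    by (induction m) (auto simp: add_point_cmult)
  have bd: "\<bar>b m k\<bar> \<le> (D * exp (- mass g) * (mass g ^ m / fact m)) * (exp (- mass h) * (mass h ^ k / fact k))" for m k
  proof -
    have "\<bar>(add_point g ^^ m) ((add_point h ^^ k) F) xs\<bar> \<le> mass g ^ m * (mass h ^ k * D)"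
      by (intro abs_add_point_power_le g h D)
    then have "\<bar>b m k\<bar> \<le> exp (- mass g) / fact m * (exp (- mass h) / fact k * (mass g ^ m * (mass h ^ k * D)))"
      unfolding b_def by (simp add: abs_mult divide_right_mono)
    then show ?thesis by (simp add: mult_ac)
  qed
  have sb: "summable (\<lambda>k. b m k)" for m
    by (rule summable_comparison_test[OF _ summable_mult[OF summable_pow_fact[of "exp (- mass h)" "mass h"],
        of "D * exp (- mass g) * (mass g ^ m / fact m)"]]) (use bd in \<open>simp only: real_norm_def, blast\<close>)
  have "poisson_fun g (poisson_fun h F) xs = (\<Sum>m. \<Sum>k. b m k)"
  proof -
    have "(add_point g ^^ m) (poisson_fun h F) xs =
      (\<Sum>k. exp (- mass h) / fact k * (add_point g ^^ m) ((add_point h ^^ k) F) xs)" for m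
      unfolding poisson_fun_def[abs_def]
      by (subst add_point_power_suminf[OF g config_fun_cmult[OF config_fun_add_point_power[OF h F]]
           abs_poisson_term_le[OF h D(1)] summable_pow_fact]) (simp only: pw)
    moreover have "summable (\<lambda>k. exp (- mass h) / fact k * (add_point g ^^ m) ((add_point h ^^ k) F) xs)" for m
      using summable_mult[OF sb[of m], of "fact m / exp (- mass g)"] unfolding b_def by simp
    ultimately have "exp (- mass g) / fact m * (add_point g ^^ m) (poisson_fun h F) xs = (\<Sum>k. b m k)" for m
      unfolding b_def by (simp only: suminf_mult)
    then show ?thesis unfolding poisson_fun_def[of g] by simp
  qed
  also have "\<dots> = (\<Sum>n. \<Sum>m\<le>n. b m (n - m))"
    using D mass_nonneg[OF g] mass_nonneg[OF h]
    by (intro suminf_suminf_triangle[OF bd] summable_pow_fact) auto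
  also have "\<dots> = poisson_fun (\<lambda>x. g x + h x) F xs"
  proof -
    have "(\<Sum>m\<le>n. b m (n - m)) = exp (- mass (\<lambda>x. g x + h x)) / fact n * (add_point (\<lambda>x. g x + h x) ^^ n) F xs" for n
      unfolding add_point_add_power[OF g h F] sum_distrib_left
    proof (intro sum.cong refl)
      fix m assume "m \<in> {..n}"
      then have c: "real (n choose m) = fact n / (fact m * fact (n - m))" by (simp add: binomial_fact)
      show "b m (n - m) = exp (- mass (\<lambda>x. g x + h x)) / fact n *
         (real (n choose m) * (add_point g ^^ m) ((add_point h ^^ (n - m)) F) xs)"
        unfolding b_def mass_add[OF g h] c minus_add_distrib exp_add by simp
    qed
    then show ?thesis unfolding poisson_fun_def by simp
  qed
  finally show "poisson_fun g (poisson_fun h F) xs = poisson_fun (\<lambda>x. g x + h x) F xs" .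
qed

section \<open>Poisson limit of rescaled samples\<close>

text \<open>A sample point lands outside \<open>B\<close> with probability \<open>1 - mass g\<close>
  and then sits at the origin, where \<open>F\<close> ignores it; inside \<open>B\<close> it
  contributes \<open>add_point g\<close>. So averaging over one point is an affine operator in
  \<open>add_point g\<close>.\<close>

lemma sample_point_collapse:
  fixes \<phi> :: "'b \<Rightarrow> 'a::euclidean_space"
  assumes M: "prob_space M" and [measurable]: "\<phi> \<in> M \<rightarrow>\<^sub>M borel" "B \<in> sets borel" "\<gamma> \<in> borel_measurable borel"
    and \<gamma>: "\<And>x. \<gamma> x \<ge> 0" "distr M borel \<phi> = density lborel (\<lambda>x. ennreal (\<gamma> x))"
  defines "g \<equiv> \<lambda>x. \<gamma> x * indicator B x"
  shows "weight g" "mass g \<le> 1"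
    "config_fun F \<Longrightarrow> sample_point M (\<lambda>z. if \<phi> z \<in> B then \<phi> z else 0) F xs = (1 - mass g) * F xs + add_point g F xs"
proof -
  interpret prob_space M by fact
  interpret D: prob_space "density lborel (\<lambda>x. ennreal (\<gamma> x))"
    using prob_space_distr[of \<phi> borel] \<gamma>(2) by simp
  have "(\<integral>\<^sup>+x. ennreal (\<gamma> x) \<partial>lborel) = 1"
    using D.emeasure_space_1 by (simp add: emeasure_density)
  then have i\<gamma>: "integrable lborel \<gamma>" "(\<integral>x. \<gamma> x \<partial>lborel) = 1"
    using \<gamma>(1) by (auto simp: integral_eq_nn_integral integrable_iff_bounded)
  have ig: "integrable lborel g"
    unfolding g_def by (rule integrable_real_mult_indicator) (use i\<gamma> in auto)
  show w: "weight g" unfolding weight_def using ig \<gamma>(1) by (simp add: g_def)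
  have "mass g \<le> (\<integral>x. \<gamma> x \<partial>lborel)"
    unfolding mass_def by (rule integral_mono[OF ig i\<gamma>(1)]) (simp add: g_def \<gamma> indicator_def)
  then show "mass g \<le> 1" using i\<gamma> by simp
  assume F: "config_fun F"
  have [measurable]: "(\<lambda>w. F ((if w \<in> B then w else 0) # xs)) \<in> borel_measurable borel"
    by (rule measurable_config_fun_Cons[OF F]) measurable
  have "sample_point M (\<lambda>z. if \<phi> z \<in> B then \<phi> z else 0) F xs = (\<integral>w. F ((if w \<in> B then w else 0) # xs) \<partial>distr M borel \<phi>)"
    unfolding sample_point_def by (subst integral_distr) auto
  also have "\<dots> = (\<integral>w. \<gamma> w * F ((if w \<in> B then w else 0) # xs) \<partial>lborel)"
    unfolding \<gamma>(2) by (subst integral_real_density) (auto simp: \<gamma>)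
  also have "\<dots> = (\<integral>w. g w * F (w # xs) + (\<gamma> w - g w) * F xs \<partial>lborel)"
  proof (rule Bochner_Integration.integral_cong[OF refl])
    fix w
    have "F (0 # xs) = F xs" by (rule config_fun_cong[OF F]) auto
    then show "\<gamma> w * F ((if w \<in> B then w else 0) # xs) = g w * F (w # xs) + (\<gamma> w - g w) * F xs"
      by (simp add: g_def)
  qed
  also have "\<dots> = add_point g F xs + (1 - mass g) * F xs"
    using integrable_add_point[OF ig F] ig i\<gamma> by (simp add: add_point_def mass_def)
  finally show "sample_point M (\<lambda>z. if \<phi> z \<in> B then \<phi> z else 0) F xs = (1 - mass g) * F xs + add_point g F xs"
    by simp
qed

lemma sample_point_collapse_power:
  fixes \<phi> :: "'b \<Rightarrow> 'a::euclidean_space"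
  assumes M: "prob_space M" and [measurable]: "\<phi> \<in> M \<rightarrow>\<^sub>M borel" "B \<in> sets borel" "\<gamma> \<in> borel_measurable borel"
    and \<gamma>: "\<And>x. \<gamma> x \<ge> 0" "distr M borel \<phi> = density lborel (\<lambda>x. ennreal (\<gamma> x))"
    and F: "config_fun F"
  defines "g \<equiv> \<lambda>x. \<gamma> x * indicator B x"
  shows "(sample_point M (\<lambda>z. if \<phi> z \<in> B then \<phi> z else 0) ^^ n) F xs =
    (\<Sum>m\<le>n. real (n choose m) * (1 - mass g) ^ (n - m) * (add_point g ^^ m) F xs)"
proof -
  note sp = sample_point_collapse[OF M _ _ _ \<gamma>, of B, folded g_def]
  let ?T = "sample_point M (\<lambda>z. if \<phi> z \<in> B then \<phi> z else 0)"
  have cf: "config_fun ((?T ^^ n) F)" for n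
    by (induction n) (auto intro!: config_fun_sample_point M F)
  have "(?T ^^ n) F = ((\<lambda>F xs. (1 - mass g) * F xs + add_point g F xs) ^^ n) F"
  proof (induction n)
    case (Suc n)
    have "?T ((?T ^^ n) F) = (\<lambda>xs. (1 - mass g) * (?T ^^ n) F xs + add_point g ((?T ^^ n) F) xs)"
      by (rule ext) (rule sp(3)[OF _ _ _ cf], measurable)
    then show ?case using Suc.IH by simp
  qed simp
  then show ?thesis using affine_add_point_power[OF sp(1) F] by simp
qed

lemma binomial_over_power_tendsto:
  "(\<lambda>n. real (n choose m) / real n ^ m) \<longlonglongrightarrow> 1 / fact m"
proof (induction m)
  case (Suc m)
  have "(\<lambda>n. real (n choose m) / real n ^ m * ((real n - real m) / real n / real (Suc m))) \<longlonglongrightarrow> 1 / fact m * (1 / real (Suc m))"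
  proof (intro tendsto_mult Suc.IH tendsto_divide tendsto_const)
    have "(\<lambda>n. 1 - real m * inverse (real n)) \<longlonglongrightarrow> 1 - real m * 0"
      by (intro tendsto_diff tendsto_mult tendsto_const LIMSEQ_inverse_real_of_nat lim_inverse_n)
    moreover have "\<forall>\<^sub>F n in sequentially. 1 - real m * inverse (real n) = (real n - real m) / real n"
      using eventually_gt_at_top[of 0] by eventually_elim (simp add: field_simps)
    ultimately show "(\<lambda>n. (real n - real m) / real n) \<longlonglongrightarrow> 1"
      by (simp add: tendsto_cong)
  qed auto
  moreover have "\<forall>\<^sub>F n in sequentially. real (n choose m) / real n ^ m * ((real n - real m) / real n / real (Suc m)) =
    real (n choose Suc m) / real n ^ Suc m"
    using eventually_ge_at_top[of "Suc m"]
  proof eventually_elim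
    case (elim n)
    have "Suc m * (n choose Suc m) = (n - m) * (n choose m)"
      using elim by (metis binomial_absorption binomial_absorb_comp times_binomial_minus1_eq zero_less_Suc diff_Suc_1)
    then have "real (Suc m) * real (n choose Suc m) = (real n - real m) * real (n choose m)"
      using elim by (metis of_nat_mult of_nat_diff Suc_leD)
    then have "real (n choose Suc m) = (real n - real m) * real (n choose m) / real (Suc m)"
      by (simp add: eq_divide_eq mult.commute del: of_nat_Suc)
    then show ?case by (simp add: mult_ac del: of_nat_Suc)
  qed
  ultimately have "(\<lambda>n. real (n choose Suc m) / real n ^ Suc m) \<longlonglongrightarrow> 1 / fact m * (1 / real (Suc m))"
    by (rule Lim_transform_eventually)
  also have "1 / fact m * (1 / real (Suc m)) = 1 / fact (Suc m)"
    by (simp add: field_simps)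
  finally show ?case .
qed simp

text \<open>For \<open>q n < 1\<close> the power with exponent \<open>n\<close> lies between the
  exponentials of \<open>- n q / (1 - q)\<close> and \<open>- n q\<close>, where \<open>q\<close>
  stands for \<open>q n\<close>. Since \<open>q\<close> tends to 0 both have the limit
  \<open>exp (- c)\<close>, and dropping \<open>m\<close> factors changes nothing in the
  limit.\<close>

lemma one_minus_power_tendsto_exp:
  fixes q :: "nat \<Rightarrow> real"
  assumes q: "\<And>n. q n \<ge> 0" and lim: "(\<lambda>n. real n * q n) \<longlonglongrightarrow> c"
  shows "(\<lambda>n. (1 - q n) ^ (n - m)) \<longlonglongrightarrow> exp (- c)"
proof -
  have q0: "q \<longlonglongrightarrow> 0"
  proof -
    have "(\<lambda>n. real n * q n * inverse (real n)) \<longlonglongrightarrow> c * 0"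
      by (intro tendsto_mult lim lim_inverse_n)
    moreover have "\<forall>\<^sub>F n in sequentially. real n * q n * inverse (real n) = q n"
      using eventually_gt_at_top[of 0] by eventually_elim simp
    ultimately show ?thesis by (simp add: tendsto_cong)
  qed
  have ev: "\<forall>\<^sub>F n in sequentially. q n < 1" using order_tendstoD(2)[OF q0, of 1] by simp
  have up: "\<forall>\<^sub>F n in sequentially. (1 - q n) ^ n \<le> exp (- (real n * q n))"
    using ev
  proof eventually_elim
    case (elim n)
    have "(1 - q n) ^ n \<le> exp (- q n) ^ n"
      using elim exp_ge_add_one_self[of "- q n"] by (intro power_mono) auto
    then show ?case by (simp add: exp_of_nat_mult[symmetric])
  qed
  have low: "\<forall>\<^sub>F n in sequentially. exp (- (real n * q n) / (1 - q n)) \<le> (1 - q n) ^ n"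
    using ev
  proof eventually_elim
    case (elim n)
    have "ln (1 / (1 - q n)) \<le> 1 / (1 - q n) - 1" using elim by (intro ln_le_minus_one) auto
    also have "1 / (1 - q n) - 1 = q n / (1 - q n)" using elim by (simp add: field_simps)
    finally have "- (q n / (1 - q n)) \<le> ln (1 - q n)" using elim by (simp add: ln_div)
    then have "exp (- (q n / (1 - q n))) \<le> 1 - q n" using elim by (metis diff_gt_0_iff_gt exp_le_cancel_iff exp_ln)
    then have "exp (- (q n / (1 - q n))) ^ n \<le> (1 - q n) ^ n" by (intro power_mono) auto
    then show ?case by (simp add: exp_of_nat_mult[symmetric])
  qed
  have "(\<lambda>n. exp (- (real n * q n) / (1 - q n))) \<longlonglongrightarrow> exp (- c / (1 - 0))"
    by (intro tendsto_intros lim q0) simp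
  moreover have "(\<lambda>n. exp (- (real n * q n))) \<longlonglongrightarrow> exp (- c)" by (intro tendsto_intros lim)
  ultimately have n: "(\<lambda>n. (1 - q n) ^ n) \<longlonglongrightarrow> exp (- c)"
    using tendsto_sandwich[OF low up] by simp
  have "(\<lambda>n. (1 - q n) ^ n / (1 - q n) ^ m) \<longlonglongrightarrow> exp (- c) / (1 - 0) ^ m"
    by (intro tendsto_intros n q0) simp
  moreover have "\<forall>\<^sub>F n in sequentially. (1 - q n) ^ n / (1 - q n) ^ m = (1 - q n) ^ (n - m)"
    using ev eventually_ge_at_top[of m]
    by eventually_elim (simp add: power_diff)
  ultimately show ?thesis by (simp add: tendsto_cong)
qed

lemma mass_tendsto:
  assumes G: "\<And>n. weight (G n)" and h: "weight h"
    and lim: "(\<lambda>n. \<integral>x. \<bar>G n x - h x\<bar> \<partial>lborel) \<longlonglongrightarrow> 0"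
  shows "(\<lambda>n. mass (G n)) \<longlonglongrightarrow> mass h"
proof -
  have "\<bar>mass (G n) - mass h\<bar> \<le> (\<integral>x. \<bar>G n x - h x\<bar> \<partial>lborel)" for n
  proof -
    have "mass (G n) - mass h = (\<integral>x. G n x - h x \<partial>lborel)"
      using G[of n] h by (simp add: mass_def weight_def)
    then show ?thesis by simp
  qed
  then have "(\<lambda>n. mass (G n) - mass h) \<longlonglongrightarrow> 0"
    by (intro Lim_null_comparison[OF _ lim]) auto
  then show ?thesis by (rule LIM_zero_cancel)
qed

text \<open>The induction needs an error bound uniform in the configuration, because the operators
  evaluate functionals at new configurations. With \<open>A\<close> and \<open>B\<close> the
  \<open>m\<close>-th powers, the next difference is \<open>add_point (G n)\<close> of
  \<open>A - B\<close> plus \<open>add_point (G n - h)\<close> of \<open>B\<close>; the first is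
  controlled by the previous error, the second by the L1 distance.\<close>

lemma add_point_power_tendsto:
  assumes G: "\<And>n. weight (G n)" and h: "weight h" and F: "config_fun F"
    and lim: "(\<lambda>n. \<integral>x. \<bar>G n x - h x\<bar> \<partial>lborel) \<longlonglongrightarrow> 0"
  shows "(\<lambda>n. (add_point (G n) ^^ m) F xs) \<longlonglongrightarrow> (add_point h ^^ m) F xs"
proof -
  obtain D where D: "\<And>xs. \<bar>F xs\<bar> \<le> D" "D \<ge> 0" using config_fun_bound[OF F] by blast
  have "\<exists>e. e \<longlonglongrightarrow> 0 \<and> (\<forall>n xs. \<bar>(add_point (G n) ^^ m) F xs - (add_point h ^^ m) F xs\<bar> \<le> e n)"
  proof (induction m)
    case 0 then show ?case by (intro exI[of _ "\<lambda>_. 0"]) auto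
  next
    case (Suc m)
    then obtain e where e: "e \<longlonglongrightarrow> 0" "\<And>n xs. \<bar>(add_point (G n) ^^ m) F xs - (add_point h ^^ m) F xs\<bar> \<le> e n" by blast
    let ?e = "\<lambda>n. mass (G n) * e n + (\<integral>x. \<bar>G n x - h x\<bar> \<partial>lborel) * (mass h ^ m * D)"
    have "?e \<longlonglongrightarrow> mass h * 0 + 0 * (mass h ^ m * D)"
      by (intro tendsto_intros mass_tendsto[OF G h lim] lim e)
    moreover have "\<bar>(add_point (G n) ^^ Suc m) F xs - (add_point h ^^ Suc m) F xs\<bar> \<le> ?e n" for n xs
    proof -
      let ?A = "(add_point (G n) ^^ m) F" and ?B = "(add_point h ^^ m) F"
      have cA: "config_fun ?A" "config_fun ?B" by (intro config_fun_add_point_power G h F)+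
      have ih: "integrable lborel (G n)" "integrable lborel h" using G[of n] h by (auto simp: weight_def)
      have "add_point (G n) ?A xs - add_point h ?B xs =
        add_point (G n) (\<lambda>xs. ?A xs - ?B xs) xs + add_point (\<lambda>x. G n x - h x) ?B xs"
        by (simp add: add_point_fun_diff[OF G cA] add_point_diff[OF ih cA(2)])
      moreover have "\<bar>add_point (G n) (\<lambda>xs. ?A xs - ?B xs) xs\<bar> \<le> mass (G n) * e n"
        by (rule abs_add_point_weight_le[OF G e(2)])
      moreover have "\<bar>add_point (\<lambda>x. G n x - h x) ?B xs\<bar> \<le> (\<integral>x. \<bar>G n x - h x\<bar> \<partial>lborel) * (mass h ^ m * D)"
        by (intro abs_add_point_le abs_add_point_power_le h D Bochner_Integration.integrable_diff ih)
      ultimately show ?thesis by simp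
    qed
    ultimately show ?case by (intro exI[of _ ?e]) auto
  qed
  then obtain e where e: "e \<longlonglongrightarrow> 0" "\<And>n xs. \<bar>(add_point (G n) ^^ m) F xs - (add_point h ^^ m) F xs\<bar> \<le> e n" by blast
  have "(\<lambda>n. (add_point (G n) ^^ m) F xs - (add_point h ^^ m) F xs) \<longlonglongrightarrow> 0"
    by (rule Lim_null_comparison[OF _ e(1)]) (use e(2) in auto)
  then show ?thesis by (rule LIM_zero_cancel)
qed

text \<open>The Poisson limit theorem at the level of operators. Each term of the binomial expansion
  converges, and the terms are eventually dominated by those of an exponential series, so Tannery's
  theorem applies.\<close>

theorem binomial_poisson_fun_tendsto:
  fixes g :: "nat \<Rightarrow> 'a::euclidean_space \<Rightarrow> real"
  assumes g: "\<And>n. weight (g n)" "\<And>n. mass (g n) \<le> 1" and h: "weight h" and F: "config_fun F"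
    and lim: "(\<lambda>n. \<integral>x. \<bar>real n * g n x - h x\<bar> \<partial>lborel) \<longlonglongrightarrow> 0"
  shows "(\<lambda>n. \<Sum>m\<le>n. real (n choose m) * (1 - mass (g n)) ^ (n - m) * (add_point (g n) ^^ m) F xs)
     \<longlonglongrightarrow> poisson_fun h F xs"
proof -
  obtain D where D: "\<And>xs. \<bar>F xs\<bar> \<le> D" "D \<ge> 0" using config_fun_bound[OF F] by blast
  \<comment> \<open>Scaling the intensity by \<open>n\<close> moves the factor \<open>n ^ m\<close>
    from the binomial coefficient into the operator, after which every factor of the term
    \<open>t m n\<close> converges separately.\<close>
  define G where "G n x = real n * g n x" for n x
  have G: "weight (G n)" for n using g(1)[of n] by (auto simp: weight_def G_def[abs_def])
  have massG: "mass (G n) = real n * mass (g n)" for n by (simp add: mass_def G_def)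
  have limG: "(\<lambda>n. \<integral>x. \<bar>G n x - h x\<bar> \<partial>lborel) \<longlonglongrightarrow> 0" using lim by (simp add: G_def)
  note massl = mass_tendsto[OF G h limG]
  define t where "t m n = real (n choose m) / real n ^ m * (1 - mass (g n)) ^ (n - m) * (add_point (G n) ^^ m) F xs" for m n
  have pow: "(add_point (G n) ^^ m) F xs = real n ^ m * (add_point (g n) ^^ m) F xs" for n m
    unfolding G_def[abs_def] by (simp add: add_point_power_scale)
  have t_lim: "(\<lambda>n. t m n) \<longlonglongrightarrow> exp (- mass h) / fact m * (add_point h ^^ m) F xs" for m
  proof -
    have "(\<lambda>n. t m n) \<longlonglongrightarrow> 1 / fact m * exp (- mass h) * (add_point h ^^ m) F xs"
      unfolding t_def
      by (intro tendsto_mult binomial_over_power_tendsto one_minus_power_tendsto_exp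
          add_point_power_tendsto[OF G h F limG])
        (use mass_nonneg[OF g(1)] massl massG in auto)
    then show ?thesis by simp
  qed
  have ev: "\<forall>\<^sub>F n in sequentially. mass (G n) < mass h + 1 \<and> n > 0"
    using order_tendstoD(2)[OF massl, of "mass h + 1"] eventually_gt_at_top[of 0] by (auto elim: eventually_conj)
  have bound: "\<bar>t m n\<bar> \<le> D * ((mass h + 1) ^ m / fact m)" if n: "mass (G n) < mass h + 1" "n > 0" for m n
  proof -
    have "real ((n choose m) * fact m) \<le> real (n ^ m)" by (intro of_nat_mono binomial_fact_pow)
    then have a: "real (n choose m) / real n ^ m \<le> 1 / fact m" using n by (simp add: field_simps)
    have b: "\<bar>(1 - mass (g n)) ^ (n - m)\<bar> \<le> 1"
      using g(2)[of n] mass_nonneg[OF g(1), of n] by (simp add: power_abs power_le_one)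
    have "\<bar>(add_point (G n) ^^ m) F xs\<bar> \<le> mass (G n) ^ m * D" by (intro abs_add_point_power_le G D)
    also have "\<dots> \<le> (mass h + 1) ^ m * D"
      using n mass_nonneg[OF G, of n] D by (intro mult_right_mono power_mono) auto
    finally have c: "\<bar>(add_point (G n) ^^ m) F xs\<bar> \<le> (mass h + 1) ^ m * D" .
    have "\<bar>t m n\<bar> \<le> 1 / fact m * 1 * ((mass h + 1) ^ m * D)"
      unfolding t_def abs_mult using a b c by (intro mult_mono) auto
    then show ?thesis by (simp add: mult_ac)
  qed
  \<comment> \<open>Domination holds for every \<open>m\<close> at once as soon as \<open>n\<close>
    is positive and \<open>mass (G n)\<close> is below \<open>mass h + 1\<close>.\<close>
  have bd: "\<forall>\<^sub>F (m, n) in sequentially \<times>\<^sub>F sequentially. norm (t m n) \<le> D * ((mass h + 1) ^ m / fact m)"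
    unfolding eventually_prod_filter
    by (intro exI[of _ "\<lambda>_. True"] exI[of _ "\<lambda>n. mass (G n) < mass h + 1 \<and> n > 0"])
      (use ev bound in auto)
  have "(\<lambda>n. \<Sum>m. t m n) \<longlonglongrightarrow> (\<Sum>m. exp (- mass h) / fact m * (add_point h ^^ m) F xs)"
    using tannerys_theorem[OF t_lim bd summable_pow_fact] by simp
  moreover have "\<forall>\<^sub>F n in sequentially. (\<Sum>m. t m n) =
     (\<Sum>m\<le>n. real (n choose m) * (1 - mass (g n)) ^ (n - m) * (add_point (g n) ^^ m) F xs)"
    using eventually_gt_at_top[of 0]
  proof eventually_elim
    case (elim n)
    have "(\<Sum>m. t m n) = (\<Sum>m\<le>n. t m n)" by (rule suminf_finite) (auto simp: t_def)
    also have "\<dots> = (\<Sum>m\<le>n. real (n choose m) * (1 - mass (g n)) ^ (n - m) * (add_point (g n) ^^ m) F xs)"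
      using elim by (intro sum.cong refl) (simp add: t_def pow)
    finally show ?case .
  qed
  ultimately show ?thesis unfolding poisson_fun_def by (simp add: tendsto_cong)
qed

section \<open>The homogeneous Poisson process\<close>

lemma integral_measure_pmf_nat:
  fixes h :: "nat \<Rightarrow> real"
  assumes "integrable (measure_pmf p) h"
  shows "(\<integral>m. h m \<partial>measure_pmf p) = (\<Sum>m. pmf p m * h m)"
proof -
  have "integrable (count_space UNIV) (\<lambda>m. pmf p m * h m)"
    using assms unfolding measure_pmf_eq_density by (subst (asm) integrable_real_density) auto
  then show ?thesis
    unfolding measure_pmf_eq_density by (subst integral_real_density) (auto simp: integral_count_space_nat)
qed

lemma uniform_measure_unit_volume:
  fixes C :: "'a::euclidean_space set"
  assumes [measurable]: "C \<in> sets borel" and "emeasure lborel C = 1"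
  shows "uniform_measure lborel C = density lborel (\<lambda>x. ennreal (indicator C x))"
  unfolding uniform_measure_def assms(2)
  by (intro density_cong) (auto simp: divide_ennreal_def split: split_indicator)

lemma weight_indicator:
  assumes "C \<in> sets borel" "emeasure lborel C < \<infinity>"
  shows "weight (indicator C)" "mass (indicator C) = measure lborel C"
  using assms unfolding weight_def mass_def by (auto simp: integrable_indicator_iff)

lemma sample_point_uniform:
  assumes C: "C \<in> sets borel" "emeasure lborel C = 1" and F: "config_fun F"
  shows "sample_point (uniform_measure lborel C) (\<lambda>z. z) F = add_point (indicator C) F"
proof
  fix xs
  have [measurable]: "(\<lambda>z. F (z # xs)) \<in> borel_measurable lborel"
    by (rule measurable_config_fun_Cons[OF F]) simp
  show "sample_point (uniform_measure lborel C) (\<lambda>z. z) F xs = add_point (indicator C) F xs"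
    unfolding sample_point_def add_point_def uniform_measure_unit_volume[OF C]
    using C by (subst integral_real_density) auto
qed

abbreviation cluster_space :: "'a::euclidean_space set \<Rightarrow> (nat \<times> (nat \<Rightarrow> 'a)) measure" where
  "cluster_space C \<equiv> measure_pmf (poisson_pmf 1) \<Otimes>\<^sub>M PiM UNIV (\<lambda>_. uniform_measure lborel C)"

lemma prob_space_cluster:
  assumes C: "emeasure lborel C = 1"
  shows "prob_space (PiM UNIV (\<lambda>_::nat. uniform_measure lborel C))" "prob_space (cluster_space C)"
proof -
  have u: "prob_space (uniform_measure lborel C)"
    using C by (intro prob_space_uniform_measure) auto
  then show p: "prob_space (PiM UNIV (\<lambda>_::nat. uniform_measure lborel C))" by (intro prob_space_PiM)
  interpret prob_space "PiM UNIV (\<lambda>_::nat. uniform_measure lborel C)" by fact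
  interpret pair_prob_space "measure_pmf (poisson_pmf 1)" "PiM UNIV (\<lambda>_::nat. uniform_measure lborel C)"
    by unfold_locales
  show "prob_space (cluster_space C)" by (rule P.prob_space_axioms)
qed

text \<open>Conditioned on the number \<open>m\<close> of points, the expectation is the
  \<open>m\<close>-th power of \<open>add_point (indicator C)\<close>. Since \<open>C\<close> has
  volume 1, the Poisson(1) weights are precisely the coefficients of
  \<open>poisson_fun\<close>.\<close>

lemma integral_config_fun_cluster:
  assumes C: "C \<in> sets borel" "emeasure lborel C = 1" and F: "config_fun F"
  shows "(\<integral>p. F (map (snd p) [0..<fst p] @ xs) \<partial>cluster_space C) = poisson_fun (indicator C) F xs"
proof -
  obtain D where D: "\<And>xs. \<bar>F xs\<bar> \<le> D" using config_fun_bound[OF F] by blast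
  let ?S = "PiM UNIV (\<lambda>_::nat. uniform_measure lborel C)"
  interpret S: prob_space ?S using prob_space_cluster[OF C(2)] by blast
  interpret PP: pair_prob_space "measure_pmf (poisson_pmf 1)" ?S by unfold_locales
  have w: "weight (indicator C)" "mass (indicator C) = 1"
    using weight_indicator[OF C(1)] C(2) by (auto simp: measure_def)
  have [measurable]: "(\<lambda>p. F (map (snd p) [0..<fst p] @ xs)) \<in> borel_measurable (cluster_space C)"
  proof (rule measurable_compose_countable[where g=fst])
    fix i show "(\<lambda>p. F (map (snd p) [0..<i] @ xs)) \<in> borel_measurable (cluster_space C)"
      using measurable_config_fun_map[OF F, of "\<lambda>i p. snd p i" "cluster_space C" i xs] by simp
  qed measurable
  have pow: "(sample_point (uniform_measure lborel C) (\<lambda>z. z) ^^ m) F = (add_point (indicator C) ^^ m) F" for m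
    by (induction m) (auto simp: sample_point_uniform[OF C] config_fun_add_point_power[OF w(1) F])
  have inner: "(\<integral>y. F (map y [0..<m] @ xs) \<partial>?S) = (add_point (indicator C) ^^ m) F xs" for m
    using integral_config_fun_iid[OF _ F, of "uniform_measure lborel C" "\<lambda>z. z" m xs] C
    unfolding pow by (simp add: prob_space_uniform_measure)
  have "(\<integral>p. F (map (snd p) [0..<fst p] @ xs) \<partial>cluster_space C) =
     (\<integral>m. (\<integral>y. F (map y [0..<m] @ xs) \<partial>?S) \<partial>measure_pmf (poisson_pmf 1))"
    by (subst PP.integral_fst'[symmetric]) (auto intro!: PP.P.integrable_bounded[where D=D] D)
  also have "\<dots> = (\<Sum>m. pmf (poisson_pmf 1) m * (add_point (indicator C) ^^ m) F xs)"
    unfolding inner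
  proof (rule integral_measure_pmf_nat, rule measure_pmf.integrable_bounded)
    show "\<bar>(add_point (indicator C) ^^ m) F xs\<bar> \<le> D" for m
      using abs_add_point_power_le[OF w(1) D, where m=m and xs=xs] w(2) by simp
  qed simp
  also have "\<dots> = poisson_fun (indicator C) F xs"
    unfolding poisson_fun_def w(2) by simp
  finally show ?thesis .
qed

lemma emeasure_unit_cube: "emeasure lborel (unit_cube c) = 1" (is ?e)
  and sets_unit_cube[measurable]: "unit_cube c \<in> sets borel"
proof -
  have "unit_cube c = (\<Inter>i. {x. real_of_int (c $ i) \<le> x $ i \<and> x $ i < real_of_int (c $ i) + 1})"
    by (auto simp: unit_cube_def)
  moreover have "{x::real^'a. real_of_int (c $ i) \<le> x $ i \<and> x $ i < real_of_int (c $ i) + 1} \<in> sets borel" for i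
    by measurable
  ultimately show m: "unit_cube c \<in> sets borel" by auto
  define l :: "real^'a" where "l = (\<chi> i. real_of_int (c $ i))"
  define u :: "real^'a" where "u = (\<chi> i. real_of_int (c $ i) + 1)"
  have one: "(\<Prod>b\<in>Basis. (u - l) \<bullet> b) = 1"
    by (rule prod.neutral) (auto simp: Basis_vec_def inner_axis u_def l_def)
  have le: "l \<bullet> b \<le> u \<bullet> b" if "b \<in> Basis" for b
    using that by (auto simp: Basis_vec_def inner_axis u_def l_def)
  \<comment> \<open>The half-open cube is squeezed between an open and a closed box of the same
    volume.\<close>
  have "box l u \<subseteq> unit_cube c" "unit_cube c \<subseteq> cbox l u"
    by (auto simp: unit_cube_def mem_box_cart l_def u_def less_imp_le)
  then have "emeasure lborel (box l u) \<le> emeasure lborel (unit_cube c)"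
    "emeasure lborel (unit_cube c) \<le> emeasure lborel (cbox l u)"
    using m by (auto intro!: emeasure_mono)
  then show ?e
    using le one by (simp add: emeasure_lborel_box emeasure_lborel_cbox)
qed

lemma unit_cube_eq_iff: "x \<in> unit_cube c \<longleftrightarrow> c = (\<chi> i. \<lfloor>x $ i\<rfloor>)"
  unfolding unit_cube_def vec_eq_iff by (auto simp: floor_eq_iff eq_commute[of _ "\<lfloor>_\<rfloor>"])

definition cluster_points :: "nat \<times> (nat \<Rightarrow> 'a) \<Rightarrow> 'a list" where
  "cluster_points p = map (snd p) [0..<fst p]"

lemma hpp_space_cluster: "hpp_space = PiM UNIV (\<lambda>c. cluster_space (unit_cube c))"
  unfolding hpp_space_def ..

lemma prob_space_hpp: "prob_space hpp_space"
  unfolding hpp_space_cluster by (intro prob_space_PiM prob_space_cluster emeasure_unit_cube)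

lemma measurable_hpp_fst[measurable]: "(\<lambda>w. fst (w c)) \<in> hpp_space \<rightarrow>\<^sub>M count_space UNIV"
proof -
  have "(\<lambda>w. fst (w c)) \<in> hpp_space \<rightarrow>\<^sub>M measure_pmf (poisson_pmf 1)"
    unfolding hpp_space_cluster
    by (rule measurable_compose[OF measurable_component_singleton[of c UNIV "\<lambda>c. cluster_space (unit_cube c)"] measurable_fst]) auto
  then show ?thesis by simp
qed

lemma measurable_hpp_snd[measurable]: "(\<lambda>w. snd (w c) i) \<in> hpp_space \<rightarrow>\<^sub>M borel"
proof -
  have "(\<lambda>w. snd (w c) i) \<in> hpp_space \<rightarrow>\<^sub>M uniform_measure lborel (unit_cube c)"
    unfolding hpp_space_cluster
    by (rule measurable_compose[OF measurable_compose[OF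
          measurable_component_singleton[of c UNIV "\<lambda>c. cluster_space (unit_cube c)"] measurable_snd]
       measurable_component_singleton[of i UNIV "\<lambda>_. uniform_measure lborel (unit_cube c)"]]) auto
  then show ?thesis by (subst (asm) measurable_cong_sets[OF refl, of _ borel]) simp_all
qed

text \<open>The number of points in a cell is random. The induction fixes this number for the first
  cell and moves its points into the list \<open>qs\<close> of measurable maps, which is why
  \<open>qs\<close> is part of the statement.\<close>

lemma measurable_config_fun_hpp:
  assumes F: "config_fun F" and q: "\<And>q. q \<in> set qs \<Longrightarrow> q \<in> hpp_space \<rightarrow>\<^sub>M borel"
  shows "(\<lambda>w. F (concat (map (\<lambda>c. cluster_points (w c)) cs) @ map (\<lambda>q. q w) qs)) \<in> borel_measurable hpp_space"
  using q
proof (induction cs arbitrary: qs)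
  case Nil
  then show ?case using measurable_config_fun[OF F Nil] by simp
next
  case (Cons c cs)
  have eq: "F (concat (map (\<lambda>c. cluster_points (w c)) (c # cs)) @ map (\<lambda>q. q w) qs) =
    F (concat (map (\<lambda>c. cluster_points (w c)) cs) @ map (\<lambda>q. q w) (map (\<lambda>i w. snd (w c) i) [0..<fst (w c)] @ qs))" for w
    by (rule config_fun_cong[OF F]) (auto simp: cluster_points_def)
  show ?case
    unfolding eq
  proof (rule measurable_compose_countable[where g="\<lambda>w. fst (w c)" and f="\<lambda>n w. F (concat (map (\<lambda>c. cluster_points (w c)) cs) @ map (\<lambda>q. q w) (map (\<lambda>i w. snd (w c) i) [0..<n] @ qs))"])
    fix n show "(\<lambda>w. F (concat (map (\<lambda>c. cluster_points (w c)) cs) @ map (\<lambda>q. q w) (map (\<lambda>i w. snd (w c) i) [0..<n] @ qs))) \<in> borel_measurable hpp_space"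
      by (rule Cons.IH) (use Cons.prems in \<open>auto intro: measurable_hpp_snd\<close>)
  qed measurable
qed

lemma poisson_fun_zero:
  fixes F :: "'a::euclidean_space list \<Rightarrow> real"
  shows "poisson_fun (\<lambda>_. 0) F xs = F xs"
proof -
  have "(\<Sum>m. exp (- mass (\<lambda>_::'a. 0)) / fact m * (add_point (\<lambda>_. 0) ^^ m) F xs) =
    (\<Sum>m\<in>{0}. exp (- mass (\<lambda>_::'a. 0)) / fact m * (add_point (\<lambda>_. 0) ^^ m) F xs)"
  proof (rule suminf_finite)
    fix m :: nat assume "m \<notin> {0}"
    then obtain j where "m = Suc j" by (cases m) auto
    then show "exp (- mass (\<lambda>_::'a. 0)) / fact m * (add_point (\<lambda>_. 0) ^^ m) F xs = 0"
      by (simp add: add_point_def[of "\<lambda>_. 0"])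
  qed simp
  then show ?thesis unfolding poisson_fun_def by (simp add: mass_def)
qed

lemma weight_unit_cube: "weight (indicator (unit_cube c))"
  by (rule weight_indicator(1)) (simp_all add: emeasure_unit_cube)

lemma weight_sum_unit_cubes: "weight (\<lambda>x. \<Sum>c\<in>J. indicator (unit_cube c) x)"
  using weight_unit_cube unfolding weight_def
  by (auto intro!: sum_nonneg Bochner_Integration.integrable_sum)

text \<open>Induction over the cells: one cell is integrated out and turns \<open>F\<close> into
  \<open>poisson_fun\<close> of its indicator applied to \<open>F\<close>, and superposition adds
  this indicator to those of the remaining cells.\<close>

theorem integral_config_fun_hpp:
  fixes F :: "(real^'d) list \<Rightarrow> real"
  assumes F: "config_fun F" and "distinct cs"
  shows "(\<integral>w. F (concat (map (\<lambda>c. cluster_points (w c)) cs) @ xs) \<partial>hpp_space) =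
    poisson_fun (\<lambda>x. \<Sum>c\<in>set cs. indicator (unit_cube c) x) F xs"
  using assms
proof (induction cs arbitrary: F)
  case Nil
  interpret prob_space "hpp_space :: (int^'d \<Rightarrow> nat \<times> (nat \<Rightarrow> real^'d)) measure" by (rule prob_space_hpp)
  show ?case by (simp add: poisson_fun_zero prob_space)
next
  case (Cons c cs)
  let ?H = "hpp_space :: (int^'d \<Rightarrow> nat \<times> (nat \<Rightarrow> real^'d)) measure"
  let ?C = "cluster_space (unit_cube c)"
  interpret H: prob_space ?H by (rule prob_space_hpp)
  interpret C: prob_space ?C by (rule prob_space_cluster(2)[OF emeasure_unit_cube])
  interpret PP: pair_prob_space ?C ?H by unfold_locales
  obtain D where D: "\<And>xs. \<bar>F xs\<bar> \<le> D" using config_fun_bound[OF Cons.prems(1)] by blast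
  have w: "weight (indicator (unit_cube c))"
    by (rule weight_unit_cube)
  \<comment> \<open>Overwriting coordinate \<open>c\<close> by an independent copy preserves the
    law. This separates cell \<open>c\<close> from the cells in \<open>cs\<close>, which do not
    contain \<open>c\<close> and are left untouched.\<close>
  have res: "distr (?C \<Otimes>\<^sub>M ?H) ?H (\<lambda>(p, w). w(c := p)) = ?H"
    using distr_pair_PiM_eq_PiM[of UNIV "\<lambda>c. cluster_space (unit_cube c)" c,
      OF prob_space_cluster(2)[OF emeasure_unit_cube] prob_space_cluster(2)[OF emeasure_unit_cube]]
    unfolding hpp_space_cluster by (simp only: insert_UNIV)
  have upd: "(\<lambda>(p, w). w(c := p)) \<in> ?C \<Otimes>\<^sub>M ?H \<rightarrow>\<^sub>M ?H"
    unfolding hpp_space_cluster case_prod_beta'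
    by (rule measurable_fun_upd[where J=UNIV]) auto
  have meas: "(\<lambda>w. F (concat (map (\<lambda>c. cluster_points (w c)) (c # cs)) @ xs)) \<in> borel_measurable ?H"
  proof -
    have "(\<lambda>w. F (concat (map (\<lambda>c. cluster_points (w c)) (c # cs)) @ map (\<lambda>q. q w) (map (\<lambda>x _. x) xs))) \<in> borel_measurable ?H"
      by (rule measurable_config_fun_hpp[OF Cons.prems(1)]) auto
    then show ?thesis by (simp add: o_def)
  qed
  have cnc: "c \<notin> set cs" using Cons.prems by simp
  have upd_eq: "concat (map (\<lambda>c'. cluster_points ((w(c := p)) c')) (c # cs)) @ xs =
     map (snd p) [0..<fst p] @ (concat (map (\<lambda>c. cluster_points (w c)) cs) @ xs)" for w p
  proof -
    have "map (\<lambda>c'. cluster_points ((w(c := p)) c')) cs = map (\<lambda>c. cluster_points (w c)) cs"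
      using cnc by (intro map_cong) auto
    then show ?thesis by (simp only: list.map concat.simps append_assoc) (simp add: cluster_points_def)
  qed
  have "(\<integral>w. F (concat (map (\<lambda>c. cluster_points (w c)) (c # cs)) @ xs) \<partial>?H) =
     (\<integral>w. F (concat (map (\<lambda>c. cluster_points (w c)) (c # cs)) @ xs) \<partial>distr (?C \<Otimes>\<^sub>M ?H) ?H (\<lambda>(p, w). w(c := p)))"
    by (simp only: res)
  also have "\<dots> = (\<integral>(p, w). F (map (snd p) [0..<fst p] @ (concat (map (\<lambda>c. cluster_points (w c)) cs) @ xs)) \<partial>(?C \<Otimes>\<^sub>M ?H))"
    by (subst integral_distr[OF upd meas]) (simp only: case_prod_beta' upd_eq)
  also have "\<dots> = (\<integral>w. (\<integral>p. F (map (snd p) [0..<fst p] @ (concat (map (\<lambda>c. cluster_points (w c)) cs) @ xs)) \<partial>?C) \<partial>?H)"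
  proof (rule PP.integral_snd[symmetric])
    have "(\<lambda>z. F (concat (map (\<lambda>c'. cluster_points ((case z of (p, w) \<Rightarrow> w(c := p)) c')) (c # cs)) @ xs)) \<in> borel_measurable (?C \<Otimes>\<^sub>M ?H)"
      by (rule measurable_compose[OF upd meas])
    then have "(\<lambda>(p, w). F (map (snd p) [0..<fst p] @ (concat (map (\<lambda>c. cluster_points (w c)) cs) @ xs))) \<in> borel_measurable (?C \<Otimes>\<^sub>M ?H)"
      by (simp only: case_prod_beta' upd_eq)
    then show "integrable (?C \<Otimes>\<^sub>M ?H) (\<lambda>(p, w). F (map (snd p) [0..<fst p] @ (concat (map (\<lambda>c. cluster_points (w c)) cs) @ xs)))"
      by (rule PP.P.integrable_bounded[where D=D]) (auto simp: D)
  qed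
  also have "\<dots> = (\<integral>w. poisson_fun (indicator (unit_cube c)) F (concat (map (\<lambda>c. cluster_points (w c)) cs) @ xs) \<partial>?H)"
    by (simp only: integral_config_fun_cluster[OF sets_unit_cube emeasure_unit_cube Cons.prems(1)])
  also have "\<dots> = poisson_fun (\<lambda>x. \<Sum>c\<in>set cs. indicator (unit_cube c) x) (poisson_fun (indicator (unit_cube c)) F) xs"
    using Cons.prems by (intro Cons.IH config_fun_poisson_fun w) auto
  also have "\<dots> = poisson_fun (\<lambda>x. (\<Sum>c\<in>set cs. indicator (unit_cube c) x) + indicator (unit_cube c) x) F xs"
    by (subst poisson_fun_superposition[OF weight_sum_unit_cubes w Cons.prems(1)]) auto
  finally show ?case using cnc by (simp add: add.commute)
qed

section \<open>Variance under bounded differences\<close>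

lemma AE_PiM_nat_Suc:
  assumes M: "prob_space M" and ae: "AE w in PiM UNIV (\<lambda>_::nat. M). Q w"
  shows "AE z in M. AE w in PiM UNIV (\<lambda>_::nat. M). Q (case_nat z w)"
proof -
  interpret M: prob_space M by fact
  interpret sequence_space M by unfold_locales
  interpret PP: pair_prob_space M "PiM UNIV (\<lambda>_::nat. M)" by unfold_locales
  have "AE w in distr (M \<Otimes>\<^sub>M PiM UNIV (\<lambda>_::nat. M)) (PiM UNIV (\<lambda>_::nat. M)) (\<lambda>(s, w). case_nat s w). Q w"
    unfolding PiM_iter by (rule ae)
  then have "AE p in M \<Otimes>\<^sub>M PiM UNIV (\<lambda>_::nat. M). Q ((\<lambda>(s, w). case_nat s w) p)"
    by (rule AE_distrD[rotated]) simp
  then show ?thesis using PP.AE_pair by fastforce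
qed

text \<open>The cross term vanishes because \<open>a\<close> minus its mean integrates to 0.\<close>

lemma (in prob_space) second_moment_decomposition:
  fixes a :: "'a \<Rightarrow> real"
  assumes [measurable]: "a \<in> borel_measurable M" and D: "\<And>x. \<bar>a x\<bar> \<le> D"
  shows "(\<integral>x. (a x - \<mu>)\<^sup>2 \<partial>M) = (\<integral>x. (a x - (\<integral>x. a x \<partial>M))\<^sup>2 \<partial>M) + ((\<integral>x. a x \<partial>M) - \<mu>)\<^sup>2"
proof -
  let ?h = "\<integral>x. a x \<partial>M"
  have ia: "integrable M a" by (rule integrable_bounded[where D=D]) (use D in auto)
  have i2: "integrable M (\<lambda>x. (a x - ?h)\<^sup>2)"
  proof (rule integrable_bounded[where D="(2 * D)\<^sup>2"])
    fix x
    have "\<bar>?h\<bar> \<le> D" by (rule abs_integral_le_const) (rule D)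
    then have "\<bar>a x - ?h\<bar> \<le> 2 * D" using D[of x] by linarith
    then have "\<bar>a x - ?h\<bar> \<le> \<bar>2 * D\<bar>" by linarith
    then show "\<bar>(a x - ?h)\<^sup>2\<bar> \<le> (2 * D)\<^sup>2" by (simp only: abs_le_square_iff abs_power2)
  qed simp
  have "(\<integral>x. (a x - \<mu>)\<^sup>2 \<partial>M) = (\<integral>x. (a x - ?h)\<^sup>2 + (2 * (?h - \<mu>) * (a x - ?h) + (?h - \<mu>)\<^sup>2) \<partial>M)"
    by (intro Bochner_Integration.integral_cong refl) (simp add: power2_eq_square algebra_simps)
  also have "\<dots> = (\<integral>x. (a x - ?h)\<^sup>2 \<partial>M) + (?h - \<mu>)\<^sup>2"
    using ia i2 by (simp add: prob_space)
  finally show ?thesis .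
qed

text \<open>Conditioning on the first coordinate splits the variance; the conditional expectation
  inherits the bounded difference in that coordinate.\<close>

lemma variance_bounded_differences:
  fixes g :: "(nat \<Rightarrow> 'b) \<Rightarrow> real"
  assumes M: "prob_space M" and "g \<in> borel_measurable (PiM UNIV (\<lambda>_::nat. M))"
    and "\<And>w. \<bar>g w\<bar> \<le> D"
    and "\<And>w w'. (\<And>i. i < n \<Longrightarrow> w i = w' i) \<Longrightarrow> g w = g w'"
    and "\<And>i. i < n \<Longrightarrow> AE w in PiM UNIV (\<lambda>_::nat. M). AE y in M. \<bar>g w - g (w(i := y))\<bar> \<le> C"
  shows "(\<integral>w. (g w - (\<integral>w. g w \<partial>PiM UNIV (\<lambda>_::nat. M)))\<^sup>2 \<partial>PiM UNIV (\<lambda>_::nat. M)) \<le> real n * C\<^sup>2"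
  using assms(2-)
proof (induction n arbitrary: g)
  case 0
  interpret prob_space "PiM UNIV (\<lambda>_::nat. M)" using M by (intro prob_space_PiM)
  have "g w = g undefined" for w by (rule "0.prems"(3)) simp
  then have g: "g = (\<lambda>_. g undefined)" by auto
  show ?case by (subst (1 2) g) (simp add: prob_space)
next
  case (Suc n)
  let ?S = "PiM UNIV (\<lambda>_::nat. M)"
  interpret M: prob_space M by fact
  interpret S: prob_space ?S using M by (intro prob_space_PiM)
  interpret PP: pair_prob_space M ?S by unfold_locales
  interpret PS: pair_prob_space ?S M by unfold_locales
  note [measurable] = Suc.prems(1)
  note D = Suc.prems(2) and dep = Suc.prems(3) and diff = Suc.prems(4)
  \<comment> \<open>The conditional expectation of \<open>g\<close> given that the first coordinate
    is \<open>z\<close>.\<close>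
  define h where "h z = (\<integral>w. g (case_nat z w) \<partial>?S)" for z
  define \<mu> where "\<mu> = (\<integral>w. g w \<partial>?S)"
  have mz: "(\<lambda>w. g (case_nat z w)) \<in> borel_measurable ?S" if "z \<in> space M" for z
    using that by measurable
  have mp: "(\<lambda>p. g (case_nat (fst p) (snd p))) \<in> borel_measurable (M \<Otimes>\<^sub>M ?S)" by measurable
  then have hm[measurable]: "h \<in> borel_measurable M"
    unfolding h_def[abs_def] by (intro S.borel_measurable_lebesgue_integral) (simp add: case_prod_beta')
  have hD: "\<bar>h z\<bar> \<le> D" for z unfolding h_def by (rule S.abs_integral_le_const) (rule D)
  have ih: "integrable M h" by (rule M.integrable_bounded[where D=D]) (use hD in auto)
  have \<mu>h: "\<mu> = (\<integral>z. h z \<partial>M)"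
    unfolding \<mu>_def h_def by (rule integral_PiM_nat_Suc[OF M _ D]) measurable
  have sq: "\<bar>(x - m)\<^sup>2\<bar> \<le> (2 * D)\<^sup>2" if "\<bar>x\<bar> \<le> D" "\<bar>m\<bar> \<le> D" for x m :: real
  proof -
    have "\<bar>x - m\<bar> \<le> \<bar>2 * D\<bar>" using that by linarith
    then show ?thesis by (simp add: abs_le_square_iff)
  qed
  have \<mu>D: "\<bar>\<mu>\<bar> \<le> D" unfolding \<mu>_def by (rule S.abs_integral_le_const) (rule D)
  have split: "(\<integral>w. (g w - \<mu>)\<^sup>2 \<partial>?S) = (\<integral>z. (\<integral>w. (g (case_nat z w) - \<mu>)\<^sup>2 \<partial>?S) \<partial>M)"
    by (rule integral_PiM_nat_Suc[OF M, where D="(2 * D)\<^sup>2"]) (use sq[OF D \<mu>D] in auto)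
  \<comment> \<open>For almost every first coordinate the remaining function depends on
    \<open>n\<close> coordinates with the same difference bound, so the induction hypothesis bounds
    the conditional variance.\<close>
  have inner: "AE z in M. (\<integral>w. (g (case_nat z w) - h z)\<^sup>2 \<partial>?S) \<le> real n * C\<^sup>2"
  proof -
    have "AE z in M. \<forall>i\<in>{..<n}. AE w in ?S. AE y in M. \<bar>g (case_nat z w) - g (case_nat z (w(i := y)))\<bar> \<le> C"
    proof (rule AE_finite_allI)
      fix i assume "i \<in> {..<n}"
      then have "AE z in M. AE w in ?S. AE y in M. \<bar>g (case_nat z w) - g ((case_nat z w)(Suc i := y))\<bar> \<le> C"
        by (intro AE_PiM_nat_Suc[OF M] diff) auto
      moreover have "(case_nat z w)(Suc i := y) = case_nat z (w(i := y))" for z w and y :: 'b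
        by (auto simp: fun_eq_iff split: nat.splits)
      ultimately show "AE z in M. AE w in ?S. AE y in M. \<bar>g (case_nat z w) - g (case_nat z (w(i := y)))\<bar> \<le> C" by simp
    qed simp
    then show ?thesis using AE_space
    proof eventually_elim
      case (elim z)
      show ?case unfolding h_def
      proof (rule Suc.IH[OF mz[OF elim(2)] D])
        show "g (case_nat z w) = g (case_nat z w')" if "\<And>i. i < n \<Longrightarrow> w i = w' i" for w w'
          by (rule dep) (use that in \<open>auto split: nat.splits\<close>)
      qed (use elim(1) in auto)
    qed
  qed
  have outer: "AE z in M. \<bar>h z - \<mu>\<bar> \<le> C"
  proof -
    have "AE z in M. AE w in ?S. AE y in M. \<bar>g (case_nat z w) - g ((case_nat z w)(0 := y))\<bar> \<le> C"
      by (intro AE_PiM_nat_Suc[OF M] diff) auto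
    moreover have "(case_nat z w)(0 := y) = case_nat y w" for z w and y :: 'b
      by (auto simp: fun_eq_iff split: nat.splits)
    ultimately have "AE z in M. AE w in ?S. AE y in M. \<bar>g (case_nat z w) - g (case_nat y w)\<bar> \<le> C" by simp
    then show ?thesis using AE_space
    proof eventually_elim
      case (elim z)
      note [measurable] = mz[OF elim(2)]
      \<comment> \<open>The order of the almost-everywhere quantifiers is exchanged so that, with
        both first coordinates fixed, the common remainder \<open>w\<close> can be integrated
        out.\<close>
      have "AE y in M. AE w in ?S. \<bar>g (case_nat z w) - g (case_nat y w)\<bar> \<le> C"
      proof (subst PP.AE_commute)
        show "{p \<in> space (M \<Otimes>\<^sub>M ?S). \<bar>g (case_nat z (snd p)) - g (case_nat (fst p) (snd p))\<bar> \<le> C} \<in> sets (M \<Otimes>\<^sub>M ?S)"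
          using mp by measurable
      qed (use elim(1) in simp)
      then have "AE y in M. \<bar>h z - h y\<bar> \<le> C" using AE_space
      proof eventually_elim
        case (elim y)
        note [measurable] = mz[OF elim(2)]
        have i: "integrable ?S (\<lambda>w. g (case_nat z w))" "integrable ?S (\<lambda>w. g (case_nat y w))"
          by (auto intro!: S.integrable_bounded[where D=D] D)
        have "h z - h y = (\<integral>w. g (case_nat z w) - g (case_nat y w) \<partial>?S)"
          unfolding h_def using i by simp
        also have "\<bar>\<dots>\<bar> \<le> (\<integral>w. \<bar>g (case_nat z w) - g (case_nat y w)\<bar> \<partial>?S)" by simp
        also have "\<dots> \<le> (\<integral>w. C \<partial>?S)" using i elim(1) by (intro integral_mono_AE) auto
        finally show ?case by (simp add: S.prob_space)
      qed
      then have "(\<integral>y. \<bar>h z - h y\<bar> \<partial>M) \<le> (\<integral>y. C \<partial>M)" using ih by (intro integral_mono_AE) auto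
      moreover have "h z - \<mu> = (\<integral>y. h z - h y \<partial>M)" unfolding \<mu>h using ih by (simp add: M.prob_space)
      moreover have "\<bar>\<integral>y. h z - h y \<partial>M\<bar> \<le> (\<integral>y. \<bar>h z - h y\<bar> \<partial>M)" by (rule integral_abs_bound)
      moreover have "(\<integral>y. C \<partial>M) = C" by (simp add: M.prob_space)
      ultimately show ?case by linarith
    qed
  qed
  have "(\<integral>z. (\<integral>w. (g (case_nat z w) - \<mu>)\<^sup>2 \<partial>?S) \<partial>M) \<le> (\<integral>z. real n * C\<^sup>2 + C\<^sup>2 \<partial>M)"
  proof (rule integral_mono_AE)
    show "integrable M (\<lambda>z. \<integral>w. (g (case_nat z w) - \<mu>)\<^sup>2 \<partial>?S)"
    proof (rule M.integrable_bounded[where D="(2 * D)\<^sup>2"])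
      show "(\<lambda>z. \<integral>w. (g (case_nat z w) - \<mu>)\<^sup>2 \<partial>?S) \<in> borel_measurable M"
        using mp by (intro S.borel_measurable_lebesgue_integral) (simp add: case_prod_beta')
      show "\<bar>\<integral>w. (g (case_nat z w) - \<mu>)\<^sup>2 \<partial>?S\<bar> \<le> (2 * D)\<^sup>2" for z
        by (rule S.abs_integral_le_const) (rule sq[OF D \<mu>D])
    qed
    show "AE z in M. (\<integral>w. (g (case_nat z w) - \<mu>)\<^sup>2 \<partial>?S) \<le> real n * C\<^sup>2 + C\<^sup>2"
      using inner outer AE_space
    proof eventually_elim
      case (elim z)
      have "(\<integral>w. (g (case_nat z w) - \<mu>)\<^sup>2 \<partial>?S) = (\<integral>w. (g (case_nat z w) - h z)\<^sup>2 \<partial>?S) + (h z - \<mu>)\<^sup>2"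
        unfolding h_def by (rule S.second_moment_decomposition[OF mz[OF elim(3)] D])
      moreover have "(h z - \<mu>)\<^sup>2 \<le> C\<^sup>2" using elim(2) by (simp add: abs_le_square_iff[symmetric])
      ultimately show ?case using elim(1) by simp
    qed
  qed simp
  then show ?case unfolding \<mu>_def[symmetric] split by (simp add: M.prob_space algebra_simps)
qed

text \<open>The i.i.d. product measure is invariant under overwriting one coordinate by an
  independent copy, so an almost sure property also holds after resampling.\<close>

lemma AE_PiM_resample:
  assumes M: "prob_space M" and ae: "AE w in PiM UNIV (\<lambda>_::'i. M). Q w"
  shows "AE w in PiM UNIV (\<lambda>_::'i. M). AE y in M. Q (w(i := y))"
proof -
  let ?S = "PiM UNIV (\<lambda>_::'i. M)"
  interpret M: prob_space M by fact
  interpret S: prob_space ?S using M by (intro prob_space_PiM)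
  interpret PP: pair_prob_space M ?S by unfold_locales
  interpret PS: pair_prob_space ?S M by unfold_locales
  have e: "distr (M \<Otimes>\<^sub>M ?S) ?S (\<lambda>(x, X). X(i := x)) = ?S"
    using distr_pair_PiM_eq_PiM[of UNIV "\<lambda>_. M" i] M by simp
  have "AE p in M \<Otimes>\<^sub>M ?S. Q ((\<lambda>(x, X). X(i := x)) p)"
  proof (rule AE_distrD[where M'="?S"])
    show "(\<lambda>(x, X). X(i := x)) \<in> M \<Otimes>\<^sub>M ?S \<rightarrow>\<^sub>M ?S"
      unfolding case_prod_beta' by (rule measurable_fun_upd[where J=UNIV]) auto
    show "AE w in distr (M \<Otimes>\<^sub>M ?S) ?S (\<lambda>(x, X). X(i := x)). Q w" unfolding e by (rule ae)
  qed
  then have "AE p in distr (?S \<Otimes>\<^sub>M M) (M \<Otimes>\<^sub>M ?S) (\<lambda>(x, y). (y, x)). Q ((\<lambda>(x, X). X(i := x)) p)"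
    unfolding PP.distr_pair_swap[symmetric] .
  then have "AE p in ?S \<Otimes>\<^sub>M M. Q ((\<lambda>(x, X). X(i := x)) ((\<lambda>(x, y). (y, x)) p))"
    by (rule AE_distrD[rotated]) measurable
  then show ?thesis using PS.AE_pair by fastforce
qed

text \<open>The same invariance in the other direction: all other coordinates may be frozen and only
  one fresh point has to be examined. This reduces coincidences and ties to null sets in
  space.\<close>

lemma AE_PiM_resampleI:
  assumes M: "prob_space M" and [measurable]: "Measurable.pred (PiM UNIV (\<lambda>_::'i. M)) Q"
    and ae: "AE w in PiM UNIV (\<lambda>_::'i. M). AE y in M. Q (w(i := y))"
  shows "AE w in PiM UNIV (\<lambda>_::'i. M). Q w"
proof -
  let ?S = "PiM UNIV (\<lambda>_::'i. M)"
  interpret M: prob_space M by fact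
  interpret S: prob_space ?S using M by (intro prob_space_PiM)
  interpret PP: pair_prob_space M ?S by unfold_locales
  have e: "distr (M \<Otimes>\<^sub>M ?S) ?S (\<lambda>(x, X). X(i := x)) = ?S"
    using distr_pair_PiM_eq_PiM[of UNIV "\<lambda>_. M" i] M by simp
  have [measurable]: "(\<lambda>p. (snd p)(i := fst p)) \<in> M \<Otimes>\<^sub>M ?S \<rightarrow>\<^sub>M ?S"
    by (rule measurable_fun_upd[where J=UNIV]) auto
  have m: "Measurable.pred (M \<Otimes>\<^sub>M ?S) (\<lambda>p. Q ((snd p)(i := fst p)))" by measurable
  have "AE y in M. AE w in ?S. Q (w(i := y))"
    by (subst PP.AE_commute) (use ae m in \<open>auto simp: pred_def\<close>)
  then have "AE p in M \<Otimes>\<^sub>M ?S. Q ((snd p)(i := fst p))"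
    by (subst PP.AE_pair_iff[symmetric]) (use m in \<open>auto simp: pred_def\<close>)
  then have "AE w in distr (M \<Otimes>\<^sub>M ?S) ?S (\<lambda>p. (snd p)(i := fst p)). Q w"
    by (subst AE_distr_iff) (auto simp: pred_def[symmetric])
  then show ?thesis using e unfolding case_prod_beta' by (simp only:)
qed

section \<open>Windows made of unit cells, and almost sure stabilisation of the homogeneous
  process\<close>

definition grid_box :: "int \<Rightarrow> (real^'d::finite) set" where
  "grid_box R = {x. \<forall>i. - real_of_int R \<le> x $ i \<and> x $ i < real_of_int R}"

definition grid_cells :: "int \<Rightarrow> (int^'d::finite) set" where
  "grid_cells R = {c. \<forall>i. - R \<le> c $ i \<and> c $ i < R}"

lemma finite_grid_cells: "finite (grid_cells R :: (int^'d::finite) set)"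
proof -
  have "grid_cells R \<subseteq> vec_lambda ` (PiE (UNIV::'d set) (\<lambda>_. {- R..<R}))"
  proof
    fix c :: "int^'d" assume "c \<in> grid_cells R"
    then have "vec_nth c \<in> PiE UNIV (\<lambda>_. {- R..<R})" by (auto simp: grid_cells_def PiE_iff)
    then show "c \<in> vec_lambda ` (PiE (UNIV::'d set) (\<lambda>_. {- R..<R}))"
      by (metis image_eqI vec_nth_inverse)
  qed
  moreover have "finite (vec_lambda ` (PiE (UNIV::'d set) (\<lambda>_. {- R..<R})))"
    by (intro finite_imageI finite_PiE) auto
  ultimately show ?thesis by (rule finite_subset)
qed

lemma grid_box_iff: "x \<in> grid_box R \<longleftrightarrow> (\<chi> i. \<lfloor>x $ i\<rfloor>) \<in> grid_cells R"
proof -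
  have "- real_of_int R \<le> x $ i \<longleftrightarrow> - R \<le> \<lfloor>x $ i\<rfloor>" for i
    by (metis le_floor_iff of_int_minus)
  moreover have "x $ i < real_of_int R \<longleftrightarrow> \<lfloor>x $ i\<rfloor> < R" for i by (simp add: floor_less_iff)
  ultimately show ?thesis by (simp add: grid_box_def grid_cells_def)
qed

text \<open>The window is half-open like the cubes, so each of its points lies in exactly one cell.
  Superposition over the cells thus yields the Poisson process of intensity 1 on the window.\<close>

lemma sum_indicator_grid_cells:
  "(\<Sum>c\<in>grid_cells R. indicator (unit_cube c) x) = (indicator (grid_box R) x :: real)"
proof -
  let ?c = "\<chi> i. \<lfloor>x $ i\<rfloor>"
  have "(\<Sum>c\<in>grid_cells R. indicator (unit_cube c) x) = (\<Sum>c\<in>grid_cells R. if c = ?c then 1 else (0::real))"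
    by (intro sum.cong refl) (auto simp: indicator_def unit_cube_eq_iff)
  also have "\<dots> = indicator (grid_box R) x"
    by (simp add: finite_grid_cells grid_box_iff indicator_def)
  finally show ?thesis .
qed

lemma sets_grid_box[measurable]: "(grid_box R :: (real^'d::finite) set) \<in> sets borel"
proof -
  have "(grid_box R :: (real^'d) set) = (\<Union>c\<in>grid_cells R. unit_cube c)"
    by (auto simp: grid_box_iff unit_cube_eq_iff)
  then show ?thesis by (simp only:) (intro sets.finite_UN finite_grid_cells sets_unit_cube)
qed

lemma weight_grid_box: "weight (indicator (grid_box R))"
  using weight_sum_unit_cubes[of "grid_cells R"] by (simp add: sum_indicator_grid_cells)

lemma cball_subset_grid_box: "r < real_of_int R \<Longrightarrow> cball 0 r \<subseteq> grid_box R"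
proof
  fix x assume r: "r < real_of_int R" "x \<in> cball (0::real^'d) r"
  have "\<bar>x $ i\<bar> < real_of_int R" for i
    using component_le_norm_cart[of x i] r by simp
  then show "x \<in> grid_box R" unfolding grid_box_def by (simp add: abs_less_iff less_imp_le minus_less_iff)
qed

lemma hpp_points_eq: "hpp_points w = {z. \<exists>ci. snd ci < fst (w (fst ci)) \<and> z = snd (w (fst ci)) (snd ci)}"
  unfolding hpp_points_def by fastforce

lemma measurable_hpp_deg:
  assumes "l \<ge> 1"
  shows "Measurable.pred hpp_space (\<lambda>w. knn_deg k (insert 0 (hpp_points w)) 0 = l)"
  unfolding hpp_points_eq
  by (rule measurable_knn_deg_insert[where x="\<lambda>_. 0"]) (use assms in measurable)

lemma dcone_borel[measurable]: "dcone (u::'a::euclidean_space) \<in> sets borel"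
proof -
  have "dcone u = {y \<in> space borel. y \<noteq> 0 \<and> norm (y /\<^sub>R norm y - u) < 1/2}" by (simp add: dcone_def)
  also have "\<dots> \<in> sets borel" by measurable
  finally show ?thesis .
qed

lemma measurable_stab:
  fixes p :: "'i::countable \<Rightarrow> 'w \<Rightarrow> 'a::euclidean_space"
  assumes [measurable]: "\<And>i. p i \<in> M \<rightarrow>\<^sub>M borel" "\<And>i. Measurable.pred M (b i)" and U: "finite U"
  shows "Measurable.pred M (\<lambda>w. stab k U r {z. \<exists>i. b i w \<and> z = p i w})"
proof -
  have "Measurable.pred M (\<lambda>w. atleast k {z. (\<exists>i. b i w \<and> z = p i w) \<and> (z \<in> dcone u \<and> norm z \<le> r)})" for u
    by (rule measurable_atleast_range) measurable
  then show ?thesis unfolding stab_def mem_Collect_eq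
    using U by (intro pred_intros_finite(3)) auto
qed

text \<open>The sample space itself allows arbitrary coordinates; only almost surely does a point
  lie in the cube of its index. This lets the points in a window be read off from the cells of the
  window.\<close>

lemma AE_hpp_in_cubes: "AE w in hpp_space. \<forall>(c::int^'d::finite) i. snd (w c) i \<in> unit_cube c"
proof -
  have "AE w in hpp_space. snd (w c) i \<in> unit_cube c" for c :: "int^'d" and i
  proof -
    let ?u = "uniform_measure lborel (unit_cube c)"
    interpret S: prob_space "PiM UNIV (\<lambda>_::nat. ?u)" by (rule prob_space_cluster(1)[OF emeasure_unit_cube])
    interpret PP: pair_prob_space "measure_pmf (poisson_pmf 1)" "PiM UNIV (\<lambda>_::nat. ?u)" by unfold_locales
    have "AE x in ?u. x \<in> unit_cube c"
      by (rule AE_uniform_measureI) auto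
    then have "AE y in PiM UNIV (\<lambda>_::nat. ?u). y i \<in> unit_cube c"
      by (rule AE_PiM_component[rotated 2]) (auto simp: emeasure_unit_cube intro!: prob_space_uniform_measure)
    then have "AE n in measure_pmf (poisson_pmf 1). AE y in PiM UNIV (\<lambda>_::nat. ?u). y i \<in> unit_cube c" by simp
    then have "AE p in cluster_space (unit_cube c). snd p i \<in> unit_cube c"
      by (subst PP.AE_pair_iff[symmetric]) auto
    then show ?thesis
      unfolding hpp_space_cluster
      by (intro AE_PiM_component[where P="\<lambda>p. snd p i \<in> unit_cube c"] prob_space_cluster emeasure_unit_cube) auto
  qed
  then show ?thesis by (simp add: AE_all_countable)
qed

lemma hpp_points_grid_box:
  assumes w: "\<And>c i. snd (w c) i \<in> unit_cube c" and cs: "set cs = grid_cells R"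
  shows "set (concat (map (\<lambda>c. cluster_points (w c)) cs)) = hpp_points w \<inter> grid_box R"
proof -
  have "snd (w c) i \<in> grid_box R \<longleftrightarrow> c \<in> grid_cells R" for c i
    using w[of c i] by (simp add: grid_box_iff unit_cube_eq_iff)
  then show ?thesis
    unfolding hpp_points_def by (auto simp: cs cluster_points_def) (metis imageI lessThan_iff)
qed

text \<open>The first \<open>n\<close> of these distinct cells are simultaneously empty with
  probability \<open>exp (- 1) ^ n\<close>, by independence.\<close>

lemma AE_hpp_occupied:
  assumes inj: "inj c"
  shows "AE w in hpp_space. \<exists>j::nat. fst (w (c j)) \<ge> 1"
proof -
  let ?N = "{w \<in> space hpp_space. \<forall>j. fst (w (c j)) = 0}"
  interpret H: prob_space hpp_space by (rule prob_space_hpp)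
  have meas: "?N \<in> sets hpp_space" by measurable
  have "H.prob ?N \<le> exp (- 1) ^ n" for n
  proof -
    interpret pp: product_prob_space "\<lambda>c. cluster_space (unit_cube c)" UNIV
      by (rule product_prob_spaceI) (rule prob_space_cluster(2)[OF emeasure_unit_cube])
    have one: "emeasure (cluster_space (unit_cube a)) ({0} \<times> UNIV) = ennreal (exp (- 1))" for a :: "int^'a"
    proof -
      interpret S: prob_space "PiM UNIV (\<lambda>_::nat. uniform_measure lborel (unit_cube a))"
        by (rule prob_space_cluster(1)[OF emeasure_unit_cube])
      have "space (PiM UNIV (\<lambda>_::nat. uniform_measure lborel (unit_cube a))) = UNIV" by (simp add: space_PiM)
      then have "emeasure (cluster_space (unit_cube a)) ({0} \<times> UNIV) =
          emeasure (measure_pmf (poisson_pmf 1)) {0} * 1"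
        using S.emeasure_pair_measure_Times[of "{0}" "measure_pmf (poisson_pmf 1)" UNIV] S.emeasure_space_1
        by (metis sets.top sets_measure_pmf UNIV_I sets_count_space PowI subset_UNIV)
      then show ?thesis by (simp add: emeasure_pmf_single)
    qed
    have sp: "{0} \<times> UNIV \<in> sets (cluster_space (unit_cube a))" for a :: "int^'a"
    proof (rule pair_measureI)
      show "UNIV \<in> sets (PiM UNIV (\<lambda>_::nat. uniform_measure lborel (unit_cube a)))"
        using sets.top[of "PiM UNIV (\<lambda>_::nat. uniform_measure lborel (unit_cube a))"] by (simp add: space_PiM)
    qed simp
    have "H.prob ?N \<le> H.prob {w \<in> space hpp_space. \<forall>a\<in>c ` {..<n}. w a \<in> {0} \<times> UNIV}"
    proof (rule H.finite_measure_mono)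
      have "{w \<in> space hpp_space. \<forall>a\<in>c ` {..<n}. fst (w a) = 0} \<in> sets hpp_space" by measurable
      then show "{w \<in> space hpp_space. \<forall>a\<in>c ` {..<n}. w a \<in> {0} \<times> UNIV} \<in> sets hpp_space"
        by (simp add: mem_Times_iff)
    qed (auto simp: mem_Times_iff)
    also have "emeasure hpp_space {w \<in> space hpp_space. \<forall>a\<in>c ` {..<n}. w a \<in> {0} \<times> UNIV} = (\<Prod>a\<in>c ` {..<n}. ennreal (exp (- 1)))"
      unfolding hpp_space_cluster by (subst pp.emeasure_PiM_Collect) (auto simp: one sp)
    then have "H.prob {w \<in> space hpp_space. \<forall>a\<in>c ` {..<n}. w a \<in> {0} \<times> UNIV} = exp (- 1) ^ n"
      using card_image[OF inj_on_subset[OF inj subset_UNIV], of "{..<n}"]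
      by (simp add: measure_def ennreal_power[symmetric])
    finally show ?thesis by simp
  qed
  moreover have "(\<lambda>n. exp (- 1::real) ^ n) \<longlonglongrightarrow> 0" by (rule LIMSEQ_power_zero) simp
  ultimately have "H.prob ?N \<le> 0" by (intro LIMSEQ_le_const[where X="\<lambda>n. exp (- 1::real) ^ n"]) auto
  then have "H.prob ?N = 0" using measure_nonneg by (rule order_antisym)
  then have "emeasure hpp_space ?N = 0" by (simp add: H.emeasure_eq_measure)
  then have "AE w in hpp_space. \<not> (\<forall>j. fst (w (c j)) = 0)"
    using meas by (intro AE_I[of _ _ ?N]) auto
  then show ?thesis by (auto elim!: eventually_mono simp: Suc_le_eq)
qed

text \<open>The factor \<open>6 d\<close>, with \<open>d\<close> the dimension, makes these cells along the ray through \<open>u\<close>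
  pairwise distinct and keeps them inside the cone around \<open>u\<close>.\<close>

definition ray_cell :: "real^'d::finite \<Rightarrow> nat \<Rightarrow> int^'d" where
  "ray_cell u j = (\<chi> i. \<lfloor>6 * real CARD('d) * real (Suc j) * u $ i\<rfloor>)"

text \<open>The point \<open>z\<close> and the point of the ray lie in the same unit cell, so their
  coordinates differ by at most 1, and the Euclidean norm is bounded by the sum of the coordinates'
  absolute values.\<close>

lemma unit_cube_ray_cell_dist:
  fixes u :: "real^'d::finite"
  assumes "z \<in> unit_cube (ray_cell u j)"
  shows "norm (z - (6 * real CARD('d) * real (Suc j)) *\<^sub>R u) \<le> real CARD('d)"
proof -
  let ?t = "6 * real CARD('d) * real (Suc j)"
  have "\<bar>(z - ?t *\<^sub>R u) $ i\<bar> \<le> 1" for i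
  proof -
    have "real_of_int \<lfloor>?t * u $ i\<rfloor> \<le> z $ i" "z $ i < real_of_int \<lfloor>?t * u $ i\<rfloor> + 1"
      using assms by (auto simp: unit_cube_def ray_cell_def)
    moreover have "real_of_int \<lfloor>?t * u $ i\<rfloor> \<le> ?t * u $ i" "?t * u $ i < real_of_int \<lfloor>?t * u $ i\<rfloor> + 1" by linarith+
    moreover have "(z - ?t *\<^sub>R u) $ i = z $ i - ?t * u $ i" by simp
    ultimately show ?thesis by linarith
  qed
  then have "norm (z - ?t *\<^sub>R u) \<le> (\<Sum>i\<in>(UNIV::'d set). 1)"
    by (intro order_trans[OF norm_le_l1_cart] sum_mono)
  then show ?thesis by simp
qed

text \<open>With \<open>d\<close> the dimension, a common cell would put two points of the ray
  within \<open>2 d\<close> of each other, although they are at least \<open>6 d\<close>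
  apart.\<close>

lemma inj_ray_cell:
  fixes u :: "real^'d::finite"
  assumes u: "norm u = 1" shows "inj (ray_cell u)"
proof (rule injI, rule ccontr)
  fix j j' assume eq: "ray_cell u j = ray_cell u j'" and ne: "j \<noteq> j'"
  let ?d = "real CARD('d)"
  define z :: "real^'d" where "z = (\<chi> i. real_of_int (ray_cell u j $ i))"
  have z: "z \<in> unit_cube (ray_cell u j)" by (simp add: z_def unit_cube_def)
  have "norm ((6 * ?d * real (Suc j)) *\<^sub>R u - (6 * ?d * real (Suc j')) *\<^sub>R u) \<le> 2 * ?d"
    using unit_cube_ray_cell_dist[OF z] unit_cube_ray_cell_dist[OF z[unfolded eq]]
      norm_triangle_ineq4[of "z - (6 * ?d * real (Suc j')) *\<^sub>R u" "z - (6 * ?d * real (Suc j)) *\<^sub>R u"] by simp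
  also have "(6 * ?d * real (Suc j)) *\<^sub>R u - (6 * ?d * real (Suc j')) *\<^sub>R u = (6 * ?d * (real j - real j')) *\<^sub>R u"
    by (simp add: algebra_simps)
  finally have "6 * ?d * \<bar>real j - real j'\<bar> \<le> 2 * ?d" using u by (simp add: abs_mult)
  moreover have "\<bar>real j - real j'\<bar> \<ge> 1" using ne by linarith
  moreover have "?d > 0" by simp
  ultimately have "6 * ?d * 1 \<le> 2 * ?d" by (meson mult_left_mono order_trans mult_nonneg_nonneg zero_le_numeral less_imp_le)
  then show False using \<open>?d > 0\<close> by simp
qed

text \<open>With \<open>d\<close> the dimension, \<open>z\<close> is within \<open>d\<close> of a
  point of the ray whose norm is at least \<open>6 d\<close>. Hence \<open>norm z\<close> is at
  least \<open>5 d\<close> while \<open>z\<close> is within \<open>2 d\<close> of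
  \<open>norm z\<close> times \<open>u\<close>, and 2/5 is below 1/2.\<close>

lemma unit_cube_ray_cell_cone:
  fixes u :: "real^'d::finite"
  assumes u: "norm u = 1"
  shows "unit_cube (ray_cell u j) \<subseteq> dcone u"
proof
  fix z assume z: "z \<in> unit_cube (ray_cell u j)"
  let ?d = "real CARD('d)" and ?t = "6 * real CARD('d) * real (Suc j)"
  have d: "?d > 0" by simp
  have t: "?t \<ge> 6 * ?d" using d by simp
  have e: "norm (z - ?t *\<^sub>R u) \<le> ?d" by (rule unit_cube_ray_cell_dist[OF z])
  have nt: "norm (?t *\<^sub>R u) = ?t" using u by simp
  have nz: "\<bar>norm z - ?t\<bar> \<le> ?d" using norm_triangle_ineq3[of z "?t *\<^sub>R u"] e nt by linarith
  then have z0: "norm z \<ge> 5 * ?d" "norm z > 0" using t d by linarith+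
  have "norm (z - norm z *\<^sub>R u) \<le> norm (z - ?t *\<^sub>R u) + norm ((?t - norm z) *\<^sub>R u)"
    using norm_triangle_ineq[of "z - ?t *\<^sub>R u" "(?t - norm z) *\<^sub>R u"] by (simp add: scaleR_left_diff_distrib)
  also have "norm ((?t - norm z) *\<^sub>R u) = \<bar>norm z - ?t\<bar>" using u by (simp only: norm_scaleR) (simp add: abs_minus_commute)
  finally have "norm (z - norm z *\<^sub>R u) \<le> 2 * ?d" using e nz by linarith
  also have "\<dots> < 1/2 * norm z" using z0 d by linarith
  finally have a: "norm (z - norm z *\<^sub>R u) < 1/2 * norm z" .
  have "z /\<^sub>R norm z - u = (z - norm z *\<^sub>R u) /\<^sub>R norm z" using z0 by (simp add: scaleR_right_diff_distrib)
  then have "norm (z /\<^sub>R norm z - u) = norm (z - norm z *\<^sub>R u) / norm z"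
    using z0 by (simp add: divide_inverse mult.commute)
  also have "\<dots> < 1/2" using a z0 by (simp add: divide_less_eq)
  finally show "z \<in> dcone u" using z0 by (auto simp: dcone_def)
qed

text \<open>Applied to every tail of the ray, \<open>AE_hpp_occupied\<close> gives infinitely many
  occupied cells in each cone, hence infinitely many distinct points there. Any \<open>k\<close> of
  them lie in some ball, and there are finitely many cones.\<close>

lemma AE_hpp_stab:
  fixes U :: "(real^'d::finite) set"
  assumes U: "cone_cover U"
  shows "AE w in hpp_space. \<exists>r::nat. stab k U (real r) (hpp_points w)"
proof -
  have fin: "finite U" and norm1: "\<And>u. u \<in> U \<Longrightarrow> norm u = 1" using U by (auto simp: cone_cover_def)
  have "AE w in hpp_space. \<forall>u\<in>U. \<forall>m. \<exists>j. fst (w (ray_cell u (m + j))) \<ge> 1"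
  proof (intro AE_finite_allI[OF fin])
    fix u assume u: "u \<in> U"
    have "AE w in hpp_space. \<exists>j. fst (w (ray_cell u (m + j))) \<ge> 1" for m
      by (rule AE_hpp_occupied, rule injI) (use inj_ray_cell[OF norm1[OF u]] in \<open>auto dest: injD\<close>)
    then show "AE w in hpp_space. \<forall>m. \<exists>j. fst (w (ray_cell u (m + j))) \<ge> 1"
      by (simp add: AE_all_countable)
  qed
  then show ?thesis using AE_hpp_in_cubes
  proof eventually_elim
    case (elim w)
    have "\<exists>r. atleast k {z \<in> hpp_points w. z \<in> dcone u \<and> norm z \<le> r}" if u: "u \<in> U" for u
    proof -
      let ?J = "{j. fst (w (ray_cell u j)) \<ge> 1}" and ?p = "\<lambda>j. snd (w (ray_cell u j)) 0"
      have "infinite ?J"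
        unfolding infinite_nat_iff_unbounded_le using elim(1) u by (metis le_add1 mem_Collect_eq)
      moreover have "inj ?p"
      proof (rule injI)
        fix j j' assume "?p j = ?p j'"
        then have "ray_cell u j = ray_cell u j'" using elim(2) by (metis unit_cube_eq_iff)
        then show "j = j'" using inj_ray_cell[OF norm1[OF u]] by (simp add: inj_eq)
      qed
      ultimately have "infinite (?p ` ?J)" by (metis finite_imageD inj_on_subset subset_UNIV)
      then obtain T where T: "T \<subseteq> ?p ` ?J" "finite T" "card T = k"
        using infinite_arbitrarily_large by blast
      have "?p ` ?J \<subseteq> hpp_points w \<inter> dcone u"
        using elim(2) unit_cube_ray_cell_cone[OF norm1[OF u]]
        by (fastforce simp: hpp_points_def)
      then have "T \<subseteq> {z \<in> hpp_points w. z \<in> dcone u \<and> norm z \<le> (\<Sum>z\<in>T. norm z)}"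
        using T by (auto intro: member_le_sum)
      then show ?thesis unfolding atleast_def using T by blast
    qed
    then obtain r where r: "\<And>u. u \<in> U \<Longrightarrow> atleast k {z \<in> hpp_points w. z \<in> dcone u \<and> norm z \<le> r u}" by metis
    obtain n where n: "\<And>u. u \<in> U \<Longrightarrow> r u \<le> real n"
    proof -
      obtain n where "(\<Sum>u\<in>U. \<bar>r u\<bar>) \<le> real n" using real_arch_simple by blast
      moreover have "r u \<le> (\<Sum>u\<in>U. \<bar>r u\<bar>)" if "u \<in> U" for u
        using member_le_sum[of u U "\<lambda>u. \<bar>r u\<bar>"] fin that by fastforce
      ultimately show thesis using that[of n] order_trans by blast
    qed
    have "stab k U (real n) (hpp_points w)"
      unfolding stab_def by (auto intro!: atleast_mono[OF r] dest: n)
    then show ?case by blast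
  qed
qed

section \<open>Stabilisation and the local limit\<close>

definition deg_ind :: "nat \<Rightarrow> nat \<Rightarrow> 'a::euclidean_space list \<Rightarrow> real" where
  "deg_ind k l xs = (if knn_deg k (insert 0 (set xs)) 0 = l then 1 else 0)"

text \<open>Inserting the origin makes the indicator visibly insensitive to it, as
  \<open>config_fun\<close> demands; the value does not change because the origin lies in no
  cone.\<close>

definition stab_ind :: "nat \<Rightarrow> 'a::euclidean_space set \<Rightarrow> real \<Rightarrow> 'a list \<Rightarrow> real" where
  "stab_ind k U r xs = (if stab k U r (insert 0 (set xs)) then 1 else 0)"

lemma stab_insert_0: "stab k U r (insert 0 S) = stab k U r S"
proof -
  have "{z \<in> insert 0 S. z \<in> dcone u \<and> norm z \<le> r} = {z \<in> S. z \<in> dcone u \<and> norm z \<le> r}" for u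
    by (auto simp: dcone_def)
  then show ?thesis by (simp add: stab_def)
qed

lemma config_fun_deg_ind:
  assumes "l \<ge> 1" shows "config_fun (deg_ind k l)"
proof (rule config_funI[where D=1])
  fix n
  have eq: "set (map y [0..<n]) = {z. \<exists>i. i < n \<and> z = y i}" for y :: "nat \<Rightarrow> 'a" by auto
  have "Measurable.pred (PiM UNIV (\<lambda>_::nat. borel)) (\<lambda>y. knn_deg k (insert (0::'a) {z. \<exists>i. i < n \<and> z = y i}) 0 = l)"
    by (rule measurable_knn_deg_insert[where x="\<lambda>_. 0"]) (use assms in auto)
  then show "(\<lambda>y. deg_ind k l (map y [0..<n])) \<in> borel_measurable (PiM UNIV (\<lambda>_::nat. (borel :: 'a measure)))"
    unfolding deg_ind_def eq by measurable
qed (auto simp: deg_ind_def)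

lemma config_fun_stab_ind:
  assumes "finite U" shows "config_fun (stab_ind k U r)"
proof (rule config_funI[where D=1])
  fix n
  have eq: "set (map y [0..<n]) = {z. \<exists>i. i < n \<and> z = y i}" for y :: "nat \<Rightarrow> 'a" by auto
  have "Measurable.pred (PiM UNIV (\<lambda>_::nat. borel)) (\<lambda>y. stab k U r {z. \<exists>i. i < n \<and> z = y i})"
    by (rule measurable_stab) (use assms in auto)
  then show "(\<lambda>y. stab_ind k U r (map y [0..<n])) \<in> borel_measurable (PiM UNIV (\<lambda>_::nat. (borel :: 'a measure)))"
    unfolding stab_ind_def eq stab_insert_0 by measurable
qed (auto simp: stab_ind_def)

abbreviation hpp_stab_prob :: "nat \<Rightarrow> (real^'d::finite) set \<Rightarrow> nat \<Rightarrow> real" where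
  "hpp_stab_prob k U r \<equiv> measure hpp_space {w \<in> space hpp_space. stab k U (real r) (hpp_points w)}"

lemma sets_hpp_stab:
  assumes "finite U"
  shows "{w \<in> space hpp_space. stab k U r (hpp_points w)} \<in> sets hpp_space"
proof -
  have "Measurable.pred hpp_space (\<lambda>w. stab k U r (hpp_points w))"
    unfolding hpp_points_eq by (rule measurable_stab) (use assms in measurable)
  then show ?thesis by (simp add: pred_def)
qed

lemma hpp_stab_prob_tendsto:
  assumes U: "cone_cover U"
  shows "(\<lambda>r. hpp_stab_prob k U r) \<longlonglongrightarrow> 1"
proof -
  interpret prob_space hpp_space by (rule prob_space_hpp)
  let ?A = "\<lambda>r::nat. {w \<in> space hpp_space. stab k U (real r) (hpp_points w)}"
  have fin: "finite U" using U by (simp add: cone_cover_def)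
  have mono: "incseq ?A"
  proof (rule incseq_SucI, clarify)
    fix r w assume st: "stab k U (real r) (hpp_points w)"
    show "stab k U (real (Suc r)) (hpp_points w)"
      unfolding stab_def
    proof
      fix u assume u: "u \<in> U"
      show "atleast k {z \<in> hpp_points w. z \<in> dcone u \<and> norm z \<le> real (Suc r)}"
        by (rule atleast_mono[OF st[unfolded stab_def, rule_format, OF u]]) auto
    qed
  qed
  have "(\<lambda>r. prob (?A r)) \<longlonglongrightarrow> prob (\<Union>r. ?A r)"
    by (rule finite_Lim_measure_incseq) (use mono sets_hpp_stab[OF fin] in auto)
  moreover have "prob (\<Union>r. ?A r) = 1"
  proof (rule AE_in_set_eq_1[THEN iffD1])
    show "(\<Union>r. ?A r) \<in> events" using sets_hpp_stab[OF fin] by blast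
    show "AE w in hpp_space. w \<in> (\<Union>r. ?A r)"
      using AE_hpp_stab[OF U, of k] AE_space by eventually_elim auto
  qed
  ultimately show ?thesis by simp
qed

text \<open>The half-width \<open>2 * int r + 1\<close> is an integer above \<open>2 * r\<close>, so
  the window contains the ball that decides both stabilisation and, when it holds, the
  degree.\<close>

lemma hpp_grid_box_points:
  fixes U :: "(real^'d::finite) set"
  assumes U: "cone_cover U" and cs: "set cs = grid_cells (2 * int r + 1)"
    and w: "\<And>c i. snd (w c) i \<in> unit_cube c"
  shows "stab_ind k U r (concat (map (\<lambda>c. cluster_points (w c)) cs) @ []) = (if stab k U r (hpp_points w) then 1 else 0)"
    "stab k U r (hpp_points w) \<Longrightarrow> deg_ind k l (concat (map (\<lambda>c. cluster_points (w c)) cs) @ []) =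
       (if knn_deg k (insert 0 (hpp_points w)) 0 = l then 1 else 0)"
proof -
  let ?B = "grid_box (2 * int r + 1) :: (real^'d) set"
  have cb: "cball 0 (2 * real r) \<subseteq> ?B" by (rule cball_subset_grid_box) simp
  have set: "set (concat (map (\<lambda>c. cluster_points (w c)) cs) @ []) = hpp_points w \<inter> ?B"
    using hpp_points_grid_box[OF w cs] by simp
  have eq: "(hpp_points w \<inter> ?B) \<inter> cball 0 (2 * real r) = hpp_points w \<inter> cball 0 (2 * real r)" using cb by auto
  have st: "stab k U r (hpp_points w \<inter> ?B) = stab k U r (hpp_points w)"
    using stab_cong[OF _ eq, of k U] stab_cong[OF _ eq[symmetric], of k U] by blast
  show "stab_ind k U r (concat (map (\<lambda>c. cluster_points (w c)) cs) @ []) = (if stab k U r (hpp_points w) then 1 else 0)"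
    unfolding stab_ind_def set stab_insert_0 st ..
  assume "stab k U r (hpp_points w)"
  then have "knn_deg k (insert 0 (hpp_points w \<inter> ?B)) 0 = knn_deg k (insert 0 (hpp_points w)) 0"
    using st by (intro knn_deg_stab_cong[OF U _ eq]) simp
  then show "deg_ind k l (concat (map (\<lambda>c. cluster_points (w c)) cs) @ []) =
       (if knn_deg k (insert 0 (hpp_points w)) 0 = l then 1 else 0)"
    unfolding deg_ind_def set by simp
qed

text \<open>On the stabilisation event the degree in the window is the true degree; off this event
  two indicators differ by at most 1. Both quantities thereby become values of
  \<open>poisson_fun\<close>, to which the sample can be compared.\<close>

lemma hpp_local:
  fixes U :: "(real^'d::finite) set" and r :: nat
  assumes U: "cone_cover U" and l: "l \<ge> 1"
  defines "h \<equiv> indicator (grid_box (2 * int r + 1)) :: real^'d \<Rightarrow> real"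
  shows "poisson_fun h (stab_ind k U r) [] = hpp_stab_prob k U r"
    "\<bar>poisson_fun h (deg_ind k l) [] - p_star TYPE('d) k l\<bar> \<le> 1 - hpp_stab_prob k U r"
proof -
  let ?H = "hpp_space :: (int^'d \<Rightarrow> nat \<times> (nat \<Rightarrow> real^'d)) measure"
  interpret prob_space ?H by (rule prob_space_hpp)
  have fin: "finite U" using U by (simp add: cone_cover_def)
  obtain cs where cs: "set cs = (grid_cells (2 * int r + 1) :: (int^'d) set)" "distinct cs"
    using finite_distinct_list[OF finite_grid_cells] by blast
  have h: "(\<lambda>x. \<Sum>c\<in>set cs. indicator (unit_cube c) x) = h"
    unfolding h_def cs by (simp add: sum_indicator_grid_cells fun_eq_iff)
  note [measurable] = sets_hpp_stab[OF fin]
  let ?S = "{w \<in> space ?H. stab k U r (hpp_points w)}"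
  let ?E = "{w \<in> space ?H. knn_deg k (insert 0 (hpp_points w)) 0 = l}"
  have [measurable]: "?E \<in> sets ?H" using measurable_hpp_deg[OF l] by (simp add: pred_def)
  let ?c = "\<lambda>w. concat (map (\<lambda>c. cluster_points (w c)) cs) @ []"
  note mc = measurable_config_fun_hpp[where qs="[]", simplified]
  have ms[measurable]: "(\<lambda>w. stab_ind k U r (?c w)) \<in> borel_measurable ?H"
    "(\<lambda>w. deg_ind k l (?c w)) \<in> borel_measurable ?H"
    using mc[OF config_fun_stab_ind[OF fin]] mc[OF config_fun_deg_ind[OF l]] by simp_all
  have "poisson_fun h (stab_ind k U r) [] = (\<integral>w. stab_ind k U r (?c w) \<partial>?H)"
    using integral_config_fun_hpp[OF config_fun_stab_ind[OF fin] cs(2), of k r "[]"] unfolding h by simp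
  also have "\<dots> = (\<integral>w. indicator ?S w \<partial>?H)"
  proof (rule integral_cong_AE)
    show "AE w in ?H. stab_ind k U r (?c w) = indicator ?S w"
      using AE_hpp_in_cubes AE_space
    proof eventually_elim
      case (elim w)
      then show ?case using hpp_grid_box_points(1)[OF U cs(1), of w k] by (simp add: indicator_def)
    qed
  qed measurable
  also have "\<dots> = prob ?S" by simp
  finally show "poisson_fun h (stab_ind k U r) [] = prob ?S" .
  have iS: "integrable ?H (indicator ?S :: _ \<Rightarrow> real)" "integrable ?H (indicator ?E :: _ \<Rightarrow> real)"
    by (auto intro!: integrable_real_indicator simp: emeasure_eq_measure)
  have iD: "integrable ?H (\<lambda>w. deg_ind k l (?c w))"
    by (rule integrable_bounded[where D=1], rule ms(2)) (simp add: deg_ind_def)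
  have "poisson_fun h (deg_ind k l) [] - p_star TYPE('d) k l = (\<integral>w. deg_ind k l (?c w) \<partial>?H) - (\<integral>w. indicator ?E w \<partial>?H)"
    using integral_config_fun_hpp[OF config_fun_deg_ind[OF l] cs(2), of k "[]"] unfolding h p_star_def by simp
  also have "\<dots> = (\<integral>w. deg_ind k l (?c w) - indicator ?E w \<partial>?H)" using iS iD by simp
  also have "\<bar>\<dots>\<bar> \<le> (\<integral>w. \<bar>deg_ind k l (?c w) - indicator ?E w\<bar> \<partial>?H)" by (rule integral_abs_bound)
  also have "\<dots> \<le> (\<integral>w. 1 - indicator ?S w \<partial>?H)"
  proof (rule integral_mono_AE)
    show "AE w in ?H. \<bar>deg_ind k l (?c w) - indicator ?E w\<bar> \<le> 1 - indicator ?S w"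
      using AE_hpp_in_cubes AE_space
    proof eventually_elim
      case (elim w)
      then show ?case using hpp_grid_box_points(2)[OF U cs(1), of w k l]
        by (cases "stab k U r (hpp_points w)") (auto simp: indicator_def deg_ind_def)
    qed
  qed (use iS iD in auto)
  also have "\<dots> = 1 - prob ?S" using iS by (simp add: prob_space)
  finally show "\<bar>poisson_fun h (deg_ind k l) [] - p_star TYPE('d) k l\<bar> \<le> 1 - prob ?S" .
qed

section \<open>Rescaling the sample around a fixed point\<close>

lemma nn_integral_lborel_affine:
  fixes H :: "'a::euclidean_space \<Rightarrow> ennreal"
  assumes [measurable]: "H \<in> borel_measurable borel" and s: "s > 0"
  shows "(\<integral>\<^sup>+z. H z \<partial>lborel) = (\<integral>\<^sup>+w. ennreal (s ^ DIM('a)) * H (x + s *\<^sub>R w) \<partial>lborel)"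
proof -
  have "(\<integral>\<^sup>+z. H z \<partial>lborel) = (\<integral>\<^sup>+z. H z \<partial>density (distr lborel borel (\<lambda>w. x + s *\<^sub>R w)) (\<lambda>_. \<bar>s\<bar> ^ DIM('a)))"
    using lborel_affine[of s x] s by simp
  also have "\<dots> = (\<integral>\<^sup>+w. ennreal (s ^ DIM('a)) * H (x + s *\<^sub>R w) \<partial>lborel)"
    using s by (simp add: nn_integral_density nn_integral_distr ennreal_power)
  finally show ?thesis .
qed

lemma distr_dens_measure_rescale:
  fixes f :: "'a::euclidean_space \<Rightarrow> real"
  assumes [measurable]: "f \<in> borel_measurable borel" and f0: "\<And>x. f x \<ge> 0" and s: "s > 0"
  shows "distr (dens_measure f) borel (\<lambda>z. (z - x) /\<^sub>R s) = density lborel (\<lambda>w. ennreal (s ^ DIM('a) * f (x + s *\<^sub>R w)))"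
proof (rule measure_eqI)
  fix A assume "A \<in> sets (distr (dens_measure f) borel (\<lambda>z. (z - x) /\<^sub>R s))"
  then have [measurable]: "A \<in> sets borel" by simp
  have m: "(\<lambda>z. (z - x) /\<^sub>R s) \<in> dens_measure f \<rightarrow>\<^sub>M borel"
    unfolding dens_measure_def by measurable
  have pre: "(\<lambda>z. (z - x) /\<^sub>R s) -` A \<in> sets borel"
    using measurable_sets[of "\<lambda>z. (z - x) /\<^sub>R s" borel borel A] by simp
  have "emeasure (distr (dens_measure f) borel (\<lambda>z. (z - x) /\<^sub>R s)) A =
     (\<integral>\<^sup>+z. ennreal (f z) * indicator A ((z - x) /\<^sub>R s) \<partial>lborel)"
    using pre by (subst emeasure_distr[OF m]) (auto simp: dens_measure_def emeasure_density intro!: nn_integral_cong split: split_indicator)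
  also have "\<dots> = (\<integral>\<^sup>+w. ennreal (s ^ DIM('a)) * (ennreal (f (x + s *\<^sub>R w)) * indicator A w) \<partial>lborel)"
    using s by (subst nn_integral_lborel_affine[OF _ s, of _ x]) auto
  also have "\<dots> = emeasure (density lborel (\<lambda>w. ennreal (s ^ DIM('a) * f (x + s *\<^sub>R w)))) A"
    using s f0 by (simp add: emeasure_density ennreal_mult mult_ac)
  finally show "emeasure (distr (dens_measure f) borel (\<lambda>z. (z - x) /\<^sub>R s)) A =
    emeasure (density lborel (\<lambda>w. ennreal (s ^ DIM('a) * f (x + s *\<^sub>R w)))) A" .
qed simp

text \<open>Degree probability of an extra deterministic point \<open>x\<close> among
  \<open>n\<close> sample points: the conditional version of the degree of one point in a sample of
  size \<open>n + 1\<close>.\<close>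

definition deg_prob :: "('a::euclidean_space \<Rightarrow> real) \<Rightarrow> nat \<Rightarrow> nat \<Rightarrow> nat \<Rightarrow> 'a \<Rightarrow> real" where
  "deg_prob f k l n x = (\<integral>w. (if knn_deg k (insert x (w ` {..<n})) x = l then 1 else 0) \<partial>iid_space f)"

lemma sets_dens_measure[measurable_cong]: "sets (dens_measure f) = sets borel"
  unfolding dens_measure_def by simp

lemma space_dens_measure[simp]: "space (dens_measure f) = UNIV"
  unfolding dens_measure_def by simp

lemma rescaled_knn_deg:
  fixes X :: "'a::real_normed_vector set"
  assumes s: "s > 0"
  shows "knn_deg k (insert x X) x = knn_deg k (insert 0 ((\<lambda>z. (z - x) /\<^sub>R s) ` X)) 0"
proof -
  let ?g = "\<lambda>z. (z - x) /\<^sub>R s"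
  have "inj ?g" using s by (auto simp: inj_def)
  moreover have "dist (?g a) (?g b) = inverse s * dist a b" for a b
    using s by (simp add: dist_norm scaleR_right_diff_distrib[symmetric])
  ultimately have "knn_deg k (?g ` insert x X) (?g x) = knn_deg k (insert x X) x"
    using s by (intro knn_deg_similarity[of _ "inverse s"]) auto
  then show ?thesis by simp
qed

text \<open>A pathwise comparison: stabilisation inside the window forces the degree in the full
  sample to agree with that in the window, whatever the points outside are.\<close>

lemma local_deg_compare:
  fixes U :: "(real^'d::finite) set" and x :: "real^'d" and r :: nat and s :: real
  assumes U: "cone_cover U" and s: "s > 0"
  defines "\<psi> \<equiv> \<lambda>z. if (z - x) /\<^sub>R s \<in> grid_box (2 * int r + 1) then (z - x) /\<^sub>R s else 0"
  shows "\<bar>(if knn_deg k (insert x (w ` {..<n})) x = l then 1 else 0) - deg_ind k l (map (\<lambda>i. \<psi> (w i)) [0..<n])\<bar>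
     \<le> 1 - stab_ind k U r (map (\<lambda>i. \<psi> (w i)) [0..<n])"
proof (cases "stab k U r (insert 0 (set (map (\<lambda>i. \<psi> (w i)) [0..<n])))")
  case True
  let ?B = "grid_box (2 * int r + 1) :: (real^'d) set"
  let ?Y = "(\<lambda>z. (z - x) /\<^sub>R s) ` w ` {..<n}"
  let ?S = "set (map (\<lambda>i. \<psi> (w i)) [0..<n])"
  have ins: "insert 0 ?S = insert 0 (?Y \<inter> ?B)"
    unfolding \<psi>_def by (auto simp: image_iff)
  have cb: "cball 0 (2 * real r) \<subseteq> ?B" by (rule cball_subset_grid_box) simp
  have eq: "(?Y \<inter> ?B) \<inter> cball 0 (2 * real r) = ?Y \<inter> cball 0 (2 * real r)" using cb by auto
  have "stab k U r (?Y \<inter> ?B)" using True unfolding ins stab_insert_0 .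
  from knn_deg_stab_cong[OF U this eq]
  have "knn_deg k (insert 0 ?S) 0 = knn_deg k (insert x (w ` {..<n})) x"
    unfolding ins rescaled_knn_deg[OF s, of k x] .
  then show ?thesis using True by (simp add: deg_ind_def stab_ind_def)
next
  case False
  then show ?thesis by (simp add: deg_ind_def stab_ind_def)
qed

lemma measurable_deg_iid:
  assumes "l \<ge> 1"
  shows "(\<lambda>w. if knn_deg k (insert x (w ` {..<n})) x = l then 1 else (0::real)) \<in> borel_measurable (iid_space f)"
proof -
  have eq: "w ` {..<n} = {z. \<exists>i. i < n \<and> z = w i}" for w :: "nat \<Rightarrow> 'a" by auto
  have "Measurable.pred (iid_space f) (\<lambda>w. knn_deg k (insert x {z. \<exists>i. i < n \<and> z = w i}) x = l)"
    unfolding iid_space_def by (rule measurable_knn_deg_insert[where x="\<lambda>_. x"]) (use assms in measurable)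
  then show ?thesis unfolding eq by measurable
qed

text \<open>The window functionals for degree and for stabilisation both converge by the same
  statement \<open>lim\<close>. The second controls how far the first is from the true degree, for
  the sample through \<open>cmp\<close> and for the Poisson process through
  \<open>hpp_local\<close>.\<close>

theorem deg_prob_tendsto:
  fixes f :: "real^'d::finite \<Rightarrow> real"
  assumes [measurable]: "f \<in> borel_measurable borel" and f0: "\<And>x. f x \<ge> 0" and fp: "prob_space (dens_measure f)"
    and fb: "\<And>x. f x \<le> C" and x: "f x > 0" "isCont f x" and l: "l \<ge> 1"
  shows "(\<lambda>n. deg_prob f k l n x) \<longlonglongrightarrow> p_star TYPE('d) k l"
proof -
  let ?d = "DIM(real^'d)"
  \<comment> \<open>The value 1 at \<open>n = 0\<close> keeps the scale below positive for every
    \<open>n\<close>.\<close>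
  define N where "N n = real (max n 1)" for n
  have N: "N n \<ge> 1" for n by (simp add: N_def)
  \<comment> \<open>Solves \<open>N n * s n ^ d * f x = 1\<close> with \<open>d\<close> the
    dimension, so that the rescaled sample has intensity close to 1 near the origin.\<close>
  define s where "s n = root ?d (1 / (N n * f x))" for n
  have dp: "?d > 0" by simp
  have s0: "s n > 0" for n using N[of n] x dp unfolding s_def by (intro real_root_gt_zero) auto
  have sd: "s n ^ ?d = 1 / (N n * f x)" for n
    unfolding s_def using N[of n] x dp by (intro real_root_pow_pos2) auto
  have Nlim: "filterlim N at_top sequentially"
    unfolding N_def by (rule filterlim_at_top_mono[OF filterlim_real_sequentially]) (auto intro!: always_eventually)
  have slim: "s \<longlonglongrightarrow> 0"
  proof -
    have "(\<lambda>n. inverse (N n) * inverse (f x)) \<longlonglongrightarrow> 0 * inverse (f x)"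
      by (intro tendsto_mult tendsto_const tendsto_inverse_0_at_top Nlim)
    then have "(\<lambda>n. root ?d (inverse (N n) * inverse (f x))) \<longlonglongrightarrow> root ?d 0"
      using dp by (intro tendsto_real_root) auto
    moreover have "s = (\<lambda>n. root ?d (inverse (N n) * inverse (f x)))"
      by (simp add: s_def divide_inverse fun_eq_iff)
    ultimately show ?thesis using dp by simp
  qed
  define \<gamma> where "\<gamma> n w = s n ^ ?d * f (x + s n *\<^sub>R w)" for n w
  have \<gamma>m[measurable]: "\<gamma> n \<in> borel_measurable borel" for n unfolding \<gamma>_def[abs_def] by measurable
  have \<gamma>0: "\<gamma> n w \<ge> 0" for n w unfolding \<gamma>_def using f0 s0[of n] by simp
  have dist\<gamma>: "distr (dens_measure f) borel (\<lambda>z. (z - x) /\<^sub>R s n) = density lborel (\<lambda>w. ennreal (\<gamma> n w))" for n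
    unfolding \<gamma>_def by (rule distr_dens_measure_rescale[OF assms(1) f0 s0])
  have phim: "(\<lambda>z. (z - x) /\<^sub>R s n) \<in> dens_measure f \<rightarrow>\<^sub>M borel" for n by measurable
  obtain U :: "(real^'d) set" where U: "cone_cover U" using cone_cover_exists by blast
  have fin: "finite U" using U by (simp add: cone_cover_def)
  define \<psi> where "\<psi> r n z = (if (z - x) /\<^sub>R s n \<in> grid_box (2 * int r + 1) then (z - x) /\<^sub>R s n else 0)" for r :: nat and n z
  have \<psi>m: "\<psi> r n \<in> dens_measure f \<rightarrow>\<^sub>M borel" for r n unfolding \<psi>_def[abs_def] by measurable
  interpret I: prob_space "iid_space f" unfolding iid_space_def by (intro prob_space_PiM fp)
  define E where "E r n F = (\<integral>w. F (map (\<lambda>i. \<psi> r n (w i)) [0..<n]) \<partial>iid_space f)" for r n and F :: "(real^'d) list \<Rightarrow> real"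
  have lim: "(\<lambda>n. E r n F) \<longlonglongrightarrow> poisson_fun (indicator (grid_box (2 * int r + 1))) F []" if F: "config_fun F" for r F
  proof -
    let ?B = "grid_box (2 * int r + 1) :: (real^'d) set"
    define g where "g n = (\<lambda>w. \<gamma> n w * indicator ?B w)" for n
    note col = sample_point_collapse[OF fp phim sets_grid_box[of "2 * int r + 1"] \<gamma>m \<gamma>0 dist\<gamma>, folded g_def]
    have eq: "E r n F = (\<Sum>m\<le>n. real (n choose m) * (1 - mass (g n)) ^ (n - m) * (add_point (g n) ^^ m) F [])" for n
    proof -
      have "E r n F = (sample_point (dens_measure f) (\<psi> r n) ^^ n) F []"
        unfolding E_def iid_space_def using integral_config_fun_iid[OF fp F \<psi>m[of r n], where xs="[]" and m=n] by simp
      also have "\<dots> = (\<Sum>m\<le>n. real (n choose m) * (1 - mass (g n)) ^ (n - m) * (add_point (g n) ^^ m) F [])"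
        unfolding \<psi>_def[abs_def] g_def
        by (rule sample_point_collapse_power[OF fp phim sets_grid_box \<gamma>m \<gamma>0 dist\<gamma> F])
      finally show ?thesis .
    qed
    \<comment> \<open>Pointwise convergence is continuity of \<open>f\<close> at \<open>x\<close>,
      because the scale tends to 0; on the window the integrand is dominated by
      \<open>C / f x + 1\<close>, because \<open>f\<close> is bounded by \<open>C\<close>.\<close>
    have L1: "(\<lambda>n. \<integral>w. \<bar>real n * g n w - indicator ?B w\<bar> \<partial>lborel) \<longlonglongrightarrow> (\<integral>w. 0 \<partial>(lborel :: (real^'d) measure))"
    proof (rule integral_dominated_convergence)
      have "integrable lborel (indicator ?B :: real^'d \<Rightarrow> real)" using weight_grid_box by (simp add: weight_def)
      then show "integrable lborel (\<lambda>w. (C / f x + 1) * (indicator ?B w :: real))" by simp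
      show "(\<lambda>w. \<bar>real n * g n w - indicator ?B w\<bar>) \<in> borel_measurable lborel" for n
        unfolding g_def by measurable
      show "AE w in lborel. norm \<bar>real n * g n w - indicator ?B w\<bar> \<le> (C / f x + 1) * indicator ?B w" for n
      proof (rule AE_I2)
        fix w :: "real^'d"
        have "real n * \<gamma> n w = (real n / N n) * (f (x + s n *\<^sub>R w) / f x)"
          unfolding \<gamma>_def sd by simp
        also have "\<dots> \<le> 1 * (C / f x)"
        proof (rule mult_mono)
          show "real n / N n \<le> 1" using N[of n] by (simp add: N_def divide_le_eq)
          show "f (x + s n *\<^sub>R w) / f x \<le> C / f x" using fb x by (intro divide_right_mono) auto
        qed (use f0 x in auto)
        finally have "real n * \<gamma> n w \<le> C / f x" by simp
        moreover have "real n * \<gamma> n w \<ge> 0" using \<gamma>0 by simp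
        ultimately have "\<bar>real n * \<gamma> n w - 1\<bar> \<le> C / f x + 1" by linarith
        then show "norm \<bar>real n * g n w - indicator ?B w\<bar> \<le> (C / f x + 1) * indicator ?B w"
          by (auto simp: g_def split: split_indicator)
      qed
      show "AE w in lborel. (\<lambda>n. \<bar>real n * g n w - indicator ?B w\<bar>) \<longlonglongrightarrow> 0"
      proof (rule AE_I2)
        fix w :: "real^'d"
        have "(\<lambda>n. x + s n *\<^sub>R w) \<longlonglongrightarrow> x + 0 *\<^sub>R w" by (intro tendsto_intros slim)
        then have "(\<lambda>n. f (x + s n *\<^sub>R w)) \<longlonglongrightarrow> f x"
          using x(2) by (auto intro: isCont_tendsto_compose)
        then have "(\<lambda>n. f (x + s n *\<^sub>R w) / f x) \<longlonglongrightarrow> f x / f x" using x by (intro tendsto_intros) auto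
        then have "(\<lambda>n. \<bar>f (x + s n *\<^sub>R w) / f x - 1\<bar>) \<longlonglongrightarrow> \<bar>f x / f x - 1\<bar>"
          by (intro tendsto_rabs tendsto_diff tendsto_const)
        then have l0: "(\<lambda>n. \<bar>f (x + s n *\<^sub>R w) / f x - 1\<bar>) \<longlonglongrightarrow> 0" using x by simp
        have "\<forall>\<^sub>F n in sequentially. norm \<bar>real n * g n w - indicator ?B w\<bar> \<le> \<bar>f (x + s n *\<^sub>R w) / f x - 1\<bar>"
          using eventually_ge_at_top[of 1]
        proof eventually_elim
          case (elim n)
          then have "real n * \<gamma> n w = f (x + s n *\<^sub>R w) / f x"
            unfolding \<gamma>_def sd by (simp add: N_def max_def)
          then show ?case by (auto simp: g_def split: split_indicator)
        qed
        then show "(\<lambda>n. \<bar>real n * g n w - indicator ?B w\<bar>) \<longlonglongrightarrow> 0" using l0 by (rule Lim_null_comparison)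
      qed
    qed measurable
    show ?thesis unfolding eq
      by (rule binomial_poisson_fun_tendsto[OF col(1) col(2) weight_grid_box F]) (use L1 in simp)
  qed
  have cmp: "\<bar>deg_prob f k l n x - E r n (deg_ind k l)\<bar> \<le> 1 - E r n (stab_ind k U r)" for r n
  proof -
    have m: "(\<lambda>w. F (map (\<lambda>i. \<psi> r n (w i)) [0..<n])) \<in> borel_measurable (iid_space f)" if "config_fun F" for F
      unfolding iid_space_def by (rule measurable_config_fun_nth[OF that], rule measurable_compose[OF _ \<psi>m]) measurable
    have i: "integrable (iid_space f) (\<lambda>w. deg_ind k l (map (\<lambda>i. \<psi> r n (w i)) [0..<n]))"
      "integrable (iid_space f) (\<lambda>w. stab_ind k U r (map (\<lambda>i. \<psi> r n (w i)) [0..<n]))"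
      "integrable (iid_space f) (\<lambda>w. if knn_deg k (insert x (w ` {..<n})) x = l then 1 else (0::real))"
      by (rule I.integrable_bounded[where D=1], rule m[OF config_fun_deg_ind[OF l]], simp add: deg_ind_def)
        (rule I.integrable_bounded[where D=1], rule m[OF config_fun_stab_ind[OF fin]], simp add: stab_ind_def,
         rule I.integrable_bounded[where D=1], rule measurable_deg_iid[OF l], simp)
    have "deg_prob f k l n x - E r n (deg_ind k l) = (\<integral>w. (if knn_deg k (insert x (w ` {..<n})) x = l then 1 else 0) -
        deg_ind k l (map (\<lambda>i. \<psi> r n (w i)) [0..<n]) \<partial>iid_space f)"
      unfolding deg_prob_def E_def by (rule Bochner_Integration.integral_diff[OF i(3) i(1), symmetric])
    also have "\<bar>\<dots>\<bar> \<le> (\<integral>w. \<bar>(if knn_deg k (insert x (w ` {..<n})) x = l then 1 else 0) -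
        deg_ind k l (map (\<lambda>i. \<psi> r n (w i)) [0..<n])\<bar> \<partial>iid_space f)" by (rule integral_abs_bound)
    also have "\<dots> \<le> (\<integral>w. 1 - stab_ind k U r (map (\<lambda>i. \<psi> r n (w i)) [0..<n]) \<partial>iid_space f)"
    proof (rule integral_mono)
      show "integrable (iid_space f) (\<lambda>w. \<bar>(if knn_deg k (insert x (w ` {..<n})) x = l then 1 else 0) -
        deg_ind k l (map (\<lambda>i. \<psi> r n (w i)) [0..<n])\<bar>)"
        by (intro integrable_abs Bochner_Integration.integrable_diff i)
      show "integrable (iid_space f) (\<lambda>w. 1 - stab_ind k U r (map (\<lambda>i. \<psi> r n (w i)) [0..<n]))"
        using i(2) by simp
      show "\<bar>(if knn_deg k (insert x (w ` {..<n})) x = l then 1 else 0) -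
        deg_ind k l (map (\<lambda>i. \<psi> r n (w i)) [0..<n])\<bar> \<le> 1 - stab_ind k U r (map (\<lambda>i. \<psi> r n (w i)) [0..<n])" for w
        unfolding \<psi>_def by (rule local_deg_compare[OF U s0])
    qed
    also have "\<dots> = 1 - E r n (stab_ind k U r)"
      unfolding E_def using i(2) by (simp add: I.prob_space)
    finally show ?thesis .
  qed
  show ?thesis
  proof (rule tendstoI)
    \<comment> \<open>Three errors below \<open>e / 4\<close> are added: window against full sample,
      sample against Poisson process in the window, and window against full Poisson process.\<close>
    fix e :: real assume e: "e > 0"
    have "\<forall>\<^sub>F r in sequentially. hpp_stab_prob k U r > 1 - e / 4"
      by (rule order_tendstoD(1)[OF hpp_stab_prob_tendsto[OF U]]) (use e in simp)
    then obtain r where r: "hpp_stab_prob k U r > 1 - e / 4" by (auto simp: eventually_sequentially)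
    note hl = hpp_local[OF U l, where k=k and r=r]
    have "\<forall>\<^sub>F n in sequentially. dist (E r n (deg_ind k l)) (poisson_fun (indicator (grid_box (2 * int r + 1))) (deg_ind k l) ([] :: (real^'d) list)) < e / 4"
      by (rule tendstoD[OF lim[OF config_fun_deg_ind[OF l]]]) (use e in simp)
    moreover have "\<forall>\<^sub>F n in sequentially. E r n (stab_ind k U r) > 1 - e / 4"
      by (rule order_tendstoD(1)[OF lim[OF config_fun_stab_ind[OF fin]]]) (use r hl(1) in simp)
    ultimately show "\<forall>\<^sub>F n in sequentially. dist (deg_prob f k l n x) (p_star TYPE('d) k l) < e"
    proof eventually_elim
      case (elim n)
      then show ?case using cmp[of n r] hl(2) r unfolding dist_real_def by linarith
    qed
  qed
qed

section \<open>Averages along squares and Poissonization\<close>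

lemma increments_bounded:
  fixes a :: "nat \<Rightarrow> real"
  assumes "\<And>n. \<bar>a (Suc n) - a n\<bar> \<le> c"
  shows "\<bar>a (m + j) - a m\<bar> \<le> c * real j"
proof (induction j)
  case (Suc j)
  have "\<bar>a (m + Suc j) - a m\<bar> \<le> \<bar>a (Suc (m + j)) - a (m + j)\<bar> + \<bar>a (m + j) - a m\<bar>" by simp
  also have "\<dots> \<le> c + c * real j" using assms Suc.IH by (intro add_mono)
  finally show ?case by (simp add: algebra_simps)
qed simp

text \<open>Between \<open>m ^ 2\<close> and the next square there are at most \<open>2 * m\<close>
  steps, so \<open>a\<close> changes by \<open>O(m)\<close>, which is negligible against
  \<open>m ^ 2\<close>.\<close>

lemma average_tendsto_from_squares:
  fixes a :: "nat \<Rightarrow> real"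
  assumes inc: "\<And>n. \<bar>a (Suc n) - a n\<bar> \<le> c" and lim: "(\<lambda>m. a (m\<^sup>2) / real (m\<^sup>2)) \<longlonglongrightarrow> p"
  shows "(\<lambda>n. a n / real n) \<longlonglongrightarrow> p"
proof -
  have c: "c \<ge> 0" using inc[of 0] by linarith
  have fs: "filterlim floor_sqrt at_top sequentially"
    unfolding filterlim_at_top
  proof
    fix Z show "\<forall>\<^sub>F n in sequentially. Z \<le> floor_sqrt n"
      using eventually_ge_at_top[of "Z\<^sup>2"] by eventually_elim (rule le_floor_sqrtI)
  qed
  have "(\<lambda>m. \<bar>a (m\<^sup>2) / real (m\<^sup>2) - p\<bar> + 2 * (c + \<bar>p\<bar>) * inverse (real m)) \<longlonglongrightarrow> \<bar>p - p\<bar> + 2 * (c + \<bar>p\<bar>) * 0"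
    by (intro tendsto_add tendsto_rabs tendsto_diff tendsto_mult tendsto_const lim lim_inverse_n)
  then have "(\<lambda>m. \<bar>a (m\<^sup>2) / real (m\<^sup>2) - p\<bar> + 2 * (c + \<bar>p\<bar>) * inverse (real m)) \<longlonglongrightarrow> 0" by simp
  from filterlim_compose[OF this fs]
  have z: "(\<lambda>n. \<bar>a ((floor_sqrt n)\<^sup>2) / real ((floor_sqrt n)\<^sup>2) - p\<bar> + 2 * (c + \<bar>p\<bar>) * inverse (real (floor_sqrt n))) \<longlonglongrightarrow> 0" .
  have "\<forall>\<^sub>F n in sequentially. norm (a n / real n - p) \<le>
    \<bar>a ((floor_sqrt n)\<^sup>2) / real ((floor_sqrt n)\<^sup>2) - p\<bar> + 2 * (c + \<bar>p\<bar>) * inverse (real (floor_sqrt n))"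
    using eventually_gt_at_top[of 0]
  proof eventually_elim
    case (elim n)
    define m where "m = floor_sqrt n"
    have m: "m > 0" "m\<^sup>2 \<le> n" "n < (Suc m)\<^sup>2" using elim Suc_floor_sqrt_power2_gt[of n] by (auto simp: m_def)
    define j where "j = n - m\<^sup>2"
    have j: "n = m\<^sup>2 + j" "j \<le> 2 * m" using m by (auto simp: j_def power2_eq_square)
    have "\<bar>a n - a (m\<^sup>2)\<bar> \<le> c * real j" unfolding j(1) by (rule increments_bounded[where a=a, OF inc])
    also have "\<dots> \<le> c * (2 * real m)" using j(2) c by (intro mult_left_mono) auto
    finally have d1: "\<bar>a n - a (m\<^sup>2)\<bar> \<le> 2 * c * real m" by simp
    have d2: "\<bar>p * real j\<bar> \<le> \<bar>p\<bar> * (2 * real m)" using j(2) by (simp add: abs_mult mult_left_mono)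
    have m2: "0 < real (m\<^sup>2)" "real (m\<^sup>2) \<le> real n" using m by auto
    have "a n - p * real n = real (m\<^sup>2) * (a (m\<^sup>2) / real (m\<^sup>2) - p) + (a n - a (m\<^sup>2)) - p * real j"
      using m2 unfolding j(1) by (simp add: field_simps)
    moreover have "\<bar>real (m\<^sup>2) * (a (m\<^sup>2) / real (m\<^sup>2) - p)\<bar> \<le> real (m\<^sup>2) * \<bar>a (m\<^sup>2) / real (m\<^sup>2) - p\<bar>"
      by (simp only: abs_mult abs_of_nat order_refl)
    moreover have "\<bar>t\<bar> \<le> x + y + z" if "t = X + Y - Z" "\<bar>X\<bar> \<le> x" "\<bar>Y\<bar> \<le> y" "\<bar>Z\<bar> \<le> z"
      for t X Y Z x y z :: real
      using that by linarith
    ultimately have "\<bar>a n - p * real n\<bar> \<le> real (m\<^sup>2) * \<bar>a (m\<^sup>2) / real (m\<^sup>2) - p\<bar> + 2 * c * real m + \<bar>p\<bar> * (2 * real m)"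
      using d1 d2 by blast
    also have "\<dots> \<le> real n * \<bar>a (m\<^sup>2) / real (m\<^sup>2) - p\<bar> + real n * (2 * (c + \<bar>p\<bar>) * inverse (real m))"
    proof -
      have "real m = real (m\<^sup>2) * inverse (real m)" using m by (simp add: power2_eq_square)
      also have "\<dots> \<le> real n * inverse (real m)" using m2 by (intro mult_right_mono) auto
      finally have "2 * (c + \<bar>p\<bar>) * real m \<le> 2 * (c + \<bar>p\<bar>) * (real n * inverse (real m))"
        using c by (intro mult_left_mono) auto
      moreover have "real (m\<^sup>2) * \<bar>a (m\<^sup>2) / real (m\<^sup>2) - p\<bar> \<le> real n * \<bar>a (m\<^sup>2) / real (m\<^sup>2) - p\<bar>"
        using m2 by (intro mult_right_mono) auto
      ultimately show ?thesis by (simp add: algebra_simps)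
    qed
    finally have "\<bar>a n - p * real n\<bar> \<le> real n * (\<bar>a (m\<^sup>2) / real (m\<^sup>2) - p\<bar> + 2 * (c + \<bar>p\<bar>) * inverse (real m))"
      by (simp add: distrib_left)
    moreover have "norm (a n / real n - p) = \<bar>a n - p * real n\<bar> / real n"
    proof -
      have "a n / real n - p = (a n - p * real n) / real n" using elim by (simp add: diff_divide_distrib)
      then show ?thesis by simp
    qed
    ultimately show ?case unfolding m_def[symmetric] using elim by (simp add: divide_le_eq mult.commute)
  qed
  then have "(\<lambda>n. a n / real n - p) \<longlonglongrightarrow> 0" using z by (rule Lim_null_comparison)
  then show ?thesis by (rule LIM_zero_cancel)
qed

text \<open>The sum of all squares has finite expectation, hence is finite almost surely, and then
  its terms tend to 0.\<close>

lemma AE_tendsto_zero_of_summable_second_moments: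
  fixes Y :: "nat \<Rightarrow> 'a \<Rightarrow> real"
  assumes int: "\<And>m. integrable M (\<lambda>w. (Y m w)\<^sup>2)" and d: "\<And>m. (\<integral>w. (Y m w)\<^sup>2 \<partial>M) \<le> d m" "summable d"
  shows "AE w in M. (\<lambda>m. Y m w) \<longlonglongrightarrow> 0"
proof -
  have [measurable]: "(\<lambda>w. (Y m w)\<^sup>2) \<in> borel_measurable M" for m using int by (rule borel_measurable_integrable)
  have d0: "d m \<ge> 0" for m
    using d(1)[of m] integral_nonneg_AE[of "\<lambda>w. (Y m w)\<^sup>2" M] by (meson AE_I2 order_trans zero_le_power2)
  have "(\<integral>\<^sup>+w. (\<Sum>m. ennreal ((Y m w)\<^sup>2)) \<partial>M) = (\<Sum>m. \<integral>\<^sup>+w. ennreal ((Y m w)\<^sup>2) \<partial>M)"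
    by (rule nn_integral_suminf) measurable
  also have "\<dots> = (\<Sum>m. ennreal (\<integral>w. (Y m w)\<^sup>2 \<partial>M))"
    by (intro suminf_cong nn_integral_eq_integral int) auto
  also have "\<dots> \<le> (\<Sum>m. ennreal (d m))" using d by (intro suminf_le summableI ennreal_leI) auto
  also have "\<dots> = ennreal (suminf d)" using d0 d(2) by (intro suminf_ennreal_eq summable_sums) auto
  finally have "(\<integral>\<^sup>+w. (\<Sum>m. ennreal ((Y m w)\<^sup>2)) \<partial>M) \<noteq> \<infinity>" by (auto simp: top_unique)
  then have "AE w in M. (\<Sum>m. ennreal ((Y m w)\<^sup>2)) \<noteq> \<infinity>"
    by (intro nn_integral_noteq_infinite) measurable
  then show ?thesis
  proof eventually_elim
    case (elim w)
    then have "summable (\<lambda>m. (Y m w)\<^sup>2)" by (intro summable_suminf_not_top) auto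
    then have "(\<lambda>m. (Y m w)\<^sup>2) \<longlonglongrightarrow> 0" by (rule summable_LIMSEQ_zero)
    then have "(\<lambda>m. sqrt ((Y m w)\<^sup>2)) \<longlonglongrightarrow> sqrt 0" by (rule tendsto_real_sqrt)
    then have "(\<lambda>m. \<bar>Y m w\<bar>) \<longlonglongrightarrow> 0" by simp
    then show ?case by (rule tendsto_rabs_zero_cancel)
  qed
qed

lemma poisson_pmf_mean:
  assumes \<nu>: "\<nu> > 0"
  shows "integrable (measure_pmf (poisson_pmf \<nu>)) real" "(\<integral>n. real n \<partial>measure_pmf (poisson_pmf \<nu>)) = \<nu>"
proof -
  have "(\<lambda>n. \<nu> ^ n / fact n) sums exp \<nu>"
    using exp_converges[of \<nu>] by (simp add: divide_inverse mult.commute)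
  then have "(\<lambda>n. \<nu> * exp (- \<nu>) * (\<nu> ^ n / fact n)) sums (\<nu> * exp (- \<nu>) * exp \<nu>)" by (rule sums_mult)
  \<comment> \<open>The weight at \<open>n\<close> times \<open>\<nu>\<close> equals
    \<open>Suc n\<close> times the weight at \<open>Suc n\<close>, so the series of the mean is a
    shifted exponential series.\<close>
  moreover have "\<nu> * exp (- \<nu>) * (\<nu> ^ n / fact n) = pmf (poisson_pmf \<nu>) (Suc n) * real (Suc n)" for n
    using \<nu> by (simp del: of_nat_Suc)
  moreover have "\<nu> * exp (- \<nu>) * exp \<nu> = \<nu>" by (simp add: exp_minus)
  ultimately have "(\<lambda>n. pmf (poisson_pmf \<nu>) (Suc n) * real (Suc n)) sums \<nu>" by (simp only:)
  then have s: "(\<lambda>n. pmf (poisson_pmf \<nu>) n * real n) sums \<nu>" by (subst (asm) sums_Suc_iff) simp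
  have "(\<integral>\<^sup>+n. ennreal (real n) \<partial>measure_pmf (poisson_pmf \<nu>)) = (\<Sum>n. ennreal (pmf (poisson_pmf \<nu>) n * real n))"
    unfolding nn_integral_measure_pmf nn_integral_count_space_nat by (simp add: ennreal_mult)
  also have "\<dots> = ennreal \<nu>" by (rule suminf_ennreal_eq[OF _ s]) simp
  finally have e: "(\<integral>\<^sup>+n. ennreal (real n) \<partial>measure_pmf (poisson_pmf \<nu>)) = ennreal \<nu>" .
  show "integrable (measure_pmf (poisson_pmf \<nu>)) real"
    by (rule integrableI_nonneg) (auto simp: e)
  show "(\<integral>n. real n \<partial>measure_pmf (poisson_pmf \<nu>)) = \<nu>"
    using e \<nu> by (subst integral_eq_nn_integral) auto
qed

text \<open>Poissonization only costs the factor \<open>E N / \<nu> = 1\<close>.\<close>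

lemma poisson_average_tendsto:
  fixes e :: "nat \<Rightarrow> real"
  assumes lim: "(\<lambda>n. e n / real n) \<longlonglongrightarrow> p" and bd: "\<And>n. \<bar>e n\<bar> \<le> real n"
  shows "((\<lambda>\<nu>. (\<integral>n. e n \<partial>measure_pmf (poisson_pmf \<nu>)) / \<nu>) \<longlongrightarrow> p) at_top"
proof (rule tendstoI)
  fix \<epsilon> :: real assume \<epsilon>: "\<epsilon> > 0"
  have "\<forall>\<^sub>F n in sequentially. \<bar>e n / real n - p\<bar> < \<epsilon> / 2"
    using tendstoD[OF lim, of "\<epsilon> / 2"] \<epsilon> by (simp add: dist_real_def)
  then obtain N where N: "\<And>n. n \<ge> N \<Longrightarrow> \<bar>e n / real n - p\<bar> < \<epsilon> / 2" by (auto simp: eventually_sequentially)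
  \<comment> \<open>Absorbs the finitely many \<open>n < N\<close>, for which only the crude bound
    on \<open>e n\<close> is available; it disappears after division by
    \<open>\<nu>\<close>.\<close>
  define C where "C = (1 + \<bar>p\<bar>) * real N"
  have C0: "C \<ge> 0" by (simp add: C_def)
  have bound: "\<bar>e n - p * real n\<bar> \<le> \<epsilon> / 2 * real n + C" for n
  proof (cases "n \<ge> N \<and> n > 0")
    case True
    have "e n - p * real n = (e n / real n - p) * real n" using True by (simp add: field_simps)
    then have "\<bar>e n - p * real n\<bar> = \<bar>e n / real n - p\<bar> * real n" by (simp add: abs_mult)
    also have "\<dots> \<le> \<epsilon> / 2 * real n" using N[of n] True by (intro mult_right_mono) auto
    finally show ?thesis using C0 by simp
  next
    case False
    have "\<bar>e n - p * real n\<bar> \<le> \<bar>e n\<bar> + \<bar>p\<bar> * real n" using abs_triangle_ineq4[of "e n" "p * real n"] by (simp add: abs_mult)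
    also have "\<dots> \<le> (1 + \<bar>p\<bar>) * real n" using bd[of n] by (simp add: distrib_right)
    also have "\<dots> \<le> C" unfolding C_def using False by (intro mult_left_mono) auto
    finally have "\<bar>e n - p * real n\<bar> \<le> C" .
    moreover have "0 \<le> \<epsilon> / 2 * real n" using \<epsilon> by simp
    ultimately show ?thesis by linarith
  qed
  show "\<forall>\<^sub>F \<nu> in at_top. dist ((\<integral>n. e n \<partial>measure_pmf (poisson_pmf \<nu>)) / \<nu>) p < \<epsilon>"
    using eventually_gt_at_top[of "2 * C / \<epsilon>"] eventually_gt_at_top[of 0]
  proof eventually_elim
    case (elim \<nu>)
    let ?P = "measure_pmf (poisson_pmf \<nu>)"
    note P = poisson_pmf_mean[OF elim(2)]
    have ie: "integrable ?P e" by (rule Bochner_Integration.integrable_bound[OF P(1)]) (use bd in auto)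
    have "(\<integral>n. e n \<partial>?P) - p * \<nu> = (\<integral>n. e n - p * real n \<partial>?P)" using ie P by simp
    also have "\<bar>\<dots>\<bar> \<le> (\<integral>n. \<bar>e n - p * real n\<bar> \<partial>?P)" by (rule integral_abs_bound)
    also have "\<dots> \<le> (\<integral>n. \<epsilon> / 2 * real n + C \<partial>?P)"
      using ie P(1) by (intro integral_mono bound) auto
    also have "\<dots> = \<epsilon> / 2 * \<nu> + C" using P by simp
    also have "\<dots> < \<epsilon> * \<nu>" using elim \<epsilon> by (simp add: field_simps)
    finally have "\<bar>(\<integral>n. e n \<partial>?P) - p * \<nu>\<bar> < \<epsilon> * \<nu>" .
    moreover have "(\<integral>n. e n \<partial>?P) / \<nu> - p = ((\<integral>n. e n \<partial>?P) - p * \<nu>) / \<nu>" using elim by (simp add: diff_divide_distrib)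
    ultimately show ?case using elim by (simp add: dist_real_def abs_divide divide_less_eq)
  qed
qed

section \<open>Degree counts of samples\<close>

lemma AE_lborel_dist_neq: "AE y in lborel. dist (a::'a::euclidean_space) y \<noteq> t"
proof -
  have "sphere a t \<in> null_sets lborel"
    using negligible_sphere[of a t] by (simp add: negligible_iff_null_sets null_sets_completion_iff)
  then show ?thesis by (rule AE_not_in[THEN AE_mp]) auto
qed

lemma AE_dens_measure:
  assumes "f \<in> borel_measurable borel" "AE y in lborel. P y"
  shows "AE y in dens_measure f. P y"
  unfolding dens_measure_def using assms by (subst AE_density) auto

text \<open>With one coordinate fresh and the others frozen, a coincidence places it at a given
  point and a tie places it on a given sphere. Both are null sets, and there are countably many
  index combinations.\<close>

lemma AE_iid_tie_free:
  fixes f :: "'a::euclidean_space \<Rightarrow> real"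
  assumes f: "f \<in> borel_measurable borel" and fp: "prob_space (dens_measure f)"
  shows "AE w in iid_space f. inj w \<and> tie_free (range w)"
proof -
  have [measurable]: "(\<lambda>w. w i) \<in> PiM UNIV (\<lambda>_::nat. dens_measure f) \<rightarrow>\<^sub>M borel" for i
    by (subst measurable_cong_sets[OF refl sets_dens_measure[of f, symmetric]]) (rule measurable_component_singleton, simp)
  have 1: "AE w in iid_space f. i \<noteq> j \<longrightarrow> w i \<noteq> w j" for i j
  proof (cases "i = j")
    case False
    have "AE w in PiM UNIV (\<lambda>_::nat. dens_measure f). w i \<noteq> w j"
    proof (rule AE_PiM_resampleI[OF fp, where i=j])
      show "AE w in PiM UNIV (\<lambda>_::nat. dens_measure f). AE y in dens_measure f. (w(j := y)) i \<noteq> (w(j := y)) j"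
      proof (rule AE_I2)
        fix w :: "nat \<Rightarrow> 'a"
        have "AE y in dens_measure f. y \<noteq> w i" by (rule AE_dens_measure[OF f AE_lborel_singleton])
        then show "AE y in dens_measure f. (w(j := y)) i \<noteq> (w(j := y)) j" using False by (auto elim!: eventually_mono)
      qed
      have "Measurable.pred (PiM UNIV (\<lambda>_::nat. dens_measure f)) (\<lambda>w. dist (w i) (w j) \<noteq> 0)" by measurable
      then show "Measurable.pred (PiM UNIV (\<lambda>_::nat. dens_measure f)) (\<lambda>w. w i \<noteq> w j)" by simp
    qed
    then show ?thesis unfolding iid_space_def by (auto elim!: eventually_mono)
  qed simp
  have 2: "AE w in iid_space f. m \<noteq> i \<longrightarrow> m \<noteq> j \<longrightarrow> dist (w i) (w j) \<noteq> dist (w i) (w m)" for i j m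
  proof (cases "m = i \<or> m = j")
    case False
    have "AE w in PiM UNIV (\<lambda>_::nat. dens_measure f). dist (w i) (w j) \<noteq> dist (w i) (w m)"
    proof (rule AE_PiM_resampleI[OF fp, where i=m])
      show "AE w in PiM UNIV (\<lambda>_::nat. dens_measure f). AE y in dens_measure f.
        dist ((w(m := y)) i) ((w(m := y)) j) \<noteq> dist ((w(m := y)) i) ((w(m := y)) m)"
      proof (rule AE_I2)
        fix w :: "nat \<Rightarrow> 'a"
        have "AE y in dens_measure f. dist (w i) y \<noteq> dist (w i) (w j)"
          by (rule AE_dens_measure[OF f AE_lborel_dist_neq])
        then show "AE y in dens_measure f.
          dist ((w(m := y)) i) ((w(m := y)) j) \<noteq> dist ((w(m := y)) i) ((w(m := y)) m)"
          using False by (auto elim!: eventually_mono)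
      qed
      have "Measurable.pred (PiM UNIV (\<lambda>_::nat. dens_measure f)) (\<lambda>w. dist (w i) (w j) - dist (w i) (w m) \<noteq> 0)"
        by measurable
      then show "Measurable.pred (PiM UNIV (\<lambda>_::nat. dens_measure f)) (\<lambda>w. dist (w i) (w j) \<noteq> dist (w i) (w m))"
        by simp
    qed
    then show ?thesis unfolding iid_space_def by (auto elim!: eventually_mono)
  qed auto
  have "AE w in iid_space f. \<forall>i j. i \<noteq> j \<longrightarrow> w i \<noteq> w j" using 1 by (simp add: AE_all_countable)
  moreover have "AE w in iid_space f. \<forall>i j m. m \<noteq> i \<longrightarrow> m \<noteq> j \<longrightarrow> dist (w i) (w j) \<noteq> dist (w i) (w m)"
    using 2 by (simp add: AE_all_countable)
  ultimately show ?thesis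
  proof eventually_elim
    case (elim w)
    have "inj w" using elim(1) by (auto simp: inj_def)
    moreover have "tie_free (range w)"
      unfolding tie_free_def
    proof (clarify)
      fix i j m assume "w m \<noteq> w i" "dist (w i) (w j) = dist (w i) (w m)"
      then show "w j = w m" using elim(2)[rule_format, of m i j] by auto
    qed
    ultimately show ?case by simp
  qed
qed

lemma V_iid_Suc_diff:
  fixes w :: "nat \<Rightarrow> 'a::euclidean_space"
  assumes U: "cone_cover (U :: 'a set)" and w: "tie_free (range w)"
  shows "\<bar>V_iid k l (Suc n) w - V_iid k l n w\<bar> \<le> real (k + 2 * k * card U + 1)"
proof -
  have "tie_free (insert (w n) (w ` {..<n}))" by (rule tie_free_subset[OF w]) auto
  from knn_count_deg_insert_diff[OF U _ this, of k l]
  show ?thesis by (simp add: V_iid_def lessThan_Suc)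
qed

text \<open>Both samples arise from the common remainder without index \<open>i\<close> by inserting
  one point, which costs the insertion bound twice.\<close>

lemma V_iid_resample_diff:
  fixes w :: "nat \<Rightarrow> 'a::euclidean_space"
  assumes U: "cone_cover (U :: 'a set)" and w: "tie_free (range w)" "tie_free (range (w(i := y)))" and i: "i < n"
  shows "\<bar>V_iid k l n w - V_iid k l n (w(i := y))\<bar> \<le> 2 * real (k + 2 * k * card U + 1)"
proof -
  let ?S = "w ` ({..<n} - {i})"
  have a: "w ` {..<n} = insert (w i) ?S" using i by auto
  have b: "(w(i := y)) ` {..<n} = insert y ?S" using i by auto
  have "tie_free (insert (w i) ?S)" by (rule tie_free_subset[OF w(1)]) auto
  from knn_count_deg_insert_diff[OF U _ this, of k l]
  have d1: "\<bar>real (knn_count_deg k l (insert (w i) ?S)) - real (knn_count_deg k l ?S)\<bar> \<le> real (k + 2 * k * card U + 1)" by simp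
  have "tie_free (insert y ?S)" unfolding b[symmetric] by (rule tie_free_subset[OF w(2)]) auto
  from knn_count_deg_insert_diff[OF U _ this, of k l]
  have d2: "\<bar>real (knn_count_deg k l (insert y ?S)) - real (knn_count_deg k l ?S)\<bar> \<le> real (k + 2 * k * card U + 1)" by simp
  have "\<bar>p - q\<bar> \<le> 2 * c" if "\<bar>p - s\<bar> \<le> c" "\<bar>q - s\<bar> \<le> c" for p q s c :: real using that by linarith
  from this[OF d1 d2] show ?thesis unfolding V_iid_def a b .
qed

lemma V_iid_bounds: "0 \<le> V_iid k l n w" "V_iid k l n w \<le> real n" "\<bar>V_iid k l n w\<bar> \<le> real n"
proof -
  have "knn_count_deg k l (w ` {..<n}) \<le> card (w ` {..<n})"
    unfolding knn_count_deg_def by (intro card_mono) auto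
  also have "\<dots> \<le> n" using card_image_le[of "{..<n}" w] by simp
  finally show "V_iid k l n w \<le> real n" "0 \<le> V_iid k l n w" "\<bar>V_iid k l n w\<bar> \<le> real n" by (auto simp: V_iid_def)
qed

lemma measurable_V_iid[measurable]:
  assumes "l \<ge> 1" shows "(\<lambda>w. V_iid k l n w) \<in> borel_measurable (iid_space f)"
  unfolding V_iid_def iid_space_def
  using measurable_knn_count_deg[OF _ assms, of "\<lambda>i w. w i" "PiM UNIV (\<lambda>_. dens_measure f)" k n] by simp

lemma V_iid_eq_sum:
  assumes "inj w"
  shows "V_iid k l n w = (\<Sum>i<n. if knn_deg k (w ` {..<n}) (w i) = l then 1 else 0)"
proof -
  have "{x \<in> w ` {..<n}. knn_deg k (w ` {..<n}) x = l} = w ` {i \<in> {..<n}. knn_deg k (w ` {..<n}) (w i) = l}" by auto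
  then have "V_iid k l n w = real (card {i \<in> {..<n}. knn_deg k (w ` {..<n}) (w i) = l})"
    unfolding V_iid_def knn_count_deg_def using assms by (simp add: card_image inj_on_subset[OF assms])
  also have "\<dots> = (\<Sum>i<n. if knn_deg k (w ` {..<n}) (w i) = l then 1 else 0)"
    by (simp add: sum.If_cases Int_def)
  finally show ?thesis .
qed

text \<open>For \<open>n > k\<close> every degree is at least \<open>k\<close>, and without ties at
  most \<open>k + k * card U\<close>; so each of the \<open>n\<close> distinct points is counted
  exactly once.\<close>

lemma sum_V_iid:
  fixes w :: "nat \<Rightarrow> 'a::euclidean_space"
  assumes w: "inj w" "tie_free (range w)" and U: "cone_cover (U :: 'a set)" and n: "n > k" and K: "K \<ge> k + k * card U"
  shows "(\<Sum>l=k..K. V_iid k l n w) = real n"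
proof -
  let ?X = "w ` {..<n}"
  have deg: "knn_deg k ?X (w i) \<in> {k..K}" if "i < n" for i
  proof -
    have mem: "w i \<in> ?X" using that by simp
    have c: "card ?X > k" using n w(1) by (simp add: card_image inj_on_subset)
    have tf: "tie_free ?X" by (rule tie_free_subset[OF w(2)]) auto
    show ?thesis using knn_deg_ge[OF _ mem c] knn_deg_le(2)[OF U tf mem, of k] K by simp
  qed
  have "(\<Sum>l=k..K. V_iid k l n w) = (\<Sum>i<n. \<Sum>l=k..K. if knn_deg k ?X (w i) = l then 1 else 0)"
    unfolding V_iid_eq_sum[OF w(1)] by (rule sum.swap)
  also have "\<dots> = (\<Sum>i<n. 1)" using deg by (intro sum.cong) (auto simp: sum.delta)
  finally show ?thesis by simp
qed

lemma measurable_deg_at_index: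
  assumes l: "l \<ge> 1"
  shows "(\<lambda>w. if knn_deg k (w ` {..<n}) (w i) = l then 1 else (0::real)) \<in> borel_measurable (iid_space f)"
proof -
  have eq: "w ` {..<n} = {z. \<exists>i. i < n \<and> z = w i}" for w :: "nat \<Rightarrow> 'a" by auto
  have "Measurable.pred (iid_space f) (\<lambda>w. knn_deg k {z. \<exists>i. i < n \<and> z = w i} (w i) = l)"
    unfolding iid_space_def by (rule measurable_knn_deg) (use l in measurable)
  then show ?thesis unfolding eq by measurable
qed

text \<open>Transposing the indices 0 and \<open>i\<close> preserves the product measure and leaves
  the set of the first \<open>n\<close> points unchanged.\<close>

lemma deg_at_index_exchangeable:
  assumes l: "l \<ge> 1" and fp: "prob_space (dens_measure f)" and i: "i < n"
  shows "(\<integral>w. (if knn_deg k (w ` {..<n}) (w i) = l then 1 else (0::real)) \<partial>iid_space f) =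
     (\<integral>w. (if knn_deg k (w ` {..<n}) (w 0) = l then 1 else 0) \<partial>iid_space f)"
proof -
  define t where "t = Transposition.transpose 0 i"
  have e: "distr (iid_space f) (iid_space f) (\<lambda>w n. w (t n)) = iid_space f"
    using distr_PiM_reindex[of UNIV "\<lambda>_. dens_measure f" t UNIV] fp
    unfolding iid_space_def t_def by (simp add: restrict_def)
  have m: "(\<lambda>w n. w (t n)) \<in> iid_space f \<rightarrow>\<^sub>M iid_space f"
    unfolding iid_space_def by (rule measurable_PiM_single') (auto simp: space_PiM)
  have im: "(\<lambda>n. w (t n)) ` {..<n} = w ` {..<n}" for w :: "nat \<Rightarrow> 'a"
  proof -
    have "t ` {..<n} = {..<n}" unfolding t_def using i by (intro transpose_image_eq) auto
    then show ?thesis by (metis image_image)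
  qed
  have "(\<integral>w. (if knn_deg k (w ` {..<n}) (w 0) = l then 1 else (0::real)) \<partial>iid_space f) =
    (\<integral>w. (if knn_deg k (w ` {..<n}) (w 0) = l then 1 else 0) \<partial>distr (iid_space f) (iid_space f) (\<lambda>w n. w (t n)))"
    by (simp only: e)
  also have "\<dots> = (\<integral>w. (if knn_deg k (w ` {..<n}) (w i) = l then 1 else 0) \<partial>iid_space f)"
    by (subst integral_distr[OF m measurable_deg_at_index[OF l]]) (simp only: im, simp add: t_def)
  finally show ?thesis ..
qed

lemma measurable_deg_prob:
  fixes f :: "'a::euclidean_space \<Rightarrow> real"
  assumes l: "l \<ge> 1" and fp: "prob_space (dens_measure f)"
  shows "(\<lambda>x. deg_prob f k l n x) \<in> borel_measurable borel"
proof -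
  interpret I: prob_space "iid_space f" unfolding iid_space_def by (intro prob_space_PiM fp)
  have eq: "w ` {..<n} = {z. \<exists>i. i < n \<and> z = w i}" for w :: "nat \<Rightarrow> 'a" by auto
  have "Measurable.pred (borel \<Otimes>\<^sub>M iid_space f) (\<lambda>p. knn_deg k (insert (fst p) {z. \<exists>i. i < n \<and> z = snd p i}) (fst p) = l)"
    unfolding iid_space_def by (rule measurable_knn_deg_insert[where x=fst]) (use l in measurable)
  then have "(\<lambda>(x, w). if knn_deg k (insert x (w ` {..<n})) x = l then 1 else (0::real)) \<in> borel_measurable (borel \<Otimes>\<^sub>M iid_space f)"
    unfolding eq case_prod_beta' by measurable
  then show ?thesis unfolding deg_prob_def by (rule I.borel_measurable_lebesgue_integral)
qed

lemma deg_prob_bounds: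
  assumes fp: "prob_space (dens_measure f)"
  shows "\<bar>deg_prob f k l n x\<bar> \<le> 1"
proof -
  interpret I: prob_space "iid_space f" unfolding iid_space_def by (intro prob_space_PiM fp)
  show ?thesis unfolding deg_prob_def by (rule I.abs_integral_le_const) simp
qed

text \<open>The count is a sum of \<open>Suc n\<close> exchangeable indicators; conditioning on the
  position \<open>x\<close> of the first point leaves \<open>n\<close> independent points, whence
  \<open>deg_prob\<close> with \<open>n\<close>.\<close>

lemma expectation_V_iid:
  fixes f :: "'a::euclidean_space \<Rightarrow> real"
  assumes f: "f \<in> borel_measurable borel" and fp: "prob_space (dens_measure f)" and l: "l \<ge> 1"
  shows "(\<integral>w. V_iid k l (Suc n) w \<partial>iid_space f) = real (Suc n) * (\<integral>x. deg_prob f k l n x \<partial>dens_measure f)"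
proof -
  interpret I: prob_space "iid_space f" unfolding iid_space_def by (intro prob_space_PiM fp)
  let ?h = "\<lambda>i w. if knn_deg k (w ` {..<Suc n}) (w i) = l then 1 else (0::real)"
  have ih: "integrable (iid_space f) (?h i)" for i
    by (rule I.integrable_bounded[where D=1], rule measurable_deg_at_index[OF l]) simp
  have "(\<integral>w. V_iid k l (Suc n) w \<partial>iid_space f) = (\<integral>w. (\<Sum>i<Suc n. ?h i w) \<partial>iid_space f)"
  proof (rule integral_cong_AE)
    show "AE w in iid_space f. V_iid k l (Suc n) w = (\<Sum>i<Suc n. ?h i w)"
      using AE_iid_tie_free[OF f fp] by eventually_elim (simp only: V_iid_eq_sum)
    show "(\<lambda>w. \<Sum>i<Suc n. ?h i w) \<in> borel_measurable (iid_space f)"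
      by (intro borel_measurable_sum measurable_deg_at_index[OF l])
  qed (rule measurable_V_iid[OF l])
  also have "\<dots> = (\<Sum>i<Suc n. (\<integral>w. ?h i w \<partial>iid_space f))" by (rule Bochner_Integration.integral_sum) (rule ih)
  also have "\<dots> = (\<Sum>i<Suc n. (\<integral>w. ?h 0 w \<partial>iid_space f))"
    by (intro sum.cong refl deg_at_index_exchangeable[OF l fp]) simp
  also have "\<dots> = real (Suc n) * (\<integral>w. ?h 0 w \<partial>iid_space f)" by (simp only: sum_constant card_lessThan)
  also have "(\<integral>w. ?h 0 w \<partial>iid_space f) = (\<integral>z. (\<integral>w. ?h 0 (case_nat z w) \<partial>iid_space f) \<partial>dens_measure f)"
    unfolding iid_space_def
    by (rule integral_PiM_nat_Suc[OF fp measurable_deg_at_index[OF l, unfolded iid_space_def], where D=1]) simp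
  also have "\<dots> = (\<integral>x. deg_prob f k l n x \<partial>dens_measure f)"
  proof -
    have "case_nat z w ` {..<Suc n} = insert z (w ` {..<n})" for z and w :: "nat \<Rightarrow> 'a"
      by (simp add: lessThan_Suc_eq_insert_0 image_image)
    then show ?thesis unfolding deg_prob_def by simp
  qed
  finally show ?thesis .
qed

lemma AE_isCont_piecewise:
  assumes "piecewise_continuous_Rd f" shows "AE x in lborel. isCont f x"
proof -
  obtain \<A> where A: "\<And>A. A \<in> \<A> \<Longrightarrow> open A \<and> continuous_on A f" "UNIV - \<Union>\<A> \<in> null_sets lborel"
    using assms unfolding piecewise_continuous_Rd_def by blast
  have "AE x in lborel. x \<notin> UNIV - \<Union>\<A>" using A(2) by (rule AE_not_in)
  then show ?thesis
    by eventually_elim (use A(1) continuous_on_eq_continuous_at in blast)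
qed

lemma expectation_V_iid_tendsto:
  fixes f :: "real^'d::finite \<Rightarrow> real"
  assumes f: "f \<in> borel_measurable borel" and f0: "\<And>x. f x \<ge> 0" and fp: "prob_space (dens_measure f)"
    and fb: "\<And>x. f x \<le> C" and pwc: "piecewise_continuous_Rd f" and l: "l \<ge> 1"
  shows "(\<lambda>n. (\<integral>w. V_iid k l n w \<partial>iid_space f) / real n) \<longlonglongrightarrow> p_star TYPE('d) k l"
proof -
  interpret M: prob_space "dens_measure f" by fact
  have "(\<lambda>n. \<integral>x. deg_prob f k l n x \<partial>dens_measure f) \<longlonglongrightarrow> (\<integral>x. p_star TYPE('d) k l \<partial>dens_measure f)"
  proof (rule integral_dominated_convergence[where w="\<lambda>_. 1"])
    show "(\<lambda>x. deg_prob f k l n x) \<in> borel_measurable (dens_measure f)" for n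
      using measurable_deg_prob[OF l fp] by (simp add: dens_measure_def)
    show "AE x in dens_measure f. norm (deg_prob f k l n x) \<le> 1" for n
      using deg_prob_bounds[OF fp] by auto
    \<comment> \<open>Points with \<open>f x = 0\<close> carry no mass under
      \<open>dens_measure f\<close>, so the pointwise limit is needed only where \<open>f\<close> is
      positive.\<close>
    have "AE x in lborel. 0 < ennreal (f x) \<longrightarrow> (\<lambda>n. deg_prob f k l n x) \<longlonglongrightarrow> p_star TYPE('d) k l"
      using AE_isCont_piecewise[OF pwc]
    proof eventually_elim
      case (elim x)
      then show ?case using deg_prob_tendsto[OF f f0 fp fb _ elim l, of k] by simp
    qed
    then show "AE x in dens_measure f. (\<lambda>n. deg_prob f k l n x) \<longlonglongrightarrow> p_star TYPE('d) k l"
      unfolding dens_measure_def using f by (subst AE_density) auto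
  qed auto
  then have "(\<lambda>n. \<integral>x. deg_prob f k l n x \<partial>dens_measure f) \<longlonglongrightarrow> p_star TYPE('d) k l"
    using M.prob_space by simp
  then have "(\<lambda>n. (\<integral>w. V_iid k l (Suc n) w \<partial>iid_space f) / real (Suc n)) \<longlonglongrightarrow> p_star TYPE('d) k l"
    unfolding expectation_V_iid[OF f fp l] by (simp del: of_nat_Suc)
  then show ?thesis by (rule LIMSEQ_imp_Suc)
qed

lemma variance_V_iid_le:
  fixes f :: "'a::euclidean_space \<Rightarrow> real"
  assumes f: "f \<in> borel_measurable borel" and fp: "prob_space (dens_measure f)" and l: "l \<ge> 1"
    and U: "cone_cover (U :: 'a set)"
  shows "(\<integral>w. (V_iid k l n w - (\<integral>w. V_iid k l n w \<partial>iid_space f))\<^sup>2 \<partial>iid_space f) \<le> real n * (2 * real (k + 2 * k * card U + 1))\<^sup>2"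
  unfolding iid_space_def
proof (rule variance_bounded_differences[OF fp])
  show "V_iid k l n \<in> borel_measurable (PiM UNIV (\<lambda>_::nat. dens_measure f))"
    using measurable_V_iid[OF l] unfolding iid_space_def .
  show "\<bar>V_iid k l n w\<bar> \<le> real n" for w :: "nat \<Rightarrow> 'a" by (rule V_iid_bounds(3))
  show "V_iid k l n w = V_iid k l n w'" if "\<And>i. i < n \<Longrightarrow> w i = w' i" for w w' :: "nat \<Rightarrow> 'a"
  proof -
    have "w ` {..<n} = w' ` {..<n}" using that by (intro image_cong) auto
    then show ?thesis by (simp add: V_iid_def)
  qed
  have tf: "AE w in PiM UNIV (\<lambda>_::nat. dens_measure f). tie_free (range w)"
    using AE_iid_tie_free[OF f fp] unfolding iid_space_def by (auto elim!: eventually_mono)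
  show "AE w in PiM UNIV (\<lambda>_::nat. dens_measure f). AE y in dens_measure f.
     \<bar>V_iid k l n w - V_iid k l n (w(i := y))\<bar> \<le> 2 * real (k + 2 * k * card U + 1)" if i: "i < n" for i
    \<comment> \<open>The difference bound requires that both the sample and the resampled sequence
      have no ties.\<close>
    using tf AE_PiM_resample[OF fp tf, of i]
  proof eventually_elim
    case (elim w)
    show ?case using elim(2) by eventually_elim (rule V_iid_resample_diff[OF U elim(1) _ i])
  qed
qed

lemma AE_V_iid_tendsto:
  fixes f :: "real^'d::finite \<Rightarrow> real"
  assumes f: "f \<in> borel_measurable borel" and f0: "\<And>x. f x \<ge> 0" and fp: "prob_space (dens_measure f)"
    and fb: "\<And>x. f x \<le> C" and pwc: "piecewise_continuous_Rd f" and l: "l \<ge> 1"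
  shows "AE w in iid_space f. (\<lambda>n. V_iid k l n w / real n) \<longlonglongrightarrow> p_star TYPE('d) k l"
proof -
  interpret I: prob_space "iid_space f" unfolding iid_space_def by (intro prob_space_PiM fp)
  obtain U :: "(real^'d) set" where U: "cone_cover U" using cone_cover_exists by blast
  define c where "c = 2 * real (k + 2 * k * card U + 1)"
  define e where "e n = (\<integral>w. V_iid k l n w \<partial>iid_space f)" for n
  \<comment> \<open>Starting at \<open>Suc m\<close> avoids a division by zero. The variance bound
    makes the second moment of \<open>Y m\<close> at most \<open>c ^ 2 / (Suc m) ^ 2\<close>, which
    is summable.\<close>
  define Y where "Y m w = (V_iid k l ((Suc m)\<^sup>2) w - e ((Suc m)\<^sup>2)) / real ((Suc m)\<^sup>2)" for m and w :: "nat \<Rightarrow> real^'d"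
  have [measurable]: "V_iid k l n \<in> borel_measurable (iid_space f)" for n by (rule measurable_V_iid[OF l])
  have eb: "\<bar>e n\<bar> \<le> real n" for n unfolding e_def by (rule I.abs_integral_le_const) (rule V_iid_bounds)
  have int: "integrable (iid_space f) (\<lambda>w. (V_iid k l n w - e n)\<^sup>2)" for n
  proof (rule I.integrable_bounded[where D="(2 * real n)\<^sup>2"])
    fix w
    have "\<bar>V_iid k l n w - e n\<bar> \<le> \<bar>2 * real n\<bar>" using V_iid_bounds(3)[of k l n w] eb[of n] by linarith
    then show "\<bar>(V_iid k l n w - e n)\<^sup>2\<bar> \<le> (2 * real n)\<^sup>2" by (simp only: abs_le_square_iff abs_power2)
  qed measurable
  have Y0: "AE w in iid_space f. (\<lambda>m. Y m w) \<longlonglongrightarrow> 0"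
  proof (rule AE_tendsto_zero_of_summable_second_moments)
    show "integrable (iid_space f) (\<lambda>w. (Y m w)\<^sup>2)" for m
      unfolding Y_def power_divide using int by simp
    show "(\<integral>w. (Y m w)\<^sup>2 \<partial>iid_space f) \<le> c\<^sup>2 * (1 / (real (Suc m))\<^sup>2)" for m
    proof -
      let ?n = "(Suc m)\<^sup>2"
      have "(\<integral>w. (Y m w)\<^sup>2 \<partial>iid_space f) = (\<integral>w. (V_iid k l ?n w - e ?n)\<^sup>2 \<partial>iid_space f) / (real ?n)\<^sup>2"
        unfolding Y_def power_divide by simp
      also have "\<dots> \<le> real ?n * c\<^sup>2 / (real ?n)\<^sup>2"
        unfolding e_def c_def by (intro divide_right_mono variance_V_iid_le[OF f fp l U]) simp
      also have "\<dots> = c\<^sup>2 * (1 / real ?n)" by (simp add: power2_eq_square)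
      finally show ?thesis by (simp only: of_nat_power)
    qed
    have "summable (\<lambda>n. inverse (real (Suc n) ^ 2))"
      using inverse_power_summable[of 2, where 'a=real] by (subst summable_Suc_iff[of "\<lambda>n. inverse (real n ^ 2)"]) simp
    then show "summable (\<lambda>m. c\<^sup>2 * (1 / (real (Suc m))\<^sup>2))"
      by (intro summable_mult) (simp only: inverse_eq_divide)
  qed
  have elim_e: "(\<lambda>n. e n / real n) \<longlonglongrightarrow> p_star TYPE('d) k l"
    unfolding e_def by (rule expectation_V_iid_tendsto[OF f f0 fp fb pwc l])
  have "filterlim (\<lambda>m. (Suc m)\<^sup>2) at_top sequentially"
    by (rule filterlim_subseq) (auto simp: strict_mono_def intro!: power_strict_mono)
  from filterlim_compose[OF elim_e this]
  have e2: "(\<lambda>m. e ((Suc m)\<^sup>2) / real ((Suc m)\<^sup>2)) \<longlonglongrightarrow> p_star TYPE('d) k l" .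
  from Y0 AE_iid_tie_free[OF f fp] show ?thesis
  proof eventually_elim
    case (elim w)
    have "(\<lambda>m. Y m w + e ((Suc m)\<^sup>2) / real ((Suc m)\<^sup>2)) \<longlonglongrightarrow> 0 + p_star TYPE('d) k l"
      by (intro tendsto_add elim(1) e2)
    then have "(\<lambda>m. V_iid k l ((Suc m)\<^sup>2) w / real ((Suc m)\<^sup>2)) \<longlonglongrightarrow> p_star TYPE('d) k l"
      unfolding Y_def by (simp add: diff_divide_distrib)
    then have "(\<lambda>m. V_iid k l (m\<^sup>2) w / real (m\<^sup>2)) \<longlonglongrightarrow> p_star TYPE('d) k l"
      by (rule LIMSEQ_imp_Suc)
    moreover have "\<bar>V_iid k l (Suc n) w - V_iid k l n w\<bar> \<le> real (k + 2 * k * card U + 1)" for n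
      by (rule V_iid_Suc_diff[OF U]) (use elim(2) in blast)
    ultimately show ?case by (rule average_tendsto_from_squares[rotated])
  qed
qed

text \<open>Fubini applies although the count is unbounded: it is at most the number of points
  drawn, whose Poisson mean is finite.\<close>

lemma expectation_V_poisson:
  fixes f :: "'a::euclidean_space \<Rightarrow> real"
  assumes fp: "prob_space (dens_measure f)" and l: "l \<ge> 1" and \<nu>: "\<nu> > 0"
  shows "(\<integral>p. V_poisson k l p \<partial>poisson_space \<nu> f) = (\<integral>n. (\<integral>w. V_iid k l n w \<partial>iid_space f) \<partial>measure_pmf (poisson_pmf \<nu>))"
proof -
  interpret I: prob_space "iid_space f" unfolding iid_space_def by (intro prob_space_PiM fp)
  let ?P = "measure_pmf (poisson_pmf \<nu>)"
  interpret PP: pair_prob_space ?P "iid_space f" by unfold_locales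
  note [measurable] = measurable_V_iid[OF l]
  have V: "V_poisson k l p = V_iid k l (fst p) (snd p)" for p :: "nat \<times> (nat \<Rightarrow> 'a)"
    by (simp add: V_poisson_def V_iid_def)
  have m: "(\<lambda>p. V_iid k l (fst p) (snd p)) \<in> borel_measurable (?P \<Otimes>\<^sub>M iid_space f)"
    by (rule measurable_compose_countable[where g=fst]) measurable
  have "integrable (?P \<Otimes>\<^sub>M iid_space f) (\<lambda>p. V_iid k l (fst p) (snd p))"
  proof (rule PP.Fubini_integrable[OF m])
    have iV: "integrable (iid_space f) (\<lambda>w. V_iid k l n w)" for n
      by (rule I.integrable_bounded[OF _ V_iid_bounds(3)]) measurable
    then show "AE n in ?P. integrable (iid_space f) (\<lambda>w. V_iid k l (fst (n, w)) (snd (n, w)))" by simp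
    have "\<bar>\<integral>w. norm (V_iid k l n w) \<partial>iid_space f\<bar> \<le> real n" for n
      by (rule I.abs_integral_le_const) (use V_iid_bounds in auto)
    then show "integrable ?P (\<lambda>n. \<integral>w. norm (V_iid k l (fst (n, w)) (snd (n, w))) \<partial>iid_space f)"
      by (intro Bochner_Integration.integrable_bound[OF poisson_pmf_mean(1)[OF \<nu>]]) auto
  qed
  from PP.integral_fst'[OF this] show ?thesis unfolding poisson_space_def V by simp
qed

theorem theorem8p1:
  fixes f :: "real^'d \<Rightarrow> real" and k :: nat
  assumes k_pos: "k \<ge> 1"
    and f_meas: "f \<in> borel_measurable lborel"
    and f_nonneg: "\<And>x. f x \<ge> 0"
    and f_prob: "prob_space (dens_measure f)"
    and f_bdd: "\<exists>B. \<forall>x. f x \<le> B"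
    and f_pwc: "piecewise_continuous_Rd f"
  shows "\<exists>K > k.
     (\<forall>l. k \<le> l \<and> l \<le> K \<longrightarrow>
        ((\<lambda>\<nu>. (\<integral>p. V_poisson k l p \<partial>poisson_space \<nu> f) / \<nu>)
           \<longlongrightarrow> p_star TYPE('d) k l) at_top)
   \<and> (\<Sum>l = k..K. p_star TYPE('d) k l) = 1
   \<and> (AE \<omega> in iid_space f. \<forall>l. k \<le> l \<and> l \<le> K \<longrightarrow>
        (\<lambda>n. V_iid k l n \<omega> / real n) \<longlonglongrightarrow> p_star TYPE('d) k l)
   \<and> (\<forall>l. k \<le> l \<and> l \<le> K \<longrightarrow>
        (\<lambda>n. (\<integral>\<omega>. V_iid k l n \<omega> \<partial>iid_space f) / real n) \<longlonglongrightarrow> p_star TYPE('d) k l)"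
proof -
  interpret I: prob_space "iid_space f" unfolding iid_space_def by (intro prob_space_PiM f_prob)
  have f: "f \<in> borel_measurable borel" using f_meas by simp
  obtain C where C: "\<And>x. f x \<le> C" using f_bdd by blast
  obtain U :: "(real^'d) set" where U: "cone_cover U" using cone_cover_exists by blast
  \<comment> \<open>The degree bound without ties is \<open>k + k * card U\<close>; the additional 1
    ensures \<open>K > k\<close> whatever \<open>U\<close> is.\<close>
  define K where "K = k + k * card U + 1"
  note lim = expectation_V_iid_tendsto[OF f f_nonneg f_prob C f_pwc]
  have l1: "l \<ge> 1" if "k \<le> l" for l using that k_pos by simp
  have poisson: "((\<lambda>\<nu>. (\<integral>p. V_poisson k l p \<partial>poisson_space \<nu> f) / \<nu>) \<longlongrightarrow> p_star TYPE('d) k l) at_top" if l: "l \<ge> 1" for l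
  proof -
    have lp: "((\<lambda>\<nu>. (\<integral>n. (\<integral>w. V_iid k l n w \<partial>iid_space f) \<partial>measure_pmf (poisson_pmf \<nu>)) / \<nu>) \<longlongrightarrow> p_star TYPE('d) k l) at_top"
      by (rule poisson_average_tendsto[OF lim[OF l]]) (rule I.abs_integral_le_const, rule V_iid_bounds)
    have "\<forall>\<^sub>F \<nu> in at_top. (\<integral>p. V_poisson k l p \<partial>poisson_space \<nu> f) / \<nu> =
       (\<integral>n. (\<integral>w. V_iid k l n w \<partial>iid_space f) \<partial>measure_pmf (poisson_pmf \<nu>)) / \<nu>"
      using eventually_gt_at_top[of 0] by eventually_elim (simp add: expectation_V_poisson[OF f_prob l])
    from tendsto_cong[OF this] lp show ?thesis by blast
  qed
  \<comment> \<open>For \<open>n > k\<close> the normalised expected counts sum to exactly 1, and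
    this constant sequence converges to the sum of the limits.\<close>
  have sum1: "(\<Sum>l=k..K. p_star TYPE('d) k l) = 1"
  proof -
    have ls: "(\<lambda>n. \<Sum>l=k..K. (\<integral>w. V_iid k l n w \<partial>iid_space f) / real n) \<longlonglongrightarrow> (\<Sum>l=k..K. p_star TYPE('d) k l)"
      by (intro tendsto_sum lim l1) simp
    have "\<forall>\<^sub>F n in sequentially. (\<Sum>l=k..K. (\<integral>w. V_iid k l n w \<partial>iid_space f) / real n) = 1"
      using eventually_gt_at_top[of k]
    proof eventually_elim
      case (elim n)
      have "(\<Sum>l=k..K. \<integral>w. V_iid k l n w \<partial>iid_space f) = (\<integral>w. (\<Sum>l=k..K. V_iid k l n w) \<partial>iid_space f)"
        by (rule Bochner_Integration.integral_sum[symmetric], rule I.integrable_bounded[OF _ V_iid_bounds(3)])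
          (auto intro!: measurable_V_iid l1)
      also have "\<dots> = (\<integral>w. real n \<partial>iid_space f)"
      proof (rule integral_cong_AE)
        show "(\<lambda>w. \<Sum>l=k..K. V_iid k l n w) \<in> borel_measurable (iid_space f)"
          by (intro borel_measurable_sum measurable_V_iid l1) simp
        show "AE w in iid_space f. (\<Sum>l=k..K. V_iid k l n w) = real n"
          using AE_iid_tie_free[OF f f_prob]
        proof eventually_elim
          case (elim w)
          then show ?case using \<open>k < n\<close> by (intro sum_V_iid[OF _ _ U]) (auto simp: K_def)
        qed
      qed simp
      finally show ?case using elim by (simp add: sum_divide_distrib[symmetric] I.prob_space)
    qed
    from tendsto_cong[OF this] ls
    have "(\<lambda>n::nat. 1::real) \<longlonglongrightarrow> (\<Sum>l=k..K. p_star TYPE('d) k l)" by blast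
    then show ?thesis by (simp add: LIMSEQ_const_iff)
  qed
  have "AE w in iid_space f. \<forall>l\<in>{k..K}. (\<lambda>n. V_iid k l n w / real n) \<longlonglongrightarrow> p_star TYPE('d) k l"
    by (intro AE_finite_allI AE_V_iid_tendsto[OF f f_nonneg f_prob C f_pwc] l1) auto
  then have ae: "AE \<omega> in iid_space f. \<forall>l. k \<le> l \<and> l \<le> K \<longrightarrow> (\<lambda>n. V_iid k l n \<omega> / real n) \<longlonglongrightarrow> p_star TYPE('d) k l"
    by eventually_elim auto
  show ?thesis
    by (rule exI[of _ K]) (use poisson sum1 ae lim l1 in \<open>auto simp: K_def\<close>)
qed

end
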